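(* Let $\mathcal H:\mathcal P_2(\mathbb R^d\times\mathbb R^d)\to\mathbb R$ be the Hamiltonian defined in the context. Then there exists a sequence $(\mathcal H_n)_{n\ge1}\subset\mathcal C^6(\mathcal P_2(\mathbb R^d\times\mathbb R^d))$ with bounded derivatives such that $$\lim_{n\to+\infty}\mathcal H_n(\tilde\mu)=\mathcal H(\tilde\mu),\qquad\tilde\mu\in\mathcal P_2(\mathbb R^d\times\mathbb R^d).$$
   Context: $d=d_1+d_2$; $\mathcal P_2(\mathbb R^m)$ is the space of probability measures with finite second moment; $\mu_\xi$ is the law of $\xi$. The Wasserstein derivative $\partial_\mu U(\mu,x)$ is characterized by $U(\mathrm{Law}(\xi+\eta))-U(\mathrm{Law}(\xi))=\mathbb E[\partial_\mu U(\mathrm{Law}(\xi),\xi)\cdot\eta]+o(\mathbb E[|\eta|^2]^{1/2})$; $\mathcal C^6(\mathcal P_2(\mathbb R^m))$ is the set of functions for which all $\partial^{i_1}_{x_1}\cdots\partial^{i_j}_{x_j}\partial^j_\mu U$ with $j\ge1$, $i_1+\cdots+i_j+j\le6$ exist and are jointly continuous. Let $\lambda>0$, $\rho>0$, $\kappa_1,\kappa_2\ge0$, $\phi,\tilde\phi\in\mathbb R^{d_2\times d_1}$, $f:\mathcal P_2(\mathbb R^{d_1})\to\mathbb R$, $\Phi:\mathbb R^{d_2}\to\mathbb R$, $U:\mathbb R^{d_1}\times\mathbb R^{d_2}\times\mathcal P_2(\mathbb R^{d_1})\to\mathbb R$. For $(M,Q,\tilde p_1,\tilde p_2)\in L^2(\Omega;\mathbb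 R^{d_1}\times\mathbb R^{d_2}\times\mathbb R^{d_1}\times\mathbb R^{d_2})$, $$\mathcal H(\mathrm{Law}(M,Q,\tilde p_1,\tilde p_2))=\inf_{\xi\in L^2(\Omega;\mathbb R^{d_1})}\mathbb E\big[(-\tilde p_1-\phi^\top\tilde p_2-\tilde\phi^\top\mathbb E\tilde p_2)\cdot\xi+U(\xi,Q,\mu_\xi)\big]-\rho\,\mathbb E[Q\cdot\tilde p_2]+f(\mu_M)+\frac{\kappa_2^2}{4\lambda}\mathbb E|\tilde p_2|^2+\Phi^*(\kappa_1\mathbb E\tilde p_2),$$ $\Phi^*(\beta)=\sup_{\alpha\in\mathbb R^{d_2}}\{\alpha\cdot\beta-\Phi(\alpha)\}$. Standing assumptions, for some $C,\delta>0$: $f,\Phi,U$ have continuous derivatives up to order six; all derivatives of $f$ (in the sense $\partial^{l_1}_{m_1}\cdots\partial^{l_k}_{m_k}\partial^k_\mu f$) of total order between 2 and 6 are bounded by $C$, as are all mixed derivatives $\partial^{l_0}_\xi\partial^{\tilde l_0}_Q\partial^{l_1}_{\xi_1}\cdots\partial^{l_k}_{\xi_k}\partial^k_\mu U$ of total order between 2 and 6; $D^2\Phi\ge\delta I_{d_2}$; $f(\mu_{\gamma M_1+(1-\gamma)M_2})\le\gamma f(\mu_{M_1})+(1-\gamma)f(\mu_{M_2})$ for $\gamma\in[0,1]$, $M_1,M_2\in L^2(\Omega;\mathbb R^{d_1})$; $D^2_{QQ}U\le0$; and, for all $\xi,\eta\in L^2(\Omega;\mathbb R^{d_1})$ (with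 $(\breve\xi,\breve\eta)$ an independent copy of $(\xi,\eta)$ and $\breve{\mathbb E}$ the expectation over it), $$\mathbb E[\langle D_\xi U(\xi,Q,\mu_\xi)-D_\xi U(\eta,Q,\mu_\eta),\xi-\eta\rangle]+\mathbb E\breve{\mathbb E}[\langle\partial_\mu U(\xi,Q,\mu_\xi,\breve\xi)-\partial_\mu U(\eta,Q,\mu_\eta,\breve\eta),\xi-\eta\rangle]\ge\delta\,\mathbb E|\xi-\eta|^2 .$$ *)

theory Defs
  imports "HOL-Probability.Probability"
begin

section \<open>Square-integrable random variables and the Wasserstein space\<close>

text \<open>
  The underlying probability space is arbitrary, except that it carries a uniformly distributed
  random variable (equivalently, it is atomless). So every element of \<open>P2\<close> is the law of some
  element of \<open>L2 \<Omega>\<close>.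
\<close>

definition rich_prob_space :: "'w measure \<Rightarrow> bool" where
  "rich_prob_space \<Omega> \<longleftrightarrow> prob_space \<Omega> \<and>
     (\<exists>u \<in> borel_measurable \<Omega>. distr \<Omega> borel u = uniform_measure lborel {0..1::real})"

definition L2 :: "'w measure \<Rightarrow> ('w \<Rightarrow> 'a::euclidean_space) set" where
  "L2 \<Omega> = {\<xi> \<in> borel_measurable \<Omega>. integrable \<Omega> (\<lambda>\<omega>. (norm (\<xi> \<omega>))\<^sup>2)}"

definition P2 :: "'a::euclidean_space measure set" where
  "P2 = {\<mu>. prob_space \<mu> \<and> sets \<mu> = sets borel \<and> integrable \<mu> (\<lambda>x. (norm x)\<^sup>2)}"

definition law :: "'w measure \<Rightarrow> ('w \<Rightarrow> 'a::euclidean_space) \<Rightarrow> 'a measure" where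
  "law \<Omega> \<xi> = distr \<Omega> borel \<xi>"

definition couplings ::
    "'a::euclidean_space measure \<Rightarrow> 'a measure \<Rightarrow> ('a \<times> 'a) measure set" where
  "couplings \<mu> \<nu> = {\<pi>. prob_space \<pi> \<and> sets \<pi> = sets borel \<and>
     distr \<pi> borel fst = \<mu> \<and> distr \<pi> borel snd = \<nu>}"

definition W2 :: "'a::euclidean_space measure \<Rightarrow> 'a measure \<Rightarrow> real" where
  "W2 \<mu> \<nu> = sqrt (INF \<pi> \<in> couplings \<mu> \<nu>. LINT p|\<pi>. (dist (fst p) (snd p))\<^sup>2)"

section \<open>Derivatives on the Wasserstein space\<close>

text \<open>
  \<open>g\<close> is the Wasserstein derivative of \<open>U\<close> at \<open>\<mu>\<close>. The derivative is determined by the expansion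
  only \<open>\<mu>\<close>-almost everywhere; the joint continuity demanded below selects the version.
\<close>

definition has_wasserstein_derivative ::
    "'w measure \<Rightarrow> ('a::euclidean_space measure \<Rightarrow> real) \<Rightarrow> ('a \<Rightarrow> 'a) \<Rightarrow> 'a measure \<Rightarrow> bool" where
  "has_wasserstein_derivative \<Omega> U g \<mu> \<longleftrightarrow>
     g \<in> borel_measurable borel \<and> integrable \<mu> (\<lambda>x. (norm (g x))\<^sup>2) \<and>
     (\<forall>\<xi> \<in> L2 \<Omega>. law \<Omega> \<xi> = \<mu> \<longrightarrow>
       (\<forall>\<epsilon>>0. \<exists>r>0. \<forall>\<eta> \<in> L2 \<Omega>. sqrt (LINT \<omega>|\<Omega>. (norm (\<eta> \<omega>))\<^sup>2) < r \<longrightarrow>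
          \<bar>U (law \<Omega> (\<lambda>\<omega>. \<xi> \<omega> + \<eta> \<omega>)) - U (law \<Omega> \<xi>) - (LINT \<omega>|\<Omega>. g (\<xi> \<omega>) \<bullet> \<eta> \<omega>)\<bar>
            \<le> \<epsilon> * sqrt (LINT \<omega>|\<Omega>. (norm (\<eta> \<omega>))\<^sup>2)))"

text \<open>
  Derivatives are tensors; we list their components in the standard basis. A multi-index
  \<open>\<alpha> = [[v\<^sub>1, w\<^sub>1\<^sub>1, \<dots>, w\<^sub>1\<^sub>i], \<dots>, [v\<^sub>j, \<dots>]]\<close> has one non-empty list of basis vectors for each point
  \<open>x\<^sub>1, \<dots>, x\<^sub>j\<close>. It denotes the component of
  \<open>\<partial>\<^sub>x\<^sub>1\<dots>\<partial>\<^sub>x\<^sub>j \<partial>\<^sub>\<mu>\<^sup>j U(\<mu>, x\<^sub>1, \<dots>, x\<^sub>j)\<close> in which the \<open>k\<close>-th Wasserstein derivative is taken in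
  direction \<open>v\<^sub>k\<close>, followed by the derivatives in the point \<open>x\<^sub>k\<close> in the remaining directions of
  the \<open>k\<close>-th list. Thus \<open>j = length \<alpha>\<close>, and the total order \<open>i\<^sub>1 + \<dots> + i\<^sub>j + j\<close> is the sum of the
  lengths of the lists. The points are passed as a list of length \<open>j\<close>.
\<close>

definition multi_index :: "'a::euclidean_space list list \<Rightarrow> bool" where
  "multi_index \<alpha> \<longleftrightarrow> (\<forall>l \<in> set \<alpha>. l \<noteq> [] \<and> set l \<subseteq> Basis)"

definition total_order :: "'a list list \<Rightarrow> nat" where
  "total_order \<alpha> = sum_list (map length \<alpha>)"

definition only_measure_derivs :: "'a list list \<Rightarrow> bool" where
  "only_measure_derivs \<alpha> \<longleftrightarrow> (\<forall>l \<in> set \<alpha>. length l = 1)"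

definition jointly_continuous ::
    "nat \<Rightarrow> ('a::euclidean_space measure \<Rightarrow> 'a list \<Rightarrow> real) \<Rightarrow> bool" where
  "jointly_continuous j G \<longleftrightarrow>
     (\<forall>\<mu> \<in> P2. \<forall>xs. length xs = j \<longrightarrow> (\<forall>\<epsilon>>0. \<exists>r>0. \<forall>\<nu> \<in> P2. \<forall>ys. length ys = j \<longrightarrow>
        W2 \<mu> \<nu> < r \<longrightarrow> (\<forall>k<j. dist (xs ! k) (ys ! k) < r) \<longrightarrow> \<bar>G \<nu> ys - G \<mu> xs\<bar> < \<epsilon>))"

text \<open>
  \<open>D \<alpha>\<close>, for \<open>\<alpha>\<close> of total order at most \<open>n\<close>, are the derivatives of \<open>U\<close>; those with at least one
  measure derivative are jointly continuous.
\<close>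

definition wasserstein_derivs ::
    "'w measure \<Rightarrow> nat \<Rightarrow> ('a::euclidean_space measure \<Rightarrow> real) \<Rightarrow>
     ('a list list \<Rightarrow> 'a measure \<Rightarrow> 'a list \<Rightarrow> real) \<Rightarrow> bool" where
  "wasserstein_derivs \<Omega> n U D \<longleftrightarrow>
     (\<forall>\<mu> \<in> P2. D [] \<mu> [] = U \<mu>) \<and>
     (\<forall>\<alpha>. multi_index \<alpha> \<longrightarrow> only_measure_derivs \<alpha> \<longrightarrow> total_order \<alpha> < n \<longrightarrow>
        (\<forall>\<mu> \<in> P2. \<forall>xs. length xs = length \<alpha> \<longrightarrow>
           has_wasserstein_derivative \<Omega> (\<lambda>\<nu>. D \<alpha> \<nu> xs)
             (\<lambda>x. \<Sum>v\<in>Basis. D (\<alpha> @ [[v]]) \<mu> (xs @ [x]) *\<^sub>R v) \<mu>)) \<and>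
     (\<forall>\<alpha>. multi_index \<alpha> \<longrightarrow> total_order \<alpha> < n \<longrightarrow>
        (\<forall>k<length \<alpha>. \<forall>w\<in>Basis. \<forall>\<mu> \<in> P2. \<forall>xs. length xs = length \<alpha> \<longrightarrow>
           ((\<lambda>t. D \<alpha> \<mu> (xs[k := xs ! k + t *\<^sub>R w]))
              has_real_derivative D (\<alpha>[k := \<alpha> ! k @ [w]]) \<mu> xs) (at 0))) \<and>
     (\<forall>\<alpha>. multi_index \<alpha> \<longrightarrow> \<alpha> \<noteq> [] \<longrightarrow> total_order \<alpha> \<le> n \<longrightarrow>
        jointly_continuous (length \<alpha>) (D \<alpha>))"

definition derivs_bounded_by ::
    "real \<Rightarrow> nat \<Rightarrow> nat \<Rightarrow> ('a::euclidean_space list list \<Rightarrow> 'a measure \<Rightarrow> 'a list \<Rightarrow> real) \<Rightarrow> bool"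
  where
  "derivs_bounded_by C m n D \<longleftrightarrow>
     (\<forall>\<alpha>. multi_index \<alpha> \<longrightarrow> \<alpha> \<noteq> [] \<longrightarrow> m \<le> total_order \<alpha> \<longrightarrow> total_order \<alpha> \<le> n \<longrightarrow>
        (\<forall>\<mu> \<in> P2. \<forall>xs. length xs = length \<alpha> \<longrightarrow> \<bar>D \<alpha> \<mu> xs\<bar> \<le> C))"

definition C_wasserstein_bounded ::
    "'w measure \<Rightarrow> nat \<Rightarrow> ('a::euclidean_space measure \<Rightarrow> real) set" where
  "C_wasserstein_bounded \<Omega> n =
     {U. \<exists>D. wasserstein_derivs \<Omega> n U D \<and> (\<exists>C. derivs_bounded_by C 1 n D)}"

text \<open>
  The same notions for functions \<open>U(z, \<mu>)\<close> with an additional Euclidean variable \<open>z\<close>. Here \<open>D \<beta> \<alpha>\<close>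
  is the measure multi-index \<open>\<alpha>\<close> together with derivatives in \<open>z\<close> along the basis vectors in \<open>\<beta>\<close>.
\<close>

definition jointly_continuous_z ::
    "nat \<Rightarrow> ('e::euclidean_space \<Rightarrow> 'a::euclidean_space measure \<Rightarrow> 'a list \<Rightarrow> real) \<Rightarrow> bool" where
  "jointly_continuous_z j G \<longleftrightarrow>
     (\<forall>z. \<forall>\<mu> \<in> P2. \<forall>xs. length xs = j \<longrightarrow>
        (\<forall>\<epsilon>>0. \<exists>r>0. \<forall>z'. \<forall>\<nu> \<in> P2. \<forall>ys. length ys = j \<longrightarrow> dist z z' < r \<longrightarrow>
        W2 \<mu> \<nu> < r \<longrightarrow> (\<forall>k<j. dist (xs ! k) (ys ! k) < r) \<longrightarrow> \<bar>G z' \<nu> ys - G z \<mu> xs\<bar> < \<epsilon>))"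

definition mixed_derivs ::
    "'w measure \<Rightarrow> nat \<Rightarrow> ('e::euclidean_space \<Rightarrow> 'a::euclidean_space measure \<Rightarrow> real) \<Rightarrow>
     ('e list \<Rightarrow> 'a list list \<Rightarrow> 'e \<Rightarrow> 'a measure \<Rightarrow> 'a list \<Rightarrow> real) \<Rightarrow> bool" where
  "mixed_derivs \<Omega> n U D \<longleftrightarrow>
     (\<forall>z. \<forall>\<mu> \<in> P2. D [] [] z \<mu> [] = U z \<mu>) \<and>
     (\<forall>\<alpha>. multi_index \<alpha> \<longrightarrow> only_measure_derivs \<alpha> \<longrightarrow> total_order \<alpha> < n \<longrightarrow>
        (\<forall>z. \<forall>\<mu> \<in> P2. \<forall>xs. length xs = length \<alpha> \<longrightarrow>
           has_wasserstein_derivative \<Omega> (\<lambda>\<nu>. D [] \<alpha> z \<nu> xs)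
             (\<lambda>x. \<Sum>v\<in>Basis. D [] (\<alpha> @ [[v]]) z \<mu> (xs @ [x]) *\<^sub>R v) \<mu>)) \<and>
     (\<forall>\<beta> \<alpha>. set \<beta> \<subseteq> Basis \<longrightarrow> multi_index \<alpha> \<longrightarrow> length \<beta> + total_order \<alpha> < n \<longrightarrow>
        (\<forall>z. \<forall>k<length \<alpha>. \<forall>w\<in>Basis. \<forall>\<mu> \<in> P2. \<forall>xs. length xs = length \<alpha> \<longrightarrow>
           ((\<lambda>t. D \<beta> \<alpha> z \<mu> (xs[k := xs ! k + t *\<^sub>R w]))
              has_real_derivative D \<beta> (\<alpha>[k := \<alpha> ! k @ [w]]) z \<mu> xs) (at 0))) \<and>
     (\<forall>\<beta> \<alpha>. set \<beta> \<subseteq> Basis \<longrightarrow> multi_index \<alpha> \<longrightarrow> length \<beta> + total_order \<alpha> < n \<longrightarrow>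
        (\<forall>z. \<forall>b\<in>Basis. \<forall>\<mu> \<in> P2. \<forall>xs. length xs = length \<alpha> \<longrightarrow>
           ((\<lambda>t. D \<beta> \<alpha> (z + t *\<^sub>R b) \<mu> xs)
              has_real_derivative D (\<beta> @ [b]) \<alpha> z \<mu> xs) (at 0))) \<and>
     (\<forall>\<beta> \<alpha>. set \<beta> \<subseteq> Basis \<longrightarrow> multi_index \<alpha> \<longrightarrow> length \<beta> + total_order \<alpha> \<le> n \<longrightarrow>
        jointly_continuous_z (length \<alpha>) (D \<beta> \<alpha>))"

definition mixed_derivs_bounded_by ::
    "real \<Rightarrow> nat \<Rightarrow> nat \<Rightarrow>
     ('e::euclidean_space list \<Rightarrow> 'a::euclidean_space list list \<Rightarrow> 'e \<Rightarrow> 'a measure \<Rightarrow> 'a list \<Rightarrow> real)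
     \<Rightarrow> bool"
  where
  "mixed_derivs_bounded_by C m n D \<longleftrightarrow>
     (\<forall>\<beta> \<alpha>. set \<beta> \<subseteq> Basis \<longrightarrow> multi_index \<alpha> \<longrightarrow>
        m \<le> length \<beta> + total_order \<alpha> \<longrightarrow> length \<beta> + total_order \<alpha> \<le> n \<longrightarrow>
        (\<forall>z. \<forall>\<mu> \<in> P2. \<forall>xs. length xs = length \<alpha> \<longrightarrow> \<bar>D \<beta> \<alpha> z \<mu> xs\<bar> \<le> C))"

text \<open>Ordinary partial derivatives of a function on a Euclidean space, up to order \<open>n\<close>.\<close>

definition euclidean_derivs ::
    "nat \<Rightarrow> ('e::euclidean_space \<Rightarrow> real) \<Rightarrow> ('e list \<Rightarrow> 'e \<Rightarrow> real) \<Rightarrow> bool" where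
  "euclidean_derivs n F D \<longleftrightarrow>
     D [] = F \<and>
     (\<forall>\<beta>. set \<beta> \<subseteq> Basis \<longrightarrow> length \<beta> < n \<longrightarrow>
        (\<forall>z. \<forall>b\<in>Basis. ((\<lambda>t. D \<beta> (z + t *\<^sub>R b)) has_real_derivative D (\<beta> @ [b]) z) (at 0))) \<and>
     (\<forall>\<beta>. set \<beta> \<subseteq> Basis \<longrightarrow> length \<beta> \<le> n \<longrightarrow> continuous_on UNIV (D \<beta>))"

section \<open>The derivatives entering the structural conditions\<close>

type_synonym ('m, 'n) U_derivs =
  "((real^'m) \<times> (real^'n)) list \<Rightarrow> (real^'m) list list \<Rightarrow> (real^'m) \<times> (real^'n) \<Rightarrow>
   (real^'m) measure \<Rightarrow> (real^'m) list \<Rightarrow> real"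

definition grad_xi :: "('m::finite, 'n::finite) U_derivs \<Rightarrow> real^'m \<Rightarrow> real^'n \<Rightarrow>
    (real^'m) measure \<Rightarrow> real^'m" where
  "grad_xi DU x q \<mu> = (\<Sum>b\<in>Basis. DU [(b, 0)] [] (x, q) \<mu> [] *\<^sub>R b)"

definition grad_measure :: "('m::finite, 'n::finite) U_derivs \<Rightarrow> real^'m \<Rightarrow> real^'n \<Rightarrow>
    (real^'m) measure \<Rightarrow> real^'m \<Rightarrow> real^'m" where
  "grad_measure DU x q \<mu> y = (\<Sum>b\<in>Basis. DU [] [[b]] (x, q) \<mu> [y] *\<^sub>R b)"

definition hess_QQ :: "('m::finite, 'n::finite) U_derivs \<Rightarrow> real^'m \<Rightarrow> real^'n \<Rightarrow>
    (real^'m) measure \<Rightarrow> real^'n \<Rightarrow> real" where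
  "hess_QQ DU x q \<mu> v =
     (\<Sum>b\<in>Basis. \<Sum>c\<in>Basis. (v \<bullet> b) * (v \<bullet> c) * DU [(0, b), (0, c)] [] (x, q) \<mu> [])"

definition hess :: "('e::euclidean_space list \<Rightarrow> 'e \<Rightarrow> real) \<Rightarrow> 'e \<Rightarrow> 'e \<Rightarrow> real" where
  "hess D z v = (\<Sum>b\<in>Basis. \<Sum>c\<in>Basis. (v \<bullet> b) * (v \<bullet> c) * D [b, c] z)"

text \<open>
  The expectation over the independent copy \<open>(\<xi>', \<eta>')\<close> of \<open>(\<xi>, \<eta>)\<close> is the inner integral over a
  second copy \<open>\<omega>'\<close> of the sample. Both inner products are taken with \<open>\<xi> - \<eta>\<close>.
\<close>

definition displacement_monotone ::
    "'w measure \<Rightarrow> real \<Rightarrow> ('m::finite, 'n::finite) U_derivs \<Rightarrow> bool" where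
  "displacement_monotone \<Omega> \<delta> DU \<longleftrightarrow>
     (\<forall>\<xi> \<in> L2 \<Omega>. \<forall>\<eta> \<in> L2 \<Omega>. \<forall>Q \<in> L2 \<Omega>.
        (LINT \<omega>|\<Omega>. (grad_xi DU (\<xi> \<omega>) (Q \<omega>) (law \<Omega> \<xi>) - grad_xi DU (\<eta> \<omega>) (Q \<omega>) (law \<Omega> \<eta>))
                     \<bullet> (\<xi> \<omega> - \<eta> \<omega>))
      + (LINT \<omega>|\<Omega>. LINT \<omega>'|\<Omega>.
           (grad_measure DU (\<xi> \<omega>) (Q \<omega>) (law \<Omega> \<xi>) (\<xi> \<omega>')
              - grad_measure DU (\<eta> \<omega>) (Q \<omega>) (law \<Omega> \<eta>) (\<eta> \<omega>')) \<bullet> (\<xi> \<omega> - \<eta> \<omega>))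
      \<ge> \<delta> * (LINT \<omega>|\<Omega>. (norm (\<xi> \<omega> - \<eta> \<omega>))\<^sup>2))"

definition displacement_convex :: "'w measure \<Rightarrow> ('a::euclidean_space measure \<Rightarrow> real) \<Rightarrow> bool" where
  "displacement_convex \<Omega> f \<longleftrightarrow>
     (\<forall>\<gamma> \<in> {0..1}. \<forall>M1 \<in> L2 \<Omega>. \<forall>M2 \<in> L2 \<Omega>.
        f (law \<Omega> (\<lambda>\<omega>. \<gamma> *\<^sub>R M1 \<omega> + (1 - \<gamma>) *\<^sub>R M2 \<omega>))
          \<le> \<gamma> * f (law \<Omega> M1) + (1 - \<gamma>) * f (law \<Omega> M2))"

section \<open>The Hamiltonian\<close>

definition convex_conjugate :: "('e::euclidean_space \<Rightarrow> real) \<Rightarrow> 'e \<Rightarrow> real" where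
  "convex_conjugate \<Phi> \<beta> = (SUP \<alpha>. \<alpha> \<bullet> \<beta> - \<Phi> \<alpha>)"

definition control_cost ::
    "'w measure \<Rightarrow> real^'m^'n \<Rightarrow> real^'m^'n \<Rightarrow>
     (real^'m \<Rightarrow> real^'n \<Rightarrow> (real^'m) measure \<Rightarrow> real) \<Rightarrow>
     ('w \<Rightarrow> real^'n) \<Rightarrow> ('w \<Rightarrow> real^'m) \<Rightarrow> ('w \<Rightarrow> real^'n) \<Rightarrow> ('w \<Rightarrow> real^'m) \<Rightarrow> real" where
  "control_cost \<Omega> \<phi> \<phi>' U Q p1 p2 \<xi> =
     (LINT \<omega>|\<Omega>. (- p1 \<omega> - transpose \<phi> *v p2 \<omega> - transpose \<phi>' *v (LINT \<omega>'|\<Omega>. p2 \<omega>')) \<bullet> \<xi> \<omega>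
                   + U (\<xi> \<omega>) (Q \<omega>) (law \<Omega> \<xi>))"

text \<open>
  \<open>H\<close> is the real-valued function on \<open>P2\<close> given by the formula of the Hamiltonian in terms of
  random variables. That \<open>H\<close> takes values in the reals means in particular that the infimum is
  finite, which is the condition \<open>bdd_below\<close>; the infimum of an unbounded set of reals would be a
  meaningless default value.
\<close>

definition is_hamiltonian ::
    "'w measure \<Rightarrow> real \<Rightarrow> real \<Rightarrow> real \<Rightarrow> real \<Rightarrow> real^'m^'n \<Rightarrow> real^'m^'n \<Rightarrow>
     ((real^'m) measure \<Rightarrow> real) \<Rightarrow> (real^'n \<Rightarrow> real) \<Rightarrow>
     (real^'m \<Rightarrow> real^'n \<Rightarrow> (real^'m) measure \<Rightarrow> real) \<Rightarrow>
     ((((real^'m) \<times> (real^'n)) \<times> ((real^'m) \<times> (real^'n))) measure \<Rightarrow> real) \<Rightarrow> bool" where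
  "is_hamiltonian \<Omega> lam \<rho> \<kappa>1 \<kappa>2 \<phi> \<phi>' f \<Phi> U H \<longleftrightarrow>
     (\<forall>M \<in> L2 \<Omega>. \<forall>Q \<in> L2 \<Omega>. \<forall>p1 \<in> L2 \<Omega>. \<forall>p2 \<in> L2 \<Omega>.
        bdd_below (control_cost \<Omega> \<phi> \<phi>' U Q p1 p2 ` L2 \<Omega>) \<and>
        H (law \<Omega> (\<lambda>\<omega>. ((M \<omega>, Q \<omega>), (p1 \<omega>, p2 \<omega>)))) =
          (INF \<xi> \<in> L2 \<Omega>. control_cost \<Omega> \<phi> \<phi>' U Q p1 p2 \<xi>)
          - \<rho> * (LINT \<omega>|\<Omega>. Q \<omega> \<bullet> p2 \<omega>)
          + f (law \<Omega> M)
          + \<kappa>2\<^sup>2 / (4 * lam) * (LINT \<omega>|\<Omega>. (norm (p2 \<omega>))\<^sup>2)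
          + convex_conjugate \<Phi> (\<kappa>1 *\<^sub>R (LINT \<omega>|\<Omega>. p2 \<omega>)))"

end

theory Submission
  imports Defs
begin

text \<open>
  The lift \<open>X \<mapsto> H (law X)\<close> of the Hamiltonian to square-integrable random variables is continuous in
  \<open>L\<^sup>2\<close>. The only delicate term is the infimum: as an infimum of continuous functions that are affine
  in \<open>(p\<^sub>1, p\<^sub>2)\<close> and concave in \<open>Q\<close>, it is concave and finite on \<open>L\<^sup>2\<close>, and hence continuous by a Baire
  category argument.

  Every function on \<open>P2\<close> with an \<open>L\<^sup>2\<close>-continuous lift is a pointwise limit of smooth functions with
  bounded derivatives. Let \<open>p\<^sub>0, p\<^sub>1, \<dots>\<close> be dense, and let \<open>\<chi>\<^sub>0, \<dots>, \<chi>\<^sub>n\<close> be a smooth partition of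
  unity such that \<open>\<chi>\<^sub>i (x)\<close> is small unless \<open>p\<^sub>i\<close> is nearly as close to \<open>x\<close> as any of \<open>p\<^sub>0, \<dots>, p\<^sub>n\<close>.
  The laws \<open>\<mu>\<^sub>n = \<Sum>i\<le>n. (\<integral>\<chi>\<^sub>i d\<mu>) \<delta>\<^bsub>p\<^sub>i\<^esub>\<close> converge to \<open>\<mu>\<close>. The weights \<open>\<integral>\<chi>\<^sub>i d\<mu>\<close> lie in a compact
  simplex, on which the value at \<open>\<mu>\<^sub>n\<close> depends continuously on the weights. By the Stone--Weierstrass
  theorem this value is up to \<open>1 / (n + 1)\<close> a polynomial in the weights, and such a polynomial is a
  smooth function of \<open>\<mu>\<close>.
\<close>

text \<open>The infimum over controls offers no derivative to work with, so all smoothness is put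
  into the approximating sequence, and \<open>H\<close> has to supply only continuity of its lift.
  For that, M, Q, p1 and p2 are treated as one element of a single L2 space: the linear part of each
  cost separates from \<open>U\<close>, so the cost is jointly concave in this element. The bilinear
  term E[Q . p2], which is not concave, stays outside the infimum. Finiteness at every point, on
  which Baire's argument rests, is the \<open>bdd_below\<close> clause of
  \<open>is_hamiltonian\<close>. Integrals against \<mu> serve as building blocks because the
  Wasserstein derivative of the integral of g is the gradient of g, whatever \<mu> is; bounded
  derivatives of the weights thus become bounded derivatives on \<open>P2\<close>. The discretised
  law is compared with \<mu> through a coupling: an independent uniform variable picks p_i with
  conditional probability \<chi>_i(X). The weights are normalised Gaussian kernels with parameter (n
  + 1)^2, which beats the n + 1 competing points: each of them adds at most the reciprocal of the
  parameter to the error.\<close>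

section \<open>Functions with given partial derivatives\<close>

text \<open>Only coordinate directions occur, because the derivative families of
  \<open>wasserstein_derivs\<close> and \<open>mixed_derivs\<close> are indexed by lists of basis
  vectors. Total differentiability is recovered later from continuity of the partials.\<close>

definition has_partials :: "('e::euclidean_space \<Rightarrow> real) \<Rightarrow> ('e \<Rightarrow> 'e \<Rightarrow> real) \<Rightarrow> bool" where
  "has_partials v g \<longleftrightarrow>
     (\<forall>z. \<forall>b\<in>Basis. ((\<lambda>t. v (z + t *\<^sub>R b)) has_real_derivative g b z) (at 0))"

lemma has_partialsD:
  assumes "has_partials v g" and "b \<in> Basis"
  shows "((\<lambda>t. v (z + t *\<^sub>R b)) has_real_derivative g b (z + t *\<^sub>R b)) (at t)"
proof -
  have "((\<lambda>s. v ((z + t *\<^sub>R b) + s *\<^sub>R b)) has_real_derivative g b (z + t *\<^sub>R b)) (at 0)"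
    using assms unfolding has_partials_def by blast
  then have "((\<lambda>s. v (z + (s + t) *\<^sub>R b)) has_real_derivative g b (z + t *\<^sub>R b)) (at 0)"
    by (simp add: algebra_simps)
  from DERIV_at_within_shift[where z = t and x = 0 and S = UNIV and f = "\<lambda>t. v (z + t *\<^sub>R b)"] this
  show ?thesis by (simp add: add.commute)
qed

text \<open>The mean value inequality is applied to one coordinate after another. A bound on the
  ball of radius \<open>norm h\<close> suffices, since a point that has received some coordinates of
  \<open>h\<close> in full and one in part never leaves it.\<close>

lemma partials_increment:
  fixes v :: "'e::euclidean_space \<Rightarrow> real" and L :: real
  assumes v: "has_partials v g"
    and L: "\<And>b z. b \<in> Basis \<Longrightarrow> z \<in> cball x (norm h) \<Longrightarrow> \<bar>g b z\<bar> \<le> L"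
  shows "\<bar>v (x + h) - v x\<bar> \<le> DIM('e) * L * norm h"
proof -
  have "\<bar>v (x + (\<Sum>b\<in>B. (h \<bullet> b) *\<^sub>R b)) - v x\<bar> \<le> card B * L * norm h" if "B \<subseteq> Basis" for B
    using finite_subset[OF that finite_Basis] that
  proof (induction B rule: finite_induct)
    case (insert b B)
    define y where "y = x + (\<Sum>b\<in>B. (h \<bullet> b) *\<^sub>R b)"
    have b: "b \<in> Basis" "B \<subseteq> Basis" using insert by auto
    have ball: "y + t *\<^sub>R b \<in> cball x (norm h)" if "\<bar>t\<bar> \<le> \<bar>h \<bullet> b\<bar>" for t
    proof -
      have "norm ((\<Sum>b\<in>B. (h \<bullet> b) *\<^sub>R b) + t *\<^sub>R b) \<le> norm h"
      proof (rule norm_le_componentwise)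
        fix c :: 'e assume c: "c \<in> Basis"
        have "(\<Sum>b\<in>B. (h \<bullet> b) *\<^sub>R b) \<bullet> c = (\<Sum>b\<in>B. if b = c then h \<bullet> c else 0)"
          unfolding inner_sum_left by (rule sum.cong) (use b c in \<open>auto simp: inner_Basis\<close>)
        also have "\<dots> = (if c \<in> B then h \<bullet> c else 0)"
          using insert by simp
        finally show "\<bar>((\<Sum>b\<in>B. (h \<bullet> b) *\<^sub>R b) + t *\<^sub>R b) \<bullet> c\<bar> \<le> \<bar>h \<bullet> c\<bar>"
          using that insert b c by (auto simp: inner_add_left inner_Basis)
      qed
      then show ?thesis unfolding mem_cball dist_commute[of x] by (simp add: y_def dist_norm add.commute)
    qed
    have "norm (v (y + (h \<bullet> b) *\<^sub>R b) - v (y + 0 *\<^sub>R b)) \<le> L * norm (h \<bullet> b - 0)"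
    proof (rule field_differentiable_bound[where S = "closed_segment 0 (h \<bullet> b)"
          and f' = "\<lambda>t. g b (y + t *\<^sub>R b)"])
      show "((\<lambda>t. v (y + t *\<^sub>R b)) has_field_derivative g b (y + t *\<^sub>R b))
          (at t within closed_segment 0 (h \<bullet> b))" for t
        using has_partialsD[OF v b(1)] by (rule has_field_derivative_at_within)
      show "norm (g b (y + t *\<^sub>R b)) \<le> L" if "t \<in> closed_segment 0 (h \<bullet> b)" for t
        using L[OF b(1) ball[of t]] that by (auto simp: closed_segment_eq_real_ivl split: if_splits)
    qed auto
    also have "\<dots> \<le> L * norm h"
    proof (rule mult_left_mono)
      show "norm (h \<bullet> b - 0) \<le> norm h" using Basis_le_norm[OF b(1), of h] by simp
      show "0 \<le> L" using L[OF b(1), of x] by (smt (verit) centre_in_cball norm_ge_zero)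
    qed
    finally have step: "\<bar>v (y + (h \<bullet> b) *\<^sub>R b) - v y\<bar> \<le> L * norm h" by simp
    have IH: "\<bar>v y - v x\<bar> \<le> card B * L * norm h" using insert b by (simp add: y_def)
    have "x + (\<Sum>b\<in>insert b B. (h \<bullet> b) *\<^sub>R b) = y + (h \<bullet> b) *\<^sub>R b"
      using insert by (simp add: y_def)
    moreover have "card (insert b B) * L * norm h = L * norm h + card B * L * norm h"
      using insert by (simp add: algebra_simps)
    ultimately show ?case using step IH by simp
  qed simp
  from this[of Basis] show ?thesis by (simp add: euclidean_representation)
qed

lemma has_partials_sub_linear:
  fixes v :: "'e::euclidean_space \<Rightarrow> real"
  assumes "has_partials v g"
  shows "has_partials (\<lambda>z. v z - (\<Sum>b\<in>Basis. (z \<bullet> b) * c b)) (\<lambda>b z. g b z - c b)"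
  unfolding has_partials_def
proof (intro allI ballI)
  fix z b :: 'e assume b: "b \<in> Basis"
  have "((\<lambda>t. v (z + t *\<^sub>R b) - ((\<Sum>b\<in>Basis. (z \<bullet> b) * c b) + t * c b))
      has_real_derivative g b z - c b) (at 0)"
    using assms b unfolding has_partials_def by (auto intro!: derivative_eq_intros)
  moreover have "(\<Sum>b'\<in>Basis. ((z + t *\<^sub>R b) \<bullet> b') * c b') =
      (\<Sum>b\<in>Basis. (z \<bullet> b) * c b) + t * c b" for t
  proof -
    have "(\<Sum>b'\<in>Basis. (b \<bullet> b') * c b') = (\<Sum>b'\<in>Basis. if b' = b then c b else 0)"
      by (rule sum.cong) (use b in \<open>auto simp: inner_Basis\<close>)
    also have "\<dots> = c b" using b by simp
    finally show ?thesis
      by (simp add: inner_add_left distrib_right sum.distrib mult.assoc flip: sum_distrib_left)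
  qed
  ultimately show "((\<lambda>t. v (z + t *\<^sub>R b) - (\<Sum>b'\<in>Basis. ((z + t *\<^sub>R b) \<bullet> b') * c b'))
      has_real_derivative g b z - c b) (at 0)"
    by simp
qed

text \<open>Subtracting the linear map with coefficients \<open>g b x\<close> leaves a function with
  partials \<open>g b z - g b x\<close>, so the increment bound becomes a first-order Taylor
  estimate.\<close>

lemma partials_linear_approx:
  fixes v :: "'e::euclidean_space \<Rightarrow> real" and L :: real
  assumes v: "has_partials v g"
    and L: "\<And>b z. b \<in> Basis \<Longrightarrow> z \<in> cball x (norm h) \<Longrightarrow> \<bar>g b z - g b x\<bar> \<le> L"
  shows "\<bar>v (x + h) - v x - (\<Sum>b\<in>Basis. (h \<bullet> b) * g b x)\<bar> \<le> DIM('e) * L * norm h"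
proof -
  have "\<bar>(v (x + h) - (\<Sum>b\<in>Basis. ((x + h) \<bullet> b) * g b x)) - (v x - (\<Sum>b\<in>Basis. (x \<bullet> b) * g b x))\<bar>
      \<le> DIM('e) * L * norm h"
    by (rule partials_increment[OF has_partials_sub_linear[OF v] L])
  then show ?thesis
    by (simp add: inner_add_left distrib_right sum.distrib algebra_simps)
qed

lemma continuous_partials_has_derivative:
  fixes v :: "'e::euclidean_space \<Rightarrow> real"
  assumes v: "has_partials v g" and cont: "\<And>b. b \<in> Basis \<Longrightarrow> isCont (g b) x"
  shows "(v has_derivative (\<lambda>h. \<Sum>b\<in>Basis. (h \<bullet> b) * g b x)) (at x)"
  unfolding has_derivative_at_alt
proof (intro conjI allI impI)
  show "bounded_linear (\<lambda>h. \<Sum>b\<in>Basis. (h \<bullet> b) * g b x)"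
    by (intro bounded_linear_intros)
  fix e :: real assume e: "e > 0"
  define e' where "e' = e / DIM('e)"
  have e': "e' > 0" using e by (simp add: e'_def)
  have "eventually (\<lambda>z. \<forall>b\<in>Basis. \<bar>g b z - g b x\<bar> < e') (nhds x)"
  proof (rule eventually_ball_finite[OF finite_Basis], intro ballI)
    fix b :: 'e assume "b \<in> Basis"
    then have "(g b \<longlongrightarrow> g b x) (nhds x)" using cont isCont_def tendsto_at_iff_tendsto_nhds by blast
    from tendstoD[OF this e'] show "\<forall>\<^sub>F z in nhds x. \<bar>g b z - g b x\<bar> < e'"
      by (simp add: dist_real_def)
  qed
  then obtain d where d: "d > 0" "\<And>z b. dist z x < d \<Longrightarrow> b \<in> Basis \<Longrightarrow> \<bar>g b z - g b x\<bar> < e'"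
    unfolding eventually_nhds_metric by blast
  show "\<exists>d>0. \<forall>y. norm (y - x) < d \<longrightarrow>
      norm (v y - v x - (\<Sum>b\<in>Basis. ((y - x) \<bullet> b) * g b x)) \<le> e * norm (y - x)"
  proof (intro exI[of _ d] conjI allI impI)
    fix y assume y: "norm (y - x) < d"
    have "\<bar>v (x + (y - x)) - v x - (\<Sum>b\<in>Basis. ((y - x) \<bullet> b) * g b x)\<bar> \<le> DIM('e) * e' * norm (y - x)"
      by (rule partials_linear_approx[OF v], rule less_imp_le, rule d(2))
        (use y in \<open>auto simp: dist_commute\<close>)
    then show "norm (v y - v x - (\<Sum>b\<in>Basis. ((y - x) \<bullet> b) * g b x)) \<le> e * norm (y - x)"
      by (simp add: e'_def)
  qed (use d in auto)
qed

lemma continuous_partials_line: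
  fixes v :: "'e::euclidean_space \<Rightarrow> real"
  assumes v: "has_partials v g" and cont: "\<And>b. b \<in> Basis \<Longrightarrow> continuous_on UNIV (g b)"
  shows "((\<lambda>t. v (z + t *\<^sub>R h)) has_real_derivative (\<Sum>b\<in>Basis. (h \<bullet> b) * g b (z + t *\<^sub>R h))) (at t)"
proof -
  have "(v has_derivative (\<lambda>k. \<Sum>b\<in>Basis. (k \<bullet> b) * g b (z + t *\<^sub>R h))) (at (z + t *\<^sub>R h))"
    by (rule continuous_partials_has_derivative[OF v])
      (use cont in \<open>auto simp: continuous_on_eq_continuous_at\<close>)
  moreover have "((\<lambda>t. z + t *\<^sub>R h) has_derivative (\<lambda>s. s *\<^sub>R h)) (at t)"
    by (auto intro!: derivative_eq_intros)
  ultimately have "((\<lambda>t. v (z + t *\<^sub>R h)) has_derivative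
      (\<lambda>s. \<Sum>b\<in>Basis. ((s *\<^sub>R h) \<bullet> b) * g b (z + t *\<^sub>R h))) (at t)"
    by (rule has_derivative_compose[rotated])
  then show ?thesis
    unfolding has_field_derivative_def
    by (rule has_derivative_eq_rhs) (auto simp: fun_eq_iff sum_distrib_left ac_simps)
qed

lemma bounded_partials_continuous:
  fixes v :: "'e::euclidean_space \<Rightarrow> real" and L :: real
  assumes v: "has_partials v g" and L: "\<And>b z. b \<in> Basis \<Longrightarrow> \<bar>g b z\<bar> \<le> L"
  shows "continuous_on UNIV v"
proof (rule lipschitz_on_continuous_on[of "DIM('e) * L"])
  show "(DIM('e) * L)-lipschitz_on UNIV v"
  proof (rule lipschitz_onI)
    obtain b :: 'e where "b \<in> Basis" using nonempty_Basis by blast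
    then have "0 \<le> L" using L[of b 0] by (meson abs_ge_zero order_trans)
    then show "0 \<le> DIM('e) * L" by simp
    show "dist (v y) (v x) \<le> DIM('e) * L * dist y x" for x y
      using partials_increment[OF v L, of x "y - x"] by (simp add: dist_norm)
  qed
qed

section \<open>Square-integrable random variables\<close>

text \<open>Elements of \<open>L2\<close> are functions, not classes modulo null sets, so this is
  only a seminorm; convergence is therefore stated as \<open>L2dist\<close> tending to 0.\<close>

definition L2norm :: "'w measure \<Rightarrow> ('w \<Rightarrow> 'a::euclidean_space) \<Rightarrow> real" where
  "L2norm \<Omega> X = sqrt (LINT w|\<Omega>. (norm (X w))\<^sup>2)"

abbreviation L2dist :: "'w measure \<Rightarrow> ('w \<Rightarrow> 'a::euclidean_space) \<Rightarrow> ('w \<Rightarrow> 'a) \<Rightarrow> real" where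
  "L2dist \<Omega> X Y \<equiv> L2norm \<Omega> (\<lambda>w. X w - Y w)"

lemma L2norm_nonneg [simp]: "0 \<le> L2norm \<Omega> X"
  by (simp add: L2norm_def)

lemma L2norm_power2: "(L2norm \<Omega> X)\<^sup>2 = (LINT w|\<Omega>. (norm (X w))\<^sup>2)"
  by (simp add: L2norm_def)

lemma L2norm_scaleR: "L2norm \<Omega> (\<lambda>w. c *\<^sub>R X w) = \<bar>c\<bar> * L2norm \<Omega> X"
  by (simp add: L2norm_def power_mult_distrib real_sqrt_mult)

lemma L2norm_minus_commute: "L2dist \<Omega> X Y = L2dist \<Omega> Y X"
  by (simp add: L2norm_def norm_minus_commute)

lemma L2_measurable [measurable_dest]: "X \<in> L2 \<Omega> \<Longrightarrow> X \<in> borel_measurable \<Omega>"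
  and L2_integrable_power2: "X \<in> L2 \<Omega> \<Longrightarrow> integrable \<Omega> (\<lambda>w. (norm (X w))\<^sup>2)"
  by (auto simp: L2_def)

lemma L2_dominated:
  fixes X :: "'w \<Rightarrow> 'a::euclidean_space" and Y :: "'w \<Rightarrow> 'b::euclidean_space"
  assumes "X \<in> L2 \<Omega>" "Y \<in> borel_measurable \<Omega>" "\<And>w. norm (Y w) \<le> c * norm (X w)"
  shows "Y \<in> L2 \<Omega>"
proof -
  have "integrable \<Omega> (\<lambda>w. (norm (Y w))\<^sup>2)"
  proof (rule Bochner_Integration.integrable_bound)
    show "integrable \<Omega> (\<lambda>w. c\<^sup>2 * (norm (X w))\<^sup>2)"
      using L2_integrable_power2[OF assms(1)] by simp
    have "(norm (Y w))\<^sup>2 \<le> (c * norm (X w))\<^sup>2" for w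
      using assms(3) by (rule power_mono) simp
    then show "AE w in \<Omega>. norm ((norm (Y w))\<^sup>2) \<le> norm (c\<^sup>2 * (norm (X w))\<^sup>2)"
      by (simp add: power_mult_distrib)
  qed (use assms in simp)
  then show ?thesis using assms by (simp add: L2_def)
qed

lemma L2norm_mono:
  fixes X :: "'w \<Rightarrow> 'a::euclidean_space" and Y :: "'w \<Rightarrow> 'b::euclidean_space"
  assumes "X \<in> L2 \<Omega>" "Y \<in> borel_measurable \<Omega>" "\<And>w. norm (Y w) \<le> norm (X w)"
  shows "L2norm \<Omega> Y \<le> L2norm \<Omega> X"
  unfolding L2norm_def
  using L2_dominated[of X \<Omega> Y 1] assms
  by (intro real_sqrt_le_mono integral_mono) (auto simp: L2_def intro: power_mono)

lemma L2_add: "X \<in> L2 \<Omega> \<Longrightarrow> Y \<in> L2 \<Omega> \<Longrightarrow> (\<lambda>w. X w + Y w) \<in> L2 \<Omega>"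
  for X :: "'w \<Rightarrow> 'a::euclidean_space"
proof -
  assume X: "X \<in> L2 \<Omega>" and Y: "Y \<in> L2 \<Omega>"
  have "integrable \<Omega> (\<lambda>w. (norm (X w + Y w))\<^sup>2)"
  proof (rule Bochner_Integration.integrable_bound)
    show "integrable \<Omega> (\<lambda>w. 2 * (norm (X w))\<^sup>2 + 2 * (norm (Y w))\<^sup>2)"
      using L2_integrable_power2[OF X] L2_integrable_power2[OF Y] by simp
    have "(norm (x + y))\<^sup>2 \<le> 2 * (norm x)\<^sup>2 + 2 * (norm y)\<^sup>2" for x y :: 'a
      using zero_le_power2[of "norm (x - y)"]
      by (simp add: power2_norm_eq_inner inner_add_left inner_add_right inner_diff_left inner_diff_right
          inner_commute)
    then show "AE w in \<Omega>. norm ((norm (X w + Y w))\<^sup>2) \<le>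
        norm (2 * (norm (X w))\<^sup>2 + 2 * (norm (Y w))\<^sup>2)" by simp
  qed (use X Y in measurable)
  then show ?thesis using X Y by (auto simp: L2_def)
qed

lemma L2_scaleR: "X \<in> L2 \<Omega> \<Longrightarrow> (\<lambda>w. c *\<^sub>R X w) \<in> L2 \<Omega>"
  by (rule L2_dominated[where X = X and c = "\<bar>c\<bar>"]) auto

lemma L2_diff: "X \<in> L2 \<Omega> \<Longrightarrow> Y \<in> L2 \<Omega> \<Longrightarrow> (\<lambda>w. X w - Y w) \<in> L2 \<Omega>"
  using L2_add[of X \<Omega> "\<lambda>w. (-1) *\<^sub>R Y w"] L2_scaleR[of Y \<Omega> "-1"] by simp

lemma L2_norm: "X \<in> L2 \<Omega> \<Longrightarrow> (\<lambda>w. norm (X w)) \<in> L2 \<Omega>"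
  by (auto simp: L2_def)

lemma L2norm_norm [simp]: "L2norm \<Omega> (\<lambda>w. norm (X w)) = L2norm \<Omega> X"
  by (simp add: L2norm_def)

lemma L2_integrable_inner:
  assumes X: "X \<in> L2 \<Omega>" and Y: "Y \<in> L2 \<Omega>"
  shows "integrable \<Omega> (\<lambda>w. X w \<bullet> Y w)"
proof -
  \<comment> \<open>Polarisation: integrability of the product follows from that of three
    squares.\<close>
  have "(\<lambda>w. X w \<bullet> Y w) =
      (\<lambda>w. ((norm (X w + Y w))\<^sup>2 - (norm (X w))\<^sup>2 - (norm (Y w))\<^sup>2) / 2)"
    by (simp add: fun_eq_iff power2_norm_eq_inner inner_add_left inner_add_right inner_commute)
  then show ?thesis
    using L2_integrable_power2[OF X] L2_integrable_power2[OF Y] L2_integrable_power2[OF L2_add[OF X Y]]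
    by simp
qed

lemma L2_integrable_mult:
  "X \<in> L2 \<Omega> \<Longrightarrow> Y \<in> L2 \<Omega> \<Longrightarrow> integrable \<Omega> (\<lambda>w. X w * Y w :: real)"
  using L2_integrable_inner[of X \<Omega> Y] by simp

lemma L2norm_add_power2:
  assumes X: "X \<in> L2 \<Omega>" and Y: "Y \<in> L2 \<Omega>"
  shows "(L2norm \<Omega> (\<lambda>w. X w + Y w))\<^sup>2 =
    (L2norm \<Omega> X)\<^sup>2 + 2 * (LINT w|\<Omega>. X w \<bullet> Y w) + (L2norm \<Omega> Y)\<^sup>2"
proof -
  have "(norm (X w + Y w))\<^sup>2 = (norm (X w))\<^sup>2 + 2 * (X w \<bullet> Y w) + (norm (Y w))\<^sup>2" for w
    by (simp add: power2_norm_eq_inner inner_add_left inner_add_right inner_commute)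
  then show ?thesis
    using L2_integrable_power2[OF X] L2_integrable_power2[OF Y] L2_integrable_inner[OF X Y]
    by (simp add: L2norm_power2)
qed

lemma L2_Cauchy_Schwarz:
  assumes X: "X \<in> L2 \<Omega>" and Y: "Y \<in> L2 \<Omega>"
  shows "\<bar>LINT w|\<Omega>. X w \<bullet> Y w\<bar> \<le> L2norm \<Omega> X * L2norm \<Omega> Y"
proof -
  define a b c where "a = L2norm \<Omega> X" and "b = (LINT w|\<Omega>. X w \<bullet> Y w)" and "c = L2norm \<Omega> Y"
  have nn: "0 \<le> a\<^sup>2 + 2 * t * b + t\<^sup>2 * c\<^sup>2" for t
  proof -
    have "0 \<le> (L2norm \<Omega> (\<lambda>w. X w + t *\<^sub>R Y w))\<^sup>2" by simp
    also have "\<dots> = a\<^sup>2 + 2 * t * b + t\<^sup>2 * c\<^sup>2"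
      by (subst L2norm_add_power2[OF X L2_scaleR[OF Y]])
        (simp add: a_def b_def c_def L2norm_scaleR power_mult_distrib)
    finally show ?thesis .
  qed
  have "b\<^sup>2 \<le> (a * c)\<^sup>2"
  proof (cases "c = 0")
    \<comment> \<open>The quadratic in \<open>t\<close> degenerates to an affine function, which is
      nonnegative everywhere only if \<open>b = 0\<close>. The value of \<open>t\<close> below would
      make it equal to -1.\<close>
    case True
    have "b = 0"
    proof (rule ccontr)
      assume "b \<noteq> 0"
      then show False using nn[of "- (a\<^sup>2 + 1) / (2 * b)"] True by (simp add: field_simps)
    qed
    then show ?thesis by simp
  next
    case False
    \<comment> \<open>This value of \<open>t\<close> minimises the quadratic.\<close>
    then have "b\<^sup>2 / c\<^sup>2 \<le> a\<^sup>2" using nn[of "- b / c\<^sup>2"] by (simp add: power2_eq_square)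
    then show ?thesis using False by (simp add: divide_le_eq power_mult_distrib)
  qed
  moreover have "0 \<le> a * c" by (simp add: a_def c_def)
  ultimately have "\<bar>b\<bar> \<le> a * c" by (metis abs_le_square_iff abs_of_nonneg)
  then show ?thesis by (simp add: a_def b_def c_def)
qed

lemma L2_integral_mult_le:
  assumes "X \<in> L2 \<Omega>" and "Y \<in> L2 \<Omega>"
  shows "(LINT w|\<Omega>. norm (X w) * norm (Y w)) \<le> L2norm \<Omega> X * L2norm \<Omega> Y"
  using L2_Cauchy_Schwarz[OF L2_norm L2_norm, OF assms] by simp

lemma L2norm_triangle:
  assumes X: "X \<in> L2 \<Omega>" and Y: "Y \<in> L2 \<Omega>"
  shows "L2norm \<Omega> (\<lambda>w. X w + Y w) \<le> L2norm \<Omega> X + L2norm \<Omega> Y"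
proof (rule power2_le_imp_le)
  show "(L2norm \<Omega> (\<lambda>w. X w + Y w))\<^sup>2 \<le> (L2norm \<Omega> X + L2norm \<Omega> Y)\<^sup>2"
    using L2_Cauchy_Schwarz[OF X Y] L2norm_add_power2[OF X Y] by (simp add: power2_sum)
qed simp

lemma L2norm_triangle_diff:
  assumes "X \<in> L2 \<Omega>" "Y \<in> L2 \<Omega>" "Z \<in> L2 \<Omega>"
  shows "L2dist \<Omega> X Z \<le> L2dist \<Omega> X Y + L2dist \<Omega> Y Z"
  using L2norm_triangle[OF L2_diff[OF assms(1,2)] L2_diff[OF assms(2,3)]] by simp

section \<open>L2 over a probability space: comparison with L1, and completeness\<close>

context prob_space
begin

lemma L2_bounded:
  assumes [measurable]: "X \<in> borel_measurable M" and "\<And>w. norm (X w) \<le> B"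
  shows "X \<in> L2 M"
proof -
  have "(norm (X w))\<^sup>2 \<le> B\<^sup>2" for w
    using assms(2) by (rule power_mono) simp
  then show ?thesis unfolding L2_def by (auto intro!: integrable_const_bound[where B = "B\<^sup>2"])
qed

lemma L2_const: "(\<lambda>_. c) \<in> L2 M"
  by (rule L2_bounded[where B = "norm c"]) auto

lemma L2norm_const: "L2norm M (\<lambda>_. c) = norm c"
  by (simp add: L2norm_def prob_space)

lemma L2_integrable:
  assumes X: "X \<in> L2 M"
  shows "integrable M X"
proof (rule Bochner_Integration.integrable_bound)
  show "integrable M (\<lambda>w. 1 * norm (X w))"
    by (rule L2_integrable_mult[OF L2_const L2_norm[OF X]])
qed (use X in auto)

lemma L2_integral_norm_le:
  assumes X: "X \<in> L2 M"
  shows "(LINT w|M. norm (X w)) \<le> L2norm M X"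
  using L2_integral_mult_le[OF L2_const[of "1::real"] X] by (simp add: L2norm_const)

lemma L2_norm_integral_le:
  assumes X: "X \<in> L2 M"
  shows "norm (LINT w|M. X w) \<le> L2norm M X"
  using integral_norm_bound[of M X] L2_integral_norm_le[OF X] by linarith

text \<open>The Riesz-Fischer argument: the increments are summable in L1, hence almost surely
  absolutely summable, and Fatou's lemma turns the pointwise limit into an L2 limit. The halving of
  \<open>s\<close>, which the gliding hump can arrange, gives an explicit rate.\<close>

lemma L2_complete:
  fixes P :: "nat \<Rightarrow> 'a \<Rightarrow> 'b::euclidean_space"
  assumes P: "\<And>n. P n \<in> L2 M" and le: "\<And>n. L2dist M (P (Suc n)) (P n) \<le> s n"
    and s: "\<And>n. s (Suc n) \<le> s n / 2"
  obtains S where "S \<in> L2 M" "\<And>n. L2dist M S (P n) \<le> 2 * s n"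
proof -
  note [measurable] = L2_measurable[OF P]
  have s0: "0 \<le> s n" for n using le[of n] L2norm_nonneg order_trans by blast
  have s_shift: "s (n + k) \<le> s n * (1/2)^k" for n k
  proof (induction k)
    case (Suc k)
    then show ?case using s[of "n + k"] by simp
  qed simp
  have "summable s"
  proof (rule summable_comparison_test')
    show "summable (\<lambda>k. s 0 * (1/2)^k)" by (intro summable_mult summable_geometric) simp
    show "norm (s k) \<le> s 0 * (1/2)^k" for k using s_shift[of 0 k] s0[of k] by simp
  qed
  \<comment> \<open>The partial sums of s n (1 + 1/2 + 1/4 + ...) are kept exact, so that the
    induction closes; their limit is the \<open>2 * s n\<close> of the conclusion.\<close>
  have dist: "L2dist M (P (n + k)) (P n) \<le> s n * (2 - 2 * (1/2)^k)" for n k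
  proof (induction k)
    case 0
    then show ?case by (simp add: L2norm_def)
  next
    case (Suc k)
    have "L2norm M (\<lambda>w. P (n + Suc k) w - P n w) \<le>
        L2dist M (P (Suc (n + k))) (P (n + k)) + L2dist M (P (n + k)) (P n)"
      using L2norm_triangle_diff[OF P P P] by simp
    also have "\<dots> \<le> s n * (1/2)^k + s n * (2 - 2 * (1/2)^k)"
      using Suc le[of "n + k"] s_shift[of n k] by linarith
    finally show ?case by (simp add: algebra_simps)
  qed
  have "(\<integral>\<^sup>+w. (\<Sum>n. ennreal (norm (P (Suc n) w - P n w))) \<partial>M) =
      (\<Sum>n. \<integral>\<^sup>+w. ennreal (norm (P (Suc n) w - P n w)) \<partial>M)"
    by (rule nn_integral_suminf) simp
  also have "\<dots> \<le> (\<Sum>n. ennreal (s n))"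
  proof (intro suminf_le)
    fix n
    have "(\<integral>\<^sup>+w. ennreal (norm (P (Suc n) w - P n w)) \<partial>M) =
        ennreal (LINT w|M. norm (P (Suc n) w - P n w))"
      by (rule nn_integral_eq_integral) (use L2_integrable[OF L2_diff[OF P P]] in auto)
    also have "\<dots> \<le> ennreal (s n)"
      by (intro ennreal_leI order_trans[OF L2_integral_norm_le[OF L2_diff[OF P P]] le])
    finally show "(\<integral>\<^sup>+w. ennreal (norm (P (Suc n) w - P n w)) \<partial>M) \<le> ennreal (s n)" .
  qed auto
  also have "\<dots> = ennreal (suminf s)"
    using \<open>summable s\<close> s0 by (intro suminf_ennreal2) auto
  finally have "(\<integral>\<^sup>+w. (\<Sum>n. ennreal (norm (P (Suc n) w - P n w))) \<partial>M) \<noteq> \<infinity>"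
    by (auto simp: top_unique)
  then have "AE w in M. (\<Sum>n. ennreal (norm (P (Suc n) w - P n w))) \<noteq> \<infinity>"
    by (intro nn_integral_PInf_AE) auto
  then have AE: "AE w in M. (\<lambda>n. P n w) \<longlonglongrightarrow> lim (\<lambda>n. P n w)"
  proof eventually_elim
    case (elim w)
    then have "summable (\<lambda>n. norm (P (Suc n) w - P n w))"
      by (intro summable_suminf_not_top) auto
    then have "summable (\<lambda>n. P (Suc n) w - P n w)" by (rule summable_norm_cancel)
    then have "convergent (\<lambda>n. \<Sum>i<n. P (Suc i) w - P i w)" by (simp add: summable_iff_convergent)
    then have "convergent (\<lambda>n. P n w - P 0 w)" 
      by (simp only: sum_lessThan_telescope[of "\<lambda>i. P i w"])
    then have "convergent (\<lambda>n. P n w)"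
      using convergent_add_const_right_iff[of "\<lambda>n. P n w" "- P 0 w"] by simp
    then show ?case by (simp add: convergent_LIMSEQ_iff)
  qed
  \<comment> \<open>Where the sequence diverges, \<open>lim\<close> is an unspecified value; this
    happens on a null set only, and \<open>S\<close> is measurable all the same.\<close>
  define S where "S w = lim (\<lambda>n. P n w)" for w
  have [measurable]: "S \<in> borel_measurable M" unfolding S_def by simp
  have fatou: "(\<integral>\<^sup>+w. ennreal ((norm (S w - P n w))\<^sup>2) \<partial>M) \<le> ennreal ((2 * s n)\<^sup>2)" for n
  proof -
    have "(\<integral>\<^sup>+w. ennreal ((norm (S w - P n w))\<^sup>2) \<partial>M) =
        (\<integral>\<^sup>+w. liminf (\<lambda>k. ennreal ((norm (P (n + k) w - P n w))\<^sup>2)) \<partial>M)"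
    proof (rule nn_integral_cong_AE)
      show "AE w in M. ennreal ((norm (S w - P n w))\<^sup>2) =
          liminf (\<lambda>k. ennreal ((norm (P (n + k) w - P n w))\<^sup>2))"
        using AE
      proof eventually_elim
        case (elim w)
        then have "(\<lambda>k. P (n + k) w) \<longlonglongrightarrow> S w"
          using LIMSEQ_ignore_initial_segment[of "\<lambda>n. P n w" _ n] by (simp add: S_def add.commute)
        then have "(\<lambda>k. ennreal ((norm (P (n + k) w - P n w))\<^sup>2)) \<longlonglongrightarrow> ennreal ((norm (S w - P n w))\<^sup>2)"
          by (intro tendsto_intros)
        then show ?case by (metis lim_imp_Liminf trivial_limit_sequentially)
      qed
    qed
    also have "\<dots> \<le> liminf (\<lambda>k. \<integral>\<^sup>+w. ennreal ((norm (P (n + k) w - P n w))\<^sup>2) \<partial>M)"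
      by (rule nn_integral_liminf) simp
    also have "\<dots> \<le> liminf (\<lambda>k. ennreal ((2 * s n)\<^sup>2))"
    proof (rule Liminf_mono, rule always_eventually, rule allI)
      fix k
      have "(\<integral>\<^sup>+w. ennreal ((norm (P (n + k) w - P n w))\<^sup>2) \<partial>M) =
          ennreal ((L2dist M (P (n + k)) (P n))\<^sup>2)"
        unfolding L2norm_power2
        by (rule nn_integral_eq_integral) (use L2_integrable_power2[OF L2_diff[OF P P]] in auto)
      also have "\<dots> \<le> ennreal ((2 * s n)\<^sup>2)"
      proof (intro ennreal_leI power_mono)
        have "s n * (2 - 2 * (1/2)^k) \<le> s n * 2" using s0 by (intro mult_left_mono) auto
        then show "L2dist M (P (n + k)) (P n) \<le> 2 * s n" using dist[of n k] by simp
      qed simp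
      finally show "(\<integral>\<^sup>+w. ennreal ((norm (P (n + k) w - P n w))\<^sup>2) \<partial>M) \<le> ennreal ((2 * s n)\<^sup>2)" .
    qed
    also have "\<dots> = ennreal ((2 * s n)\<^sup>2)" by (simp add: Liminf_const)
    finally show ?thesis .
  qed
  have diff: "(\<lambda>w. S w - P n w) \<in> L2 M" for n
    unfolding L2_def using fatou[of n]
    by (auto intro!: integrableI_bounded simp: le_less_trans[OF _ ennreal_less_top])
  have "S \<in> L2 M"
    using L2_add[OF diff[of 0] P[of 0]] by simp
  moreover have "L2dist M S (P n) \<le> 2 * s n" for n
  proof (rule power2_le_imp_le)
    have "ennreal ((L2dist M S (P n))\<^sup>2) = (\<integral>\<^sup>+w. ennreal ((norm (S w - P n w))\<^sup>2) \<partial>M)"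
      unfolding L2norm_power2
      by (rule nn_integral_eq_integral[symmetric]) (use L2_integrable_power2[OF diff] in auto)
    also have "\<dots> \<le> ennreal ((2 * s n)\<^sup>2)" by (rule fatou)
    finally show "(L2dist M S (P n))\<^sup>2 \<le> (2 * s n)\<^sup>2" by (simp add: ennreal_le_iff)
  qed (simp add: s0)
  ultimately show thesis by (rule that)
qed

end

section \<open>Infima of concave functions on \<open>L\<^sup>2\<close>\<close>

context prob_space
begin

text \<open>Continuity of the costs is proved along sequences, whereas the gliding hump asks for a
  whole ball on which a strict upper bound persists.\<close>

lemma L2_seq_cont_eps_delta:
  fixes F :: "('a \<Rightarrow> 'b::euclidean_space) \<Rightarrow> real"
  assumes cont: "\<And>Y. (\<And>k. Y k \<in> L2 M) \<Longrightarrow> (\<lambda>k. L2dist M (Y k) X) \<longlonglongrightarrow> 0 \<Longrightarrow>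
      (\<lambda>k::nat. F (Y k)) \<longlonglongrightarrow> F X"
    and less: "F X < B"
  shows "\<exists>r>0. \<forall>Y\<in>L2 M. L2dist M Y X < r \<longrightarrow> F Y < B"
proof (rule ccontr)
  assume neg: "\<not> ?thesis"
  have "\<exists>Y\<in>L2 M. L2dist M Y X < 1 / Suc k \<and> B \<le> F Y" for k :: nat
    using neg[simplified, rule_format, of "1 / Suc k"] by (auto simp: not_less)
  then obtain Y where Y: "\<And>k. Y k \<in> L2 M" "\<And>k. L2dist M (Y k) X < 1 / Suc k"
    "\<And>k. B \<le> F (Y k)"
    by metis
  have "(\<lambda>k. L2dist M (Y k) X) \<longlonglongrightarrow> 0"
  proof (rule real_tendsto_sandwich[OF _ _ tendsto_const LIMSEQ_Suc[OF lim_1_over_n]])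
    show "\<forall>\<^sub>F k in sequentially. L2dist M (Y k) X \<le> 1 / real (Suc k)"
      using Y(2) by (auto intro: always_eventually less_imp_le)
  qed simp
  from cont[OF Y(1) this] have "(\<lambda>k. F (Y k)) \<longlonglongrightarrow> F X" .
  then have "B \<le> F X" using Y(3) by (intro LIMSEQ_le_const) auto
  with less show False by simp
qed

text \<open>
  Baire's theorem in the form of a gliding hump: if the infimum were unbounded below near one
  point, by concavity it would be so near every point, and one could build a convergent series
  along which the infimum tends to \<open>- \<infinity>\<close>.
\<close>

lemma L2_concave_INF_locally_bounded:
  fixes c :: "'i \<Rightarrow> ('a \<Rightarrow> 'b::euclidean_space) \<Rightarrow> real"
  assumes I: "I \<noteq> {}"
    and concave: "\<And>i X Y t. i \<in> I \<Longrightarrow> X \<in> L2 M \<Longrightarrow> Y \<in> L2 M \<Longrightarrow> 0 \<le> t \<Longrightarrow> t \<le> 1 \<Longrightarrow>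
      (1 - t) * c i X + t * c i Y \<le> c i (\<lambda>w. (1 - t) *\<^sub>R X w + t *\<^sub>R Y w)"
    and cont: "\<And>i X Y. i \<in> I \<Longrightarrow> X \<in> L2 M \<Longrightarrow> (\<And>k. Y k \<in> L2 M) \<Longrightarrow>
      (\<lambda>k. L2dist M (Y k) X) \<longlonglongrightarrow> 0 \<Longrightarrow> (\<lambda>k::nat. c i (Y k)) \<longlonglongrightarrow> c i X"
    and bdd: "\<And>X. X \<in> L2 M \<Longrightarrow> bdd_below ((\<lambda>i. c i X) ` I)"
    and X: "X \<in> L2 M"
  shows "\<exists>r>0. \<exists>B. \<forall>V\<in>L2 M. L2norm M V < r \<longrightarrow> B \<le> (INF i\<in>I. c i (\<lambda>w. X w + V w))"
proof (rule ccontr)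
  assume neg: "\<not> ?thesis"
  define G where "G X = (INF i\<in>I. c i X)" for X
  have G_le: "G Y \<le> c i Y" if "Y \<in> L2 M" "i \<in> I" for Y i
    unfolding G_def by (rule cINF_lower[OF bdd]) (use that in auto)
  have "\<exists>i\<in>I. c i Y < B" if "G Y < B" for Y B
    using that cINF_greatest[OF I, of B "\<lambda>i. c i Y"] unfolding G_def by (meson not_less)
  note G_less = this
  have G_half: "G Y / 2 + G Z / 2 \<le> G (\<lambda>w. (1/2) *\<^sub>R Y w + (1/2) *\<^sub>R Z w)"
    if Y: "Y \<in> L2 M" and Z: "Z \<in> L2 M" for Y Z
    unfolding G_def[of "\<lambda>w. (1/2) *\<^sub>R Y w + (1/2) *\<^sub>R Z w"]
  proof (rule cINF_greatest[OF I])
    fix i assume i: "i \<in> I"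
    show "G Y / 2 + G Z / 2 \<le> c i (\<lambda>w. (1/2) *\<^sub>R Y w + (1/2) *\<^sub>R Z w)"
      using concave[OF i Y Z, of "1/2"] G_le[OF Y i] G_le[OF Z i] by simp
  qed
  have near_X: "\<exists>V\<in>L2 M. L2norm M V < r \<and> G (\<lambda>w. X w + V w) < B" if "r > 0" for r B
    using neg that unfolding G_def by (meson not_less)
  have near: "\<exists>V\<in>L2 M. L2norm M V < r \<and> G (\<lambda>w. P w + V w) < B" if P: "P \<in> L2 M" and r: "r > 0" for P r B
  proof -
    \<comment> \<open>\<open>R\<close> is the reflection of \<open>P\<close> in \<open>X\<close>, so
      X + V is the midpoint of R and P + 2 V. Since \<open>G R\<close> is a fixed finite number, a
      sufficiently low value at X + V forces a low value at P + 2 V.\<close>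
    define R where "R w = 2 *\<^sub>R X w - P w" for w
    have R: "R \<in> L2 M" unfolding R_def by (intro L2_diff L2_scaleR X P)
    obtain V where V: "V \<in> L2 M" "L2norm M V < r / 2" "G (\<lambda>w. X w + V w) < (B + G R) / 2"
      using near_X[OF half_gt_zero[OF r]] by blast
    define W where "W w = 2 *\<^sub>R V w" for w
    have W: "W \<in> L2 M" unfolding W_def by (intro L2_scaleR V)
    have "(\<lambda>w. (1/2) *\<^sub>R R w + (1/2) *\<^sub>R (P w + W w)) = (\<lambda>w. X w + V w)"
      by (simp add: R_def W_def fun_eq_iff algebra_simps)
    then have "G R / 2 + G (\<lambda>w. P w + W w) / 2 \<le> G (\<lambda>w. X w + V w)"
      using G_half[OF R L2_add[OF P W]] by simp
    then have "G (\<lambda>w. P w + W w) < B" using V(3) by simp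
    moreover have "L2norm M W < r" unfolding W_def using V(2) by (simp add: L2norm_scaleR)
    ultimately show ?thesis using W by blast
  qed
  \<comment> \<open>The radius is \<open>2 * s\<close> because the radii will be halved at each
    step, which keeps the limit of the centres within \<open>2 * s\<close> of the current one. A
    single control then shows that the infimum at the limit is below -n.\<close>
  define hump where "hump n P s \<longleftrightarrow>
      (\<exists>i\<in>I. \<forall>Y\<in>L2 M. L2dist M Y P \<le> 2 * s \<longrightarrow> c i Y < - real n)" for n P s
  have "\<exists>f. \<forall>n. (fst (f n) \<in> L2 M \<and> snd (f n) > 0) \<and>
      (L2dist M (fst (f (Suc n))) (fst (f n)) \<le> snd (f n) \<and>
       snd (f (Suc n)) \<le> snd (f n) / 2 \<and> hump n (fst (f (Suc n))) (snd (f (Suc n))))"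
  proof (rule dependent_nat_choice)
    show "\<exists>x :: ('a \<Rightarrow> 'b) \<times> real. fst x \<in> L2 M \<and> 0 < snd x"
      by (rule exI[of _ "(X, 1::real)"]) (use X in auto)
    fix x :: "('a \<Rightarrow> 'b) \<times> real" and n :: nat
    assume x: "fst x \<in> L2 M \<and> 0 < snd x"
    obtain V where V: "V \<in> L2 M" "L2norm M V < snd x" "G (\<lambda>w. fst x w + V w) < - real n"
      using near[of "fst x" "snd x" "- real n"] x by auto
    define P where "P w = fst x w + V w" for w
    have P: "P \<in> L2 M" unfolding P_def using x V by (intro L2_add) auto
    have "G P < - real n" using V(3) by (simp add: P_def[abs_def])
    then obtain i where i: "i \<in> I" "c i P < - real n" using G_less by blast
    obtain r where r: "r > 0" "\<And>Y. Y \<in> L2 M \<Longrightarrow> L2dist M Y P < r \<Longrightarrow> c i Y < - real n"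
      using L2_seq_cont_eps_delta[where F = "c i", OF cont[OF i(1) P] i(2)] by blast
    \<comment> \<open>The first bound halves the radius; r / 3 makes \<open>2 * s\<close> smaller
      than \<open>r\<close>.\<close>
    define s where "s = min (snd x / 2) (r / 3)"
    have "hump n P s" unfolding hump_def
    proof (intro bexI[OF _ i(1)] ballI impI)
      fix Y assume "Y \<in> L2 M" "L2dist M Y P \<le> 2 * s"
      then show "c i Y < - real n" using r by (auto simp: s_def min_def split: if_splits)
    qed
    moreover have "L2dist M P (fst x) \<le> snd x" using V(2) by (simp add: P_def)
    ultimately show "\<exists>y. (fst y \<in> L2 M \<and> 0 < snd y) \<and>
        L2dist M (fst y) (fst x) \<le> snd x \<and> snd y \<le> snd x / 2 \<and> hump n (fst y) (snd y)"
      using P x r(1) by (intro exI[of _ "(P, s)"]) (auto simp: s_def)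
  qed
  then obtain f where f: "\<And>n. fst (f n) \<in> L2 M"
    "\<And>n. L2dist M (fst (f (Suc n))) (fst (f n)) \<le> snd (f n)"
    "\<And>n. snd (f (Suc n)) \<le> snd (f n) / 2" "\<And>n. hump n (fst (f (Suc n))) (snd (f (Suc n)))"
    by blast
  obtain S where S: "S \<in> L2 M" "\<And>n. L2dist M S (fst (f n)) \<le> 2 * snd (f n)"
    using L2_complete[of "\<lambda>n. fst (f n)" "\<lambda>n. snd (f n)"] f by blast
  have "G S < - real n" for n
  proof -
    obtain i where "i \<in> I" "c i S < - real n"
      using f(4)[of n] S unfolding hump_def by blast
    then show ?thesis using G_le[OF S(1)] by fastforce
  qed
  moreover obtain n where "- G S < real n" using reals_Archimedean2 by blast
  ultimately show False by (metis less_asym minus_less_iff)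
qed

text \<open>Upper semicontinuity is inherited from an index that is nearly optimal at
  \<open>X\<close>. For lower semicontinuity, a point near \<open>X\<close> is a convex combination,
  with small weight \<open>t\<close>, of \<open>X\<close> and a point at moderate distance where the
  local lower bound holds; concavity limits the loss to \<open>t\<close> times a constant.\<close>

lemma L2_concave_INF_continuous:
  fixes c :: "'i \<Rightarrow> ('a \<Rightarrow> 'b::euclidean_space) \<Rightarrow> real"
  assumes I: "I \<noteq> {}"
    and concave: "\<And>i X Y t. i \<in> I \<Longrightarrow> X \<in> L2 M \<Longrightarrow> Y \<in> L2 M \<Longrightarrow> 0 \<le> t \<Longrightarrow> t \<le> 1 \<Longrightarrow>
      (1 - t) * c i X + t * c i Y \<le> c i (\<lambda>w. (1 - t) *\<^sub>R X w + t *\<^sub>R Y w)"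
    and cont: "\<And>i X Y. i \<in> I \<Longrightarrow> X \<in> L2 M \<Longrightarrow> (\<And>k. Y k \<in> L2 M) \<Longrightarrow>
      (\<lambda>k. L2dist M (Y k) X) \<longlonglongrightarrow> 0 \<Longrightarrow> (\<lambda>k::nat. c i (Y k)) \<longlonglongrightarrow> c i X"
    and bdd: "\<And>X. X \<in> L2 M \<Longrightarrow> bdd_below ((\<lambda>i. c i X) ` I)"
    and X: "X \<in> L2 M" and Y: "\<And>k. Y k \<in> L2 M"
    and lim: "(\<lambda>k. L2dist M (Y k) X) \<longlonglongrightarrow> 0"
  shows "(\<lambda>k::nat. INF i\<in>I. c i (Y k)) \<longlonglongrightarrow> (INF i\<in>I. c i X)"
proof -
  define G where "G X = (INF i\<in>I. c i X)" for X
  have G_le: "G Y \<le> c i Y" if "Y \<in> L2 M" "i \<in> I" for Y i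
    unfolding G_def by (rule cINF_lower[OF bdd]) (use that in auto)
  have "(\<lambda>k. G (Y k)) \<longlonglongrightarrow> G X"
  proof (rule order_tendstoI)
    fix a assume "G X < a"
    then obtain i where i: "i \<in> I" "c i X < a"
      using cINF_greatest[OF I, of a "\<lambda>i. c i X"] unfolding G_def by (meson not_less)
    from order_tendstoD(2)[OF cont[OF i(1) X Y lim] i(2)]
    show "\<forall>\<^sub>F k in sequentially. G (Y k) < a"
      by eventually_elim (use G_le[OF Y i(1)] in \<open>auto intro: le_less_trans\<close>)
  next
    fix a assume a: "a < G X"
    obtain r B where r: "r > 0" and B: "\<And>V. V \<in> L2 M \<Longrightarrow> L2norm M V < r \<Longrightarrow> B \<le> G (\<lambda>w. X w + V w)"
      using L2_concave_INF_locally_bounded[where c = c, OF I concave cont bdd X] unfolding G_def by blast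
    \<comment> \<open>Lowering the bound makes \<open>G X - B'\<close> at least 1, so the division
      in \<open>t\<close> is harmless. With this \<open>t\<close> the loss
      \<open>t * (G X - B')\<close> is at most half of the available gap
      \<open>G X - a\<close>.\<close>
    define B' where "B' = min B (G X - 1)"
    define t where "t = min 1 ((G X - a) / (2 * (G X - B')))"
    have t: "0 < t" "t \<le> 1" using a by (auto simp: t_def B'_def)
    have "t * (G X - B') \<le> (G X - a) / (2 * (G X - B')) * (G X - B')"
      by (rule mult_right_mono) (auto simp: t_def B'_def)
    also have "\<dots> = (G X - a) / 2" 
    proof -
      have "G X - B' \<noteq> 0" by (simp add: B'_def)
      then show ?thesis by (metis nonzero_mult_divide_mult_cancel_right times_divide_eq_left)
    qed
    finally have tB: "t * (G X - B') < G X - a" using a by simp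
    have "\<forall>\<^sub>F k in sequentially. L2dist M (Y k) X < t * r"
      using order_tendstoD(2)[OF lim, of "t * r"] t r by simp
    then show "\<forall>\<^sub>F k in sequentially. a < G (Y k)"
    proof eventually_elim
      case (elim k)
      \<comment> \<open>The displacement is magnified by 1 / t, which puts \<open>Y k\<close> at the
        fraction \<open>t\<close> of the way from X to X + V.\<close>
      define V where "V w = (1 / t) *\<^sub>R (Y k w - X w)" for w
      have V: "V \<in> L2 M" unfolding V_def by (intro L2_scaleR L2_diff X Y)
      have XV: "(\<lambda>w. X w + V w) \<in> L2 M" by (intro L2_add X V)
      have "L2norm M V < r"
        unfolding V_def L2norm_scaleR using elim t by (simp add: divide_simps ac_simps)
      then have "B' \<le> G (\<lambda>w. X w + V w)" using B[OF V] by (simp add: B'_def)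
      have eq: "(\<lambda>w. (1 - t) *\<^sub>R X w + t *\<^sub>R (X w + V w)) = Y k"
        using t by (simp add: V_def fun_eq_iff algebra_simps)
      have "(1 - t) * G X + t * B' \<le> G (Y k)"
        unfolding G_def[of "Y k"]
      proof (rule cINF_greatest[OF I])
        fix i assume i: "i \<in> I"
        have "(1 - t) * G X + t * B' \<le> (1 - t) * c i X + t * c i (\<lambda>w. X w + V w)"
          using t G_le[OF X i] G_le[OF XV i] \<open>B' \<le> G (\<lambda>w. X w + V w)\<close>
          by (intro add_mono mult_left_mono) auto
        also have "\<dots> \<le> c i (Y k)" using concave[OF i X XV, of t] t eq by simp
        finally show "(1 - t) * G X + t * B' \<le> c i (Y k)" .
      qed
      then show "a < G (Y k)" using tB by (simp add: algebra_simps)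
    qed
  qed
  then show ?thesis by (simp add: G_def)
qed

end

section \<open>Calculus of Wasserstein derivatives\<close>

abbreviation first_order_error where
  "first_order_error \<Omega> U g \<mu> \<xi> \<eta> \<equiv>
     U (law \<Omega> (\<lambda>w. \<xi> w + \<eta> w)) - U \<mu> - (LINT w|\<Omega>. g (\<xi> w) \<bullet> \<eta> w)"

lemma P2_law:
  assumes "prob_space \<Omega>" and X: "X \<in> L2 \<Omega>"
  shows "law \<Omega> X \<in> P2"
proof -
  interpret prob_space \<Omega> by fact
  have "X \<in> borel_measurable \<Omega>" using X by (rule L2_measurable)
  then show ?thesis
    using L2_integrable_power2[OF X]
    by (auto simp: P2_def law_def prob_space_distr integrable_distr_eq)
qed

lemma has_wasserstein_derivative_L2:
  assumes g: "g \<in> borel_measurable borel" "integrable \<mu> (\<lambda>x. (norm (g x))\<^sup>2)"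
    and \<xi>: "\<xi> \<in> L2 \<Omega>" "law \<Omega> \<xi> = \<mu>"
  shows "(\<lambda>w. g (\<xi> w)) \<in> L2 \<Omega>"
  using g L2_measurable[OF \<xi>(1)] unfolding \<xi>(2)[symmetric] law_def L2_def
  by (auto simp: integrable_distr_eq)

lemma has_wasserstein_derivativeI:
  assumes "g \<in> borel_measurable borel" "integrable \<mu> (\<lambda>x. (norm (g x))\<^sup>2)"
    and "\<And>\<xi> \<epsilon>. \<xi> \<in> L2 \<Omega> \<Longrightarrow> law \<Omega> \<xi> = \<mu> \<Longrightarrow> (\<lambda>w. g (\<xi> w)) \<in> L2 \<Omega> \<Longrightarrow> \<epsilon> > 0 \<Longrightarrow>
      \<exists>r>0. \<forall>\<eta>\<in>L2 \<Omega>. L2norm \<Omega> \<eta> < r \<longrightarrow>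
        \<bar>first_order_error \<Omega> U g \<mu> \<xi> \<eta>\<bar> \<le> \<epsilon> * L2norm \<Omega> \<eta>"
  shows "has_wasserstein_derivative \<Omega> U g \<mu>"
  unfolding has_wasserstein_derivative_def L2norm_def[symmetric]
proof (intro conjI ballI allI impI)
  fix \<xi> and \<epsilon> :: real assume "\<xi> \<in> L2 \<Omega>" "law \<Omega> \<xi> = \<mu>" "\<epsilon> > 0"
  with assms(3)[OF this(1,2) has_wasserstein_derivative_L2[OF assms(1,2) this(1,2)] this(3)]
  show "\<exists>r>0. \<forall>\<eta>\<in>L2 \<Omega>. L2norm \<Omega> \<eta> < r \<longrightarrow>
      \<bar>first_order_error \<Omega> U g (law \<Omega> \<xi>) \<xi> \<eta>\<bar> \<le> \<epsilon> * L2norm \<Omega> \<eta>"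
    by simp
qed (use assms in auto)

lemma has_wasserstein_derivativeD:
  assumes "has_wasserstein_derivative \<Omega> U g \<mu>"
  shows "g \<in> borel_measurable borel" "integrable \<mu> (\<lambda>x. (norm (g x))\<^sup>2)"
    and "\<xi> \<in> L2 \<Omega> \<Longrightarrow> law \<Omega> \<xi> = \<mu> \<Longrightarrow> (\<lambda>w. g (\<xi> w)) \<in> L2 \<Omega>"
    and "\<xi> \<in> L2 \<Omega> \<Longrightarrow> law \<Omega> \<xi> = \<mu> \<Longrightarrow> \<epsilon> > 0 \<Longrightarrow>
      \<exists>r>0. \<forall>\<eta>\<in>L2 \<Omega>. L2norm \<Omega> \<eta> < r \<longrightarrow>
        \<bar>first_order_error \<Omega> U g \<mu> \<xi> \<eta>\<bar> \<le> \<epsilon> * L2norm \<Omega> \<eta>"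
proof -
  show g: "g \<in> borel_measurable borel" "integrable \<mu> (\<lambda>x. (norm (g x))\<^sup>2)"
    using assms by (auto simp: has_wasserstein_derivative_def)
  show "\<xi> \<in> L2 \<Omega> \<Longrightarrow> law \<Omega> \<xi> = \<mu> \<Longrightarrow> (\<lambda>w. g (\<xi> w)) \<in> L2 \<Omega>"
    by (rule has_wasserstein_derivative_L2[OF g])
  show "\<xi> \<in> L2 \<Omega> \<Longrightarrow> law \<Omega> \<xi> = \<mu> \<Longrightarrow> \<epsilon> > 0 \<Longrightarrow>
      \<exists>r>0. \<forall>\<eta>\<in>L2 \<Omega>. L2norm \<Omega> \<eta> < r \<longrightarrow>
        \<bar>first_order_error \<Omega> U g \<mu> \<xi> \<eta>\<bar> \<le> \<epsilon> * L2norm \<Omega> \<eta>"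
    using assms by (auto simp: has_wasserstein_derivative_def L2norm_def)
qed

lemma integrable_power2_add:
  fixes f g :: "'a \<Rightarrow> 'b::euclidean_space"
  assumes "f \<in> borel_measurable \<mu>" "integrable \<mu> (\<lambda>x. (norm (f x))\<^sup>2)"
    and "g \<in> borel_measurable \<mu>" "integrable \<mu> (\<lambda>x. (norm (g x))\<^sup>2)"
  shows "integrable \<mu> (\<lambda>x. (norm (f x + g x))\<^sup>2)"
  using assms L2_integrable_power2[OF L2_add[of f \<mu> g]] by (simp add: L2_def)

lemma has_wasserstein_derivative_const:
  "has_wasserstein_derivative \<Omega> (\<lambda>_. c) (\<lambda>_. 0) \<mu>"
  by (rule has_wasserstein_derivativeI) (auto intro: exI[of _ 1])

lemma has_wasserstein_derivative_add:
  fixes \<Omega> :: "'w measure" and F G :: "'a::euclidean_space measure \<Rightarrow> real"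
  assumes F: "has_wasserstein_derivative \<Omega> F f \<mu>" and G: "has_wasserstein_derivative \<Omega> G g \<mu>"
    and \<mu>: "\<mu> \<in> P2"
  shows "has_wasserstein_derivative \<Omega> (\<lambda>\<nu>. F \<nu> + G \<nu>) (\<lambda>x. f x + g x) \<mu>"
proof (rule has_wasserstein_derivativeI)
  note F' = has_wasserstein_derivativeD[OF F] and G' = has_wasserstein_derivativeD[OF G]
  note [measurable] = F'(1) G'(1)
  show "(\<lambda>x. f x + g x) \<in> borel_measurable borel" by simp
  have "sets \<mu> = sets borel" using \<mu> by (simp add: P2_def)
  then show "integrable \<mu> (\<lambda>x. (norm (f x + g x))\<^sup>2)"
    by (intro integrable_power2_add F'(2) G'(2)) (simp_all cong: measurable_cong_sets)
  fix \<xi> and \<epsilon> :: real assume \<xi>: "\<xi> \<in> L2 \<Omega>" "law \<Omega> \<xi> = \<mu>" and \<epsilon>: "\<epsilon> > 0"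
  obtain r1 where r1: "r1 > 0" "\<And>\<eta>. \<eta> \<in> L2 \<Omega> \<Longrightarrow> L2norm \<Omega> \<eta> < r1 \<Longrightarrow>
      \<bar>first_order_error \<Omega> F f \<mu> \<xi> \<eta>\<bar> \<le> \<epsilon> / 2 * L2norm \<Omega> \<eta>"
    using F'(4)[OF \<xi> half_gt_zero[OF \<epsilon>]] by blast
  obtain r2 where r2: "r2 > 0" "\<And>\<eta>. \<eta> \<in> L2 \<Omega> \<Longrightarrow> L2norm \<Omega> \<eta> < r2 \<Longrightarrow>
      \<bar>first_order_error \<Omega> G g \<mu> \<xi> \<eta>\<bar> \<le> \<epsilon> / 2 * L2norm \<Omega> \<eta>"
    using G'(4)[OF \<xi> half_gt_zero[OF \<epsilon>]] by blast
  show "\<exists>r>0. \<forall>\<eta>\<in>L2 \<Omega>. L2norm \<Omega> \<eta> < r \<longrightarrow>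
      \<bar>F (law \<Omega> (\<lambda>w. \<xi> w + \<eta> w)) + G (law \<Omega> (\<lambda>w. \<xi> w + \<eta> w)) - (F \<mu> + G \<mu>) -
        (LINT w|\<Omega>. (f (\<xi> w) + g (\<xi> w)) \<bullet> \<eta> w)\<bar> \<le> \<epsilon> * L2norm \<Omega> \<eta>"
  proof (intro exI[of _ "min r1 r2"] conjI ballI impI)
    fix \<eta> :: "'w \<Rightarrow> 'a" assume \<eta>: "\<eta> \<in> L2 \<Omega>" "L2norm \<Omega> \<eta> < min r1 r2"
    have "(LINT w|\<Omega>. (f (\<xi> w) + g (\<xi> w)) \<bullet> \<eta> w) =
        (LINT w|\<Omega>. f (\<xi> w) \<bullet> \<eta> w) + (LINT w|\<Omega>. g (\<xi> w) \<bullet> \<eta> w)"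
      using L2_integrable_inner[OF F'(3)[OF \<xi>] \<eta>(1)] L2_integrable_inner[OF G'(3)[OF \<xi>] \<eta>(1)]
      by (simp add: inner_add_left)
    moreover have "L2norm \<Omega> \<eta> < r1" "L2norm \<Omega> \<eta> < r2" using \<eta>(2) by auto
    ultimately show "\<bar>F (law \<Omega> (\<lambda>w. \<xi> w + \<eta> w)) + G (law \<Omega> (\<lambda>w. \<xi> w + \<eta> w)) - (F \<mu> + G \<mu>) -
        (LINT w|\<Omega>. (f (\<xi> w) + g (\<xi> w)) \<bullet> \<eta> w)\<bar> \<le> \<epsilon> * L2norm \<Omega> \<eta>"
      using r1(2)[OF \<eta>(1)] r2(2)[OF \<eta>(1)] by linarith
  qed (use r1 r2 in auto)
qed

lemma has_wasserstein_derivative_sum: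
  assumes "finite I" "\<mu> \<in> P2" "\<And>i. i \<in> I \<Longrightarrow> has_wasserstein_derivative \<Omega> (F i) (f i) \<mu>"
  shows "has_wasserstein_derivative \<Omega> (\<lambda>\<nu>. \<Sum>i\<in>I. F i \<nu>) (\<lambda>x. \<Sum>i\<in>I. f i x) \<mu>"
  using assms(1,3)
  by (induction I rule: finite_induct)
    (auto intro!: has_wasserstein_derivative_const has_wasserstein_derivative_add assms(2))

text \<open>The error splits into the product of both increments, which is of second order, and the
  two first-order errors multiplied by the values at \<mu>.\<close>

lemma has_wasserstein_derivative_mult:
  fixes \<Omega> :: "'w measure" and F G :: "'a::euclidean_space measure \<Rightarrow> real"
  assumes F: "has_wasserstein_derivative \<Omega> F f \<mu>" and G: "has_wasserstein_derivative \<Omega> G g \<mu>"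
    and \<mu>: "\<mu> \<in> P2"
  shows "has_wasserstein_derivative \<Omega> (\<lambda>\<nu>. F \<nu> * G \<nu>) (\<lambda>x. G \<mu> *\<^sub>R f x + F \<mu> *\<^sub>R g x) \<mu>"
proof (rule has_wasserstein_derivativeI)
  note F' = has_wasserstein_derivativeD[OF F] and G' = has_wasserstein_derivativeD[OF G]
  note [measurable] = F'(1) G'(1)
  show "(\<lambda>x. G \<mu> *\<^sub>R f x + F \<mu> *\<^sub>R g x) \<in> borel_measurable borel" by simp
  have "sets \<mu> = sets borel" using \<mu> by (simp add: P2_def)
  then show "integrable \<mu> (\<lambda>x. (norm (G \<mu> *\<^sub>R f x + F \<mu> *\<^sub>R g x))\<^sup>2)"
    by (intro integrable_power2_add)
      (simp_all add: power_mult_distrib F'(2) G'(2) cong: measurable_cong_sets)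
  fix \<xi> and \<epsilon> :: real assume \<xi>: "\<xi> \<in> L2 \<Omega>" "law \<Omega> \<xi> = \<mu>" and \<epsilon>: "\<epsilon> > 0"
  define a b where "a = L2norm \<Omega> (\<lambda>w. f (\<xi> w))" and "b = L2norm \<Omega> (\<lambda>w. g (\<xi> w))"
  have ab: "0 \<le> a" "0 \<le> b" by (auto simp: a_def b_def)
  \<comment> \<open>With e \<le> 1 the increments are at most (a + 1) n and (b + 1) n, where n is
    the norm of the perturbation. The second bound keeps the weighted first-order errors within half
    of the tolerance.\<close>
  define e where "e = min 1 (\<epsilon> / (2 * (1 + \<bar>F \<mu>\<bar> + \<bar>G \<mu>\<bar>)))"
  have e: "e > 0" "e \<le> 1" using \<epsilon> by (auto simp: e_def add_pos_nonneg)
  have "e * (1 + \<bar>F \<mu>\<bar> + \<bar>G \<mu>\<bar>) \<le> \<epsilon> / (2 * (1 + \<bar>F \<mu>\<bar> + \<bar>G \<mu>\<bar>)) * (1 + \<bar>F \<mu>\<bar> + \<bar>G \<mu>\<bar>)"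
    by (rule mult_right_mono) (auto simp: e_def)
  also have "\<dots> = \<epsilon> / 2"
  proof -
    have "1 + \<bar>F \<mu>\<bar> + \<bar>G \<mu>\<bar> \<noteq> 0" by simp
    then show ?thesis by (metis nonzero_mult_divide_mult_cancel_right times_divide_eq_left)
  qed
  finally have e2: "e * (1 + \<bar>F \<mu>\<bar> + \<bar>G \<mu>\<bar>) \<le> \<epsilon> / 2" .
  obtain r1 where r1: "r1 > 0" "\<And>\<eta>. \<eta> \<in> L2 \<Omega> \<Longrightarrow> L2norm \<Omega> \<eta> < r1 \<Longrightarrow>
      \<bar>first_order_error \<Omega> F f \<mu> \<xi> \<eta>\<bar> \<le> e * L2norm \<Omega> \<eta>"
    using F'(4)[OF \<xi> e(1)] by blast
  obtain r2 where r2: "r2 > 0" "\<And>\<eta>. \<eta> \<in> L2 \<Omega> \<Longrightarrow> L2norm \<Omega> \<eta> < r2 \<Longrightarrow>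
      \<bar>first_order_error \<Omega> G g \<mu> \<xi> \<eta>\<bar> \<le> e * L2norm \<Omega> \<eta>"
    using G'(4)[OF \<xi> e(1)] by blast
  \<comment> \<open>Below this radius the product of the increments, at most (a + 1) (b + 1) n^2,
    fits into the other half of the tolerance.\<close>
  define r3 where "r3 = \<epsilon> / (2 * ((a + 1) * (b + 1)))"
  have r3: "r3 > 0" using \<epsilon> ab by (auto simp: r3_def)
  show "\<exists>r>0. \<forall>\<eta>\<in>L2 \<Omega>. L2norm \<Omega> \<eta> < r \<longrightarrow>
      \<bar>F (law \<Omega> (\<lambda>w. \<xi> w + \<eta> w)) * G (law \<Omega> (\<lambda>w. \<xi> w + \<eta> w)) - F \<mu> * G \<mu> -
        (LINT w|\<Omega>. (G \<mu> *\<^sub>R f (\<xi> w) + F \<mu> *\<^sub>R g (\<xi> w)) \<bullet> \<eta> w)\<bar> \<le> \<epsilon> * L2norm \<Omega> \<eta>"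
  proof (intro exI[of _ "min r3 (min r1 r2)"] conjI ballI impI)
    fix \<eta> :: "'w \<Rightarrow> 'a" assume \<eta>: "\<eta> \<in> L2 \<Omega>" "L2norm \<Omega> \<eta> < min r3 (min r1 r2)"
    define n where "n = L2norm \<Omega> \<eta>"
    define dF where "dF = F (law \<Omega> (\<lambda>w. \<xi> w + \<eta> w)) - F \<mu>"
    define dG where "dG = G (law \<Omega> (\<lambda>w. \<xi> w + \<eta> w)) - G \<mu>"
    define lF where "lF = (LINT w|\<Omega>. f (\<xi> w) \<bullet> \<eta> w)"
    define lG where "lG = (LINT w|\<Omega>. g (\<xi> w) \<bullet> \<eta> w)"
    have n: "0 \<le> n" by (simp add: n_def)
    have eF: "\<bar>dF - lF\<bar> \<le> e * n" and eG: "\<bar>dG - lG\<bar> \<le> e * n"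
      using r1(2)[of \<eta>] r2(2)[of \<eta>] \<eta> by (auto simp: dF_def dG_def lF_def lG_def n_def)
    have "\<bar>lF\<bar> \<le> a * n" "\<bar>lG\<bar> \<le> b * n"
      using L2_Cauchy_Schwarz[OF F'(3)[OF \<xi>] \<eta>(1)] L2_Cauchy_Schwarz[OF G'(3)[OF \<xi>] \<eta>(1)]
      by (auto simp: lF_def lG_def a_def b_def n_def)
    moreover have "e * n \<le> n" using e n by (simp add: mult_left_le_one_le)
    ultimately have "\<bar>dF\<bar> \<le> (a + 1) * n" "\<bar>dG\<bar> \<le> (b + 1) * n"
      using eF eG by (simp_all add: algebra_simps abs_le_iff)
    then have "\<bar>dF\<bar> * \<bar>dG\<bar> \<le> ((a + 1) * n) * ((b + 1) * n)"
      by (intro mult_mono) (use ab n in auto)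
    then have "\<bar>dF * dG\<bar> \<le> ((a + 1) * (b + 1) * n) * n"
      by (simp add: abs_mult algebra_simps)
    also have "\<dots> \<le> \<epsilon> / 2 * n"
    proof (rule mult_right_mono)
      have "n \<le> r3" using \<eta> by (simp add: n_def)
      moreover have "0 < (a + 1) * (b + 1)" using ab by simp
      ultimately show "(a + 1) * (b + 1) * n \<le> \<epsilon> / 2" by (simp add: r3_def field_simps)
    qed (use n in auto)
    finally have 1: "\<bar>dF * dG\<bar> \<le> \<epsilon> / 2 * n" .
    have "\<bar>F \<mu> * (dG - lG) + G \<mu> * (dF - lF)\<bar> \<le> \<bar>F \<mu>\<bar> * \<bar>dG - lG\<bar> + \<bar>G \<mu>\<bar> * \<bar>dF - lF\<bar>"
      by (metis abs_mult abs_triangle_ineq)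
    also have "\<dots> \<le> \<bar>F \<mu>\<bar> * (e * n) + \<bar>G \<mu>\<bar> * (e * n)"
      using eF eG by (intro add_mono mult_left_mono) auto
    also have "\<dots> \<le> (e * (1 + \<bar>F \<mu>\<bar> + \<bar>G \<mu>\<bar>)) * n"
      using e n by (simp add: algebra_simps)
    also have "\<dots> \<le> \<epsilon> / 2 * n" using e2 n by (rule mult_right_mono)
    finally have 2: "\<bar>F \<mu> * (dG - lG) + G \<mu> * (dF - lF)\<bar> \<le> \<epsilon> / 2 * n" .
    have "(LINT w|\<Omega>. (G \<mu> *\<^sub>R f (\<xi> w) + F \<mu> *\<^sub>R g (\<xi> w)) \<bullet> \<eta> w) = G \<mu> * lF + F \<mu> * lG"
      using L2_integrable_inner[OF F'(3)[OF \<xi>] \<eta>(1)] L2_integrable_inner[OF G'(3)[OF \<xi>] \<eta>(1)]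
      by (simp add: inner_add_left lF_def lG_def)
    moreover have "F (law \<Omega> (\<lambda>w. \<xi> w + \<eta> w)) * G (law \<Omega> (\<lambda>w. \<xi> w + \<eta> w)) - F \<mu> * G \<mu>
        - (G \<mu> * lF + F \<mu> * lG) = dF * dG + (F \<mu> * (dG - lG) + G \<mu> * (dF - lF))"
      by (simp add: dF_def dG_def algebra_simps)
    ultimately show "\<bar>F (law \<Omega> (\<lambda>w. \<xi> w + \<eta> w)) * G (law \<Omega> (\<lambda>w. \<xi> w + \<eta> w)) - F \<mu> * G \<mu> -
        (LINT w|\<Omega>. (G \<mu> *\<^sub>R f (\<xi> w) + F \<mu> *\<^sub>R g (\<xi> w)) \<bullet> \<eta> w)\<bar> \<le> \<epsilon> * L2norm \<Omega> \<eta>"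
      using 1 2 unfolding n_def[symmetric] by linarith
  qed (use r1 r2 r3 in auto)
qed

lemma has_wasserstein_derivative_cmult:
  assumes "has_wasserstein_derivative \<Omega> F f \<mu>" and "\<mu> \<in> P2"
  shows "has_wasserstein_derivative \<Omega> (\<lambda>\<nu>. c * F \<nu>) (\<lambda>x. c *\<^sub>R f x) \<mu>"
  using has_wasserstein_derivative_mult[OF has_wasserstein_derivative_const assms] by simp

lemma has_wasserstein_derivative_prod:
  assumes "finite I" "\<mu> \<in> P2" "\<And>i. i \<in> I \<Longrightarrow> has_wasserstein_derivative \<Omega> (F i) (f i) \<mu>"
  shows "has_wasserstein_derivative \<Omega> (\<lambda>\<nu>. \<Prod>i\<in>I. F i \<nu>)
    (\<lambda>x. \<Sum>i\<in>I. (\<Prod>j\<in>I - {i}. F j \<mu>) *\<^sub>R f i x) \<mu>"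
  using assms(1,3)
proof (induction I rule: finite_induct)
  case (insert i I)
  have "has_wasserstein_derivative \<Omega> (\<lambda>\<nu>. F i \<nu> * (\<Prod>i\<in>I. F i \<nu>))
    (\<lambda>x. (\<Prod>i\<in>I. F i \<mu>) *\<^sub>R f i x + F i \<mu> *\<^sub>R (\<Sum>i\<in>I. (\<Prod>j\<in>I - {i}. F j \<mu>) *\<^sub>R f i x)) \<mu>"
    using insert by (intro has_wasserstein_derivative_mult assms(2)) auto
  moreover have "F i \<mu> *\<^sub>R (\<Sum>k\<in>I. (\<Prod>j\<in>I - {k}. F j \<mu>) *\<^sub>R f k x) =
      (\<Sum>k\<in>I. (\<Prod>j\<in>insert i I - {k}. F j \<mu>) *\<^sub>R f k x)" for x
    unfolding scaleR_sum_right
  proof (rule sum.cong)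
    fix k assume "k \<in> I"
    then have "insert i I - {k} = insert i (I - {k})" using insert by auto
    then show "F i \<mu> *\<^sub>R (\<Prod>j\<in>I - {k}. F j \<mu>) *\<^sub>R f k x = (\<Prod>j\<in>insert i I - {k}. F j \<mu>) *\<^sub>R f k x"
      using insert by simp
  qed simp
  moreover have "insert i I - {i} = I" using insert by auto
  ultimately show ?case using insert by simp
qed (simp add: has_wasserstein_derivative_const)

section \<open>Smooth functions with bounded derivatives\<close>

text \<open>\<open>G l\<close> stands for the derivative of \<open>G []\<close> along the basis
  vectors in \<open>l\<close>. Boundedness at every order makes every \<open>G l\<close> Lipschitz,
  which yields both the quadratic Taylor remainder and continuity with respect to \<open>W2\<close>.
  The bound may depend on \<open>l\<close>.\<close>

definition test_derivs :: "('a::euclidean_space list \<Rightarrow> 'a \<Rightarrow> real) \<Rightarrow> bool" where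
  "test_derivs G \<longleftrightarrow> (\<forall>l. set l \<subseteq> Basis \<longrightarrow>
     (\<exists>B. \<forall>x. \<bar>G l x\<bar> \<le> B) \<and> has_partials (G l) (\<lambda>b. G (l @ [b])))"

lemma test_derivs_bound:
  assumes "test_derivs G" "set l \<subseteq> Basis"
  obtains B where "\<And>x. \<bar>G l x\<bar> \<le> B"
  using assms unfolding test_derivs_def by blast

lemma test_derivs_bound_Basis:
  fixes G :: "'a::euclidean_space list \<Rightarrow> 'a \<Rightarrow> real"
  assumes G: "test_derivs G" "set l \<subseteq> Basis"
  obtains B where "\<And>b x. b \<in> Basis \<Longrightarrow> \<bar>G (l @ [b]) x\<bar> \<le> B" "B \<ge> 0"
proof -
  have "\<forall>b\<in>Basis. \<exists>B. \<forall>x. \<bar>G (l @ [b]) x\<bar> \<le> B"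
    using G unfolding test_derivs_def by auto
  then obtain B where B: "\<And>b x. b \<in> Basis \<Longrightarrow> \<bar>G (l @ [b]) x\<bar> \<le> B b" by metis
  have B0: "0 \<le> B b" if "b \<in> Basis" for b using B[OF that, of 0] by linarith
  have "\<bar>G (l @ [b]) x\<bar> \<le> (\<Sum>b\<in>Basis. B b)" if "b \<in> Basis" for b x
    using B[OF that, of x] member_le_sum[OF that, of B] B0 by fastforce
  moreover have "0 \<le> (\<Sum>b\<in>Basis. B b)" by (rule sum_nonneg) (rule B0)
  ultimately show thesis by (rule that)
qed

lemma test_derivs_has_partials:
  "test_derivs G \<Longrightarrow> set l \<subseteq> Basis \<Longrightarrow> has_partials (G l) (\<lambda>b. G (l @ [b]))"
  by (simp add: test_derivs_def)

lemma test_derivs_lipschitz: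
  fixes G :: "'a::euclidean_space list \<Rightarrow> 'a \<Rightarrow> real"
  assumes G: "test_derivs G" "set l \<subseteq> Basis"
  obtains L where "L \<ge> 0" "\<And>x h. \<bar>G l (x + h) - G l x\<bar> \<le> L * norm h"
proof -
  obtain B where "\<And>b x. b \<in> Basis \<Longrightarrow> \<bar>G (l @ [b]) x\<bar> \<le> B" "B \<ge> 0"
    using test_derivs_bound_Basis[OF G] by blast
  with partials_increment[OF test_derivs_has_partials[OF G]] that[of "DIM('a) * B"]
  show thesis by simp
qed

lemma test_derivs_continuous:
  assumes "test_derivs G" "set l \<subseteq> Basis"
  shows "continuous_on UNIV (G l)"
  using test_derivs_bound_Basis[OF assms]
    bounded_partials_continuous[OF test_derivs_has_partials[OF assms]] by metis

lemma test_derivs_measurable: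
  assumes "test_derivs G" "set l \<subseteq> Basis"
  shows "G l \<in> borel_measurable borel"
  by (rule borel_measurable_continuous_onI[OF test_derivs_continuous[OF assms]])

lemma test_derivs_quadratic:
  fixes G :: "'a::euclidean_space list \<Rightarrow> 'a \<Rightarrow> real"
  assumes G: "test_derivs G"
  obtains K where "K \<ge> 0"
    "\<And>x h. \<bar>G [] (x + h) - G [] x - (\<Sum>b\<in>Basis. G [b] x *\<^sub>R b) \<bullet> h\<bar> \<le> K * (norm h)\<^sup>2"
proof -
  have "\<forall>b\<in>Basis. \<exists>L\<ge>0. \<forall>x h. \<bar>G [b] (x + h) - G [b] x\<bar> \<le> L * norm h"
    using test_derivs_lipschitz[OF G] by (metis empty_set empty_subsetI insert_subset list.simps(15))
  then obtain L where L: "\<And>b. b \<in> Basis \<Longrightarrow> L b \<ge> 0"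
    "\<And>b x h. b \<in> Basis \<Longrightarrow> \<bar>G [b] (x + h) - G [b] x\<bar> \<le> L b * norm h" by metis
  define L' where "L' = (\<Sum>b\<in>Basis. L b)"
  have L'0: "L' \<ge> 0" unfolding L'_def by (intro sum_nonneg L)
  have L': "\<bar>G [b] z - G [b] x\<bar> \<le> L' * norm h" if "b \<in> Basis" "z \<in> cball x (norm h)" for b x z h
  proof -
    have "\<bar>G [b] z - G [b] x\<bar> \<le> L b * norm (z - x)" using L(2)[OF that(1), of x "z - x"] by simp
    also have "\<dots> \<le> L' * norm h"
      unfolding L'_def using that L(1)
      by (intro mult_mono member_le_sum sum_nonneg) (auto simp: dist_norm norm_minus_commute)
    finally show ?thesis .
  qed
  have P: "has_partials (G []) (\<lambda>b. G [b])" using test_derivs_has_partials[OF G, of "[]"] by simp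
  have "\<bar>G [] (x + h) - G [] x - (\<Sum>b\<in>Basis. G [b] x *\<^sub>R b) \<bullet> h\<bar> \<le> (DIM('a) * L') * (norm h)\<^sup>2" for x h
  proof -
    have "(\<Sum>b\<in>Basis. G [b] x *\<^sub>R b) \<bullet> h = (\<Sum>b\<in>Basis. (h \<bullet> b) * G [b] x)"
      unfolding inner_sum_left by (rule sum.cong) (simp_all add: inner_commute[of _ h])
    then show ?thesis
      using partials_linear_approx[OF P L', of x h] by (simp add: power2_eq_square mult.assoc)
  qed
  then show thesis using that L'0 by (meson of_nat_0_le_iff mult_nonneg_nonneg)
qed

lemma P2_integrable_bounded:
  fixes g :: "'a::euclidean_space \<Rightarrow> 'b::{banach, second_countable_topology}"
  assumes "\<mu> \<in> P2" "g \<in> borel_measurable borel" "\<And>x. norm (g x) \<le> B"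
  shows "integrable \<mu> g"
proof -
  interpret prob_space \<mu> using assms by (simp add: P2_def)
  have "sets \<mu> = sets borel" using assms by (simp add: P2_def)
  then show ?thesis using assms
    by (intro integrable_const_bound[where B = B]) (auto cong: measurable_cong_sets)
qed

text \<open>The integral is linear in the measure, so its derivative is the gradient of the
  integrand at every \<mu>. The pointwise Taylor remainder K |\<eta>|^2 integrates to K times the
  squared L2 norm of \<eta>, which is of smaller order than the norm.\<close>

lemma has_wasserstein_derivative_integral:
  fixes \<Omega> :: "'w measure" and G :: "'a::euclidean_space list \<Rightarrow> 'a \<Rightarrow> real"
  assumes \<Omega>: "prob_space \<Omega>" and G: "test_derivs G" and \<mu>: "\<mu> \<in> P2"
  shows "has_wasserstein_derivative \<Omega> (\<lambda>\<nu>. LINT x|\<nu>. G [] x) (\<lambda>x. \<Sum>b\<in>Basis. G [b] x *\<^sub>R b) \<mu>"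
proof (rule has_wasserstein_derivativeI)
  interpret prob_space \<Omega> by fact
  have G_meas [measurable]: "G [] \<in> borel_measurable borel" "\<And>b. b \<in> Basis \<Longrightarrow> G [b] \<in> borel_measurable borel"
    using test_derivs_measurable[OF G] by auto
  let ?g = "\<lambda>x. \<Sum>b\<in>Basis. G [b] x *\<^sub>R b"
  show g: "?g \<in> borel_measurable borel" by measurable
  obtain B where B: "\<And>b x. b \<in> Basis \<Longrightarrow> \<bar>G [b] x\<bar> \<le> B"
    using test_derivs_bound_Basis[OF G, of "[]", simplified] by metis
  have g_bound: "norm (?g x) \<le> DIM('a) * B" for x
    using sum_norm_bound[of Basis "\<lambda>b. G [b] x *\<^sub>R b" B] B by simp
  have "(norm (?g x))\<^sup>2 \<le> (DIM('a) * B)\<^sup>2" for x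
    using g_bound by (rule power_mono) simp
  then show "integrable \<mu> (\<lambda>x. (norm (?g x))\<^sup>2)"
    by (intro P2_integrable_bounded[OF \<mu>]) auto
  fix \<xi> and \<epsilon> :: real
  assume \<xi>: "\<xi> \<in> L2 \<Omega>" "law \<Omega> \<xi> = \<mu>" and g\<xi>: "(\<lambda>w. ?g (\<xi> w)) \<in> L2 \<Omega>" and \<epsilon>: "\<epsilon> > 0"
  obtain K where K: "K \<ge> 0" "\<And>x h. \<bar>G [] (x + h) - G [] x - ?g x \<bullet> h\<bar> \<le> K * (norm h)\<^sup>2"
    using test_derivs_quadratic[OF G] by blast
  obtain B0 where B0: "\<And>x. \<bar>G [] x\<bar> \<le> B0" using test_derivs_bound[OF G, of "[]"] by auto
  have int: "integrable \<Omega> (\<lambda>w. G [] (X w))" if "X \<in> L2 \<Omega>" for X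
    by (rule integrable_const_bound[where B = B0]) (use B0 L2_measurable[OF that] in auto)
  have law_int: "(LINT x|law \<Omega> X. G [] x) = (LINT w|\<Omega>. G [] (X w))" if "X \<in> L2 \<Omega>" for X
    unfolding law_def by (rule integral_distr) (use L2_measurable[OF that] in auto)
  show "\<exists>r>0. \<forall>\<eta>\<in>L2 \<Omega>. L2norm \<Omega> \<eta> < r \<longrightarrow>
      \<bar>(LINT x|law \<Omega> (\<lambda>w. \<xi> w + \<eta> w). G [] x) - (LINT x|\<mu>. G [] x)
        - (LINT w|\<Omega>. ?g (\<xi> w) \<bullet> \<eta> w)\<bar> \<le> \<epsilon> * L2norm \<Omega> \<eta>"
  \<comment> \<open>\<open>K\<close> may be 0, hence K + 1 in the denominator.\<close>
  proof (intro exI[of _ "\<epsilon> / (K + 1)"] conjI ballI impI)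
    show "\<epsilon> / (K + 1) > 0" using K \<epsilon> by simp
    fix \<eta> :: "'w \<Rightarrow> 'a" assume \<eta>: "\<eta> \<in> L2 \<Omega>" "L2norm \<Omega> \<eta> < \<epsilon> / (K + 1)"
    have \<xi>\<eta>: "(\<lambda>w. \<xi> w + \<eta> w) \<in> L2 \<Omega>" by (rule L2_add[OF \<xi>(1) \<eta>(1)])
    have "(LINT x|law \<Omega> (\<lambda>w. \<xi> w + \<eta> w). G [] x) - (LINT x|\<mu>. G [] x)
        - (LINT w|\<Omega>. ?g (\<xi> w) \<bullet> \<eta> w) =
        (LINT w|\<Omega>. G [] (\<xi> w + \<eta> w) - G [] (\<xi> w) - ?g (\<xi> w) \<bullet> \<eta> w)"
      unfolding \<xi>(2)[symmetric] law_int[OF \<xi>\<eta>] law_int[OF \<xi>(1)]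
      using int[OF \<xi>\<eta>] int[OF \<xi>(1)] L2_integrable_inner[OF g\<xi> \<eta>(1)] by simp
    also have "\<bar>\<dots>\<bar> \<le> (LINT w|\<Omega>. \<bar>G [] (\<xi> w + \<eta> w) - G [] (\<xi> w) - ?g (\<xi> w) \<bullet> \<eta> w\<bar>)"
      by (rule integral_abs_bound)
    also have "\<dots> \<le> (LINT w|\<Omega>. K * (norm (\<eta> w))\<^sup>2)"
      using int[OF \<xi>\<eta>] int[OF \<xi>(1)] L2_integrable_inner[OF g\<xi> \<eta>(1)] L2_integrable_power2[OF \<eta>(1)] K(2)
      by (intro integral_mono) auto
    also have "\<dots> = (K * L2norm \<Omega> \<eta>) * L2norm \<Omega> \<eta>"
      using L2norm_power2[of \<Omega> \<eta>] by (simp add: power2_eq_square mult.assoc)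
    also have "\<dots> \<le> \<epsilon> * L2norm \<Omega> \<eta>"
    proof (rule mult_right_mono)
      have "K * L2norm \<Omega> \<eta> \<le> (K + 1) * L2norm \<Omega> \<eta>" by (simp add: algebra_simps)
      also have "\<dots> \<le> \<epsilon>" using \<eta>(2) K(1) by (simp add: field_simps)
      finally show "K * L2norm \<Omega> \<eta> \<le> \<epsilon>" .
    qed simp
    finally show "\<bar>(LINT x|law \<Omega> (\<lambda>w. \<xi> w + \<eta> w). G [] x) - (LINT x|\<mu>. G [] x)
        - (LINT w|\<Omega>. ?g (\<xi> w) \<bullet> \<eta> w)\<bar> \<le> \<epsilon> * L2norm \<Omega> \<eta>" .
  qed
qed

section \<open>Polynomials of linear functionals of the measure\<close>

text \<open>Joint continuity is recast as convergence along a filter, so that the limit rules for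
  sums, products and compositions apply.\<close>

definition wasserstein_nhds ::
    "nat \<Rightarrow> 'a::euclidean_space measure \<Rightarrow> 'a list \<Rightarrow> ('a measure \<times> 'a list) filter" where
  "wasserstein_nhds j \<mu> xs = (INF r\<in>{0<..}. principal {(\<nu>, ys). \<nu> \<in> P2 \<and> length ys = j \<and>
     W2 \<mu> \<nu> < r \<and> (\<forall>k<j. dist (xs ! k) (ys ! k) < r)})"

lemma eventually_wasserstein_nhds:
  "eventually P (wasserstein_nhds j \<mu> xs) \<longleftrightarrow> (\<exists>r>0. \<forall>\<nu>\<in>P2. \<forall>ys. length ys = j \<longrightarrow>
     W2 \<mu> \<nu> < r \<longrightarrow> (\<forall>k<j. dist (xs ! k) (ys ! k) < r) \<longrightarrow> P (\<nu>, ys))"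
proof -
  have "eventually P (wasserstein_nhds j \<mu> xs) \<longleftrightarrow>
      (\<exists>r\<in>{0<..}. eventually P (principal {(\<nu>, ys). \<nu> \<in> P2 \<and> length ys = j \<and>
        W2 \<mu> \<nu> < r \<and> (\<forall>k<j. dist (xs ! k) (ys ! k) < r)}))"
    unfolding wasserstein_nhds_def
  proof (rule eventually_INF_base)
    fix a b :: real assume "a \<in> {0<..}" "b \<in> {0<..}"
    then show "\<exists>x\<in>{0<..}. principal {(\<nu>, ys). \<nu> \<in> P2 \<and> length ys = j \<and> W2 \<mu> \<nu> < x \<and>
          (\<forall>k<j. dist (xs ! k) (ys ! k) < x)} \<le>
        inf (principal {(\<nu>, ys). \<nu> \<in> P2 \<and> length ys = j \<and> W2 \<mu> \<nu> < a \<and>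
          (\<forall>k<j. dist (xs ! k) (ys ! k) < a)})
         (principal {(\<nu>, ys). \<nu> \<in> P2 \<and> length ys = j \<and> W2 \<mu> \<nu> < b \<and>
          (\<forall>k<j. dist (xs ! k) (ys ! k) < b)})"
      by (intro bexI[of _ "min a b"]) auto
  qed auto
  then show ?thesis by (simp add: eventually_principal Ball_def Bex_def imp_conjL)
qed

lemma jointly_continuous_iff:
  "jointly_continuous j G \<longleftrightarrow> (\<forall>\<mu>\<in>P2. \<forall>xs. length xs = j \<longrightarrow>
     ((\<lambda>(\<nu>, ys). G \<nu> ys) \<longlongrightarrow> G \<mu> xs) (wasserstein_nhds j \<mu> xs))"
  unfolding jointly_continuous_def tendsto_iff eventually_wasserstein_nhds dist_real_def
  by auto

text \<open>Along a coupling the two integrals differ by at most \<open>L\<close> times the expected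
  distance, hence by at most \<open>L\<close> times the root mean square distance. The strict bound
  on \<open>W2\<close> supplies a coupling whose cost is below r^2, so an optimal coupling never has
  to be constructed.\<close>

lemma W2_integral_lipschitz:
  fixes g :: "'a::euclidean_space \<Rightarrow> real"
  assumes \<mu>: "\<mu> \<in> P2" and \<nu>: "\<nu> \<in> P2" and g: "\<And>x y. \<bar>g x - g y\<bar> \<le> L * dist x y" and bound: "\<And>x. \<bar>g x\<bar> \<le> B"
    and meas [measurable]: "g \<in> borel_measurable borel" and L: "L \<ge> 0" and W2: "W2 \<mu> \<nu> < r"
  shows "\<bar>(LINT x|\<nu>. g x) - (LINT x|\<mu>. g x)\<bar> \<le> L * r"
proof -
  interpret \<mu>: prob_space \<mu> using \<mu> by (simp add: P2_def)
  interpret \<nu>: prob_space \<nu> using \<nu> by (simp add: P2_def)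
  interpret \<mu>\<nu>: pair_prob_space \<mu> \<nu> ..
  have sets [measurable_cong]: "sets \<mu> = sets borel" "sets \<nu> = sets borel"
    using \<mu> \<nu> by (auto simp: P2_def)
  have "distr (\<mu> \<Otimes>\<^sub>M \<nu>) borel fst = distr (\<mu> \<Otimes>\<^sub>M \<nu>) \<mu> fst"
    by (rule distr_cong) (simp_all add: sets)
  also have "\<dots> = \<mu>" by (rule \<nu>.distr_pair_fst)
  finally have "distr (\<mu> \<Otimes>\<^sub>M \<nu>) borel fst = \<mu>" .
  moreover have "distr (\<mu> \<Otimes>\<^sub>M \<nu>) borel snd = \<nu>"
  proof (rule measure_eqI)
    fix A assume "A \<in> sets (distr (\<mu> \<Otimes>\<^sub>M \<nu>) borel snd)"
    then have A [measurable]: "A \<in> sets borel" by simp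
    have "emeasure (distr (\<mu> \<Otimes>\<^sub>M \<nu>) borel snd) A = emeasure (\<mu> \<Otimes>\<^sub>M \<nu>) (space \<mu> \<times> A)"
      using sets.sets_into_space[OF A] sets_eq_imp_space_eq[OF sets(2)]
      by (subst emeasure_distr) (auto intro!: arg_cong2[where f = emeasure] simp: space_pair_measure)
    also have "\<dots> = emeasure \<mu> (space \<mu>) * emeasure \<nu> A"
      by (rule \<nu>.emeasure_pair_measure_Times) (use A in \<open>simp_all add: sets(2)\<close>)
    finally show "emeasure (distr (\<mu> \<Otimes>\<^sub>M \<nu>) borel snd) A = emeasure \<nu> A"
      by (simp add: \<mu>.emeasure_space_1)
  qed (simp add: sets)
  moreover have "sets (\<mu> \<Otimes>\<^sub>M \<nu>) = sets borel"
    by (simp add: sets borel_prod[symmetric] cong: sets_pair_measure_cong)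
  ultimately have "\<mu> \<Otimes>\<^sub>M \<nu> \<in> couplings \<mu> \<nu>"
    using \<mu>\<nu>.prob_space_axioms by (simp add: couplings_def)
  \<comment> \<open>The product measure rules out an infimum over the empty set, whose value would
    carry no information.\<close>
  then have ne: "couplings \<mu> \<nu> \<noteq> {}" by auto
  obtain \<pi> where \<pi>: "\<pi> \<in> couplings \<mu> \<nu>" "sqrt (LINT p|\<pi>. (dist (fst p) (snd p))\<^sup>2) < r"
  proof (cases "r > 0")
    case True
    have "(INF \<pi> \<in> couplings \<mu> \<nu>. LINT p|\<pi>. (dist (fst p) (snd p))\<^sup>2) < r\<^sup>2"
      using W2 True real_sqrt_less_iff[of "INF \<pi> \<in> couplings \<mu> \<nu>. LINT p|\<pi>. (dist (fst p) (snd p))\<^sup>2" "r\<^sup>2"]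
      by (simp add: W2_def)
    from cInf_lessD[OF _ this] ne
    obtain \<pi> where "\<pi> \<in> couplings \<mu> \<nu>" "(LINT p|\<pi>. (dist (fst p) (snd p))\<^sup>2) < r\<^sup>2" by auto
    moreover from this(2) have "sqrt (LINT p|\<pi>. (dist (fst p) (snd p))\<^sup>2) < sqrt (r\<^sup>2)"
      by (rule real_sqrt_less_mono)
    ultimately show thesis using True that by simp
  next
    \<comment> \<open>A radius r \<le> 0 is contradictory: costs are nonnegative, so
      \<open>W2\<close> cannot be negative.\<close>
    case False
    then have "(INF \<pi> \<in> couplings \<mu> \<nu>. LINT p|\<pi>. (dist (fst p) (snd p))\<^sup>2) < 0"
      using W2 real_sqrt_ge_zero[of "INF \<pi> \<in> couplings \<mu> \<nu>. LINT p|\<pi>. (dist (fst p) (snd p))\<^sup>2"]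
      unfolding W2_def by linarith
    moreover have "0 \<le> (INF \<pi> \<in> couplings \<mu> \<nu>. LINT p|\<pi>. (dist (fst p) (snd p))\<^sup>2)"
      by (rule cINF_greatest[OF ne]) simp
    ultimately show thesis by simp
  qed
  interpret \<pi>: prob_space \<pi> using \<pi> by (simp add: couplings_def)
  have sets\<pi>: "sets \<pi> = sets borel" and marg: "distr \<pi> borel fst = \<mu>" "distr \<pi> borel snd = \<nu>"
    using \<pi> by (auto simp: couplings_def)
  have [measurable]: "fst \<in> borel_measurable \<pi>" "snd \<in> borel_measurable \<pi>"
    by (simp_all add: sets\<pi> borel_prod[symmetric] cong: measurable_cong_sets)
  \<comment> \<open>Finite second moments of the marginals make the squared distance integrable, so
    the cost is a true integral rather than the default value 0.\<close>
  have "fst \<in> L2 \<pi>" "snd \<in> L2 \<pi>"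
    using \<mu> \<nu> unfolding L2_def P2_def marg[symmetric] by (auto simp: integrable_distr_eq)
  then have d: "(\<lambda>p. fst p - snd p) \<in> L2 \<pi>" by (rule L2_diff)
  have int: "integrable \<pi> (\<lambda>p. g (fst p))" "integrable \<pi> (\<lambda>p. g (snd p))"
    by (auto intro!: \<pi>.integrable_const_bound[where B = B] simp: bound)
  have "(LINT x|\<nu>. g x) - (LINT x|\<mu>. g x) = (LINT p|\<pi>. g (snd p) - g (fst p))"
    unfolding marg[symmetric] using int by (simp add: integral_distr)
  also have "\<bar>\<dots>\<bar> \<le> (LINT p|\<pi>. \<bar>g (snd p) - g (fst p)\<bar>)" by (rule integral_abs_bound)
  also have "\<dots> \<le> (LINT p|\<pi>. L * norm (fst p - snd p))"
  proof (rule integral_mono)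
    show "\<bar>g (snd p) - g (fst p)\<bar> \<le> L * norm (fst p - snd p)" for p
      using g[of "snd p" "fst p"] by (simp add: dist_norm norm_minus_commute)
  qed (use int \<pi>.L2_integrable[OF L2_norm[OF d]] in auto)
  also have "\<dots> = L * (LINT p|\<pi>. norm (fst p - snd p))" by simp
  also have "\<dots> \<le> L * L2norm \<pi> (\<lambda>p. fst p - snd p)"
    by (intro mult_left_mono \<pi>.L2_integral_norm_le d L)
  also have "\<dots> \<le> L * r"
    using \<pi>(2) L by (intro mult_left_mono) (auto simp: L2norm_def dist_norm)
  finally show ?thesis .
qed

lemma tendsto_integral_wasserstein_nhds:
  fixes G :: "'a::euclidean_space list \<Rightarrow> 'a \<Rightarrow> real"
  assumes G: "test_derivs G" and \<mu>: "\<mu> \<in> P2"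
  shows "((\<lambda>(\<nu>, ys). LINT x|\<nu>. G [] x) \<longlongrightarrow> (LINT x|\<mu>. G [] x)) (wasserstein_nhds j \<mu> xs)"
proof (rule tendstoI)
  fix e :: real assume e: "e > 0"
  obtain L where L: "L \<ge> 0" "\<And>x h. \<bar>G [] (x + h) - G [] x\<bar> \<le> L * norm h"
    using test_derivs_lipschitz[OF G, of "[]"] by auto
  have L': "\<bar>G [] x - G [] y\<bar> \<le> L * dist x y" for x y
    using L(2)[of y "x - y"] by (simp add: dist_norm)
  obtain B where B: "\<And>x. \<bar>G [] x\<bar> \<le> B" using test_derivs_bound[OF G, of "[]"] by auto
  show "\<forall>\<^sub>F x in wasserstein_nhds j \<mu> xs.
      dist (case x of (\<nu>, ys) \<Rightarrow> LINT x|\<nu>. G [] x) (LINT x|\<mu>. G [] x) < e"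
    unfolding eventually_wasserstein_nhds
  proof (intro exI[of _ "e / (L + 1)"] conjI ballI allI impI)
    show "e / (L + 1) > 0" using e L by simp
    fix \<nu> ys assume "\<nu> \<in> P2" "W2 \<mu> \<nu> < e / (L + 1)"
    then have "\<bar>(LINT x|\<nu>. G [] x) - (LINT x|\<mu>. G [] x)\<bar> \<le> L * (e / (L + 1))"
      using test_derivs_measurable[OF G, of "[]"]
      by (intro W2_integral_lipschitz[OF \<mu> _ L' B _ L(1)]) auto
    also have "\<dots> < e" using e L(1) pos_divide_less_eq[of "L + 1" "L * e" e] by (simp add: algebra_simps)
    finally show "dist (case (\<nu>, ys) of (\<nu>, ys) \<Rightarrow> LINT x|\<nu>. G [] x) (LINT x|\<mu>. G [] x) < e"
      by (simp add: dist_real_def)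
  qed
qed

text \<open>
  The derivatives of \<open>\<mu> \<mapsto> \<Prod>i\<in>I. \<integral>g\<^sub>i d\<mu>\<close>, where \<open>G i l\<close> is the derivative of \<open>g\<^sub>i\<close> along \<open>l\<close>:
  each measure derivative turns one of the remaining factors \<open>\<integral>g\<^sub>i d\<mu>\<close> into a derivative of
  \<open>g\<^sub>i\<close> at the new point.
\<close>

primrec product_derivs ::
    "('i \<Rightarrow> 'a::euclidean_space list \<Rightarrow> 'a \<Rightarrow> real) \<Rightarrow> 'a list list \<Rightarrow> 'i set \<Rightarrow> 'a measure \<Rightarrow> 'a list \<Rightarrow> real"
  where
  "product_derivs G [] I \<mu> xs = (\<Prod>i\<in>I. LINT x|\<mu>. G i [] x)"
| "product_derivs G (l # \<alpha>) I \<mu> xs =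
     (\<Sum>i\<in>I. G i l (hd xs) * product_derivs G \<alpha> (I - {i}) \<mu> (tl xs))"

text \<open>The new direction is appended as the last list. So the induction passes over the earlier
  factors, which are constants in the measure, and the product rule is applied only at the end, to
  the integrals that remain.\<close>

lemma product_derivs_measure_deriv:
  fixes G :: "'i \<Rightarrow> 'a::euclidean_space list \<Rightarrow> 'a \<Rightarrow> real"
  assumes \<Omega>: "prob_space \<Omega>" and G: "\<And>i. test_derivs (G i)" and \<mu>: "\<mu> \<in> P2"
  shows "finite I \<Longrightarrow> length xs = length \<alpha> \<Longrightarrow>
    has_wasserstein_derivative \<Omega> (\<lambda>\<nu>. product_derivs G \<alpha> I \<nu> xs)
      (\<lambda>x. \<Sum>v\<in>Basis. product_derivs G (\<alpha> @ [[v]]) I \<mu> (xs @ [x]) *\<^sub>R v) \<mu>"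
proof (induction \<alpha> arbitrary: I xs)
  case Nil
  have "has_wasserstein_derivative \<Omega> (\<lambda>\<nu>. \<Prod>i\<in>I. LINT x|\<nu>. G i [] x)
    (\<lambda>x. \<Sum>i\<in>I. (\<Prod>j\<in>I - {i}. LINT x|\<mu>. G j [] x) *\<^sub>R (\<Sum>b\<in>Basis. G i [b] x *\<^sub>R b)) \<mu>"
    by (intro has_wasserstein_derivative_prod has_wasserstein_derivative_integral Nil \<mu> \<Omega> G)
  moreover have "(\<Sum>i\<in>I. (\<Prod>j\<in>I - {i}. LINT x|\<mu>. G j [] x) *\<^sub>R (\<Sum>b\<in>Basis. G i [b] x *\<^sub>R b)) =
      (\<Sum>v\<in>Basis. (\<Sum>i\<in>I. G i [v] x * (\<Prod>j\<in>I - {i}. LINT x|\<mu>. G j [] x)) *\<^sub>R v)" for x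
    unfolding scaleR_sum_right scaleR_sum_left by (subst sum.swap) (simp add: mult.commute)
  ultimately show ?case using Nil by simp
next
  case (Cons l \<alpha>)
  obtain y ys where xs: "xs = y # ys" "length ys = length \<alpha>"
    using Cons.prems by (auto simp: length_Suc_conv)
  have "has_wasserstein_derivative \<Omega> (\<lambda>\<nu>. \<Sum>i\<in>I. G i l y * product_derivs G \<alpha> (I - {i}) \<nu> ys)
    (\<lambda>x. \<Sum>i\<in>I. G i l y *\<^sub>R (\<Sum>v\<in>Basis. product_derivs G (\<alpha> @ [[v]]) (I - {i}) \<mu> (ys @ [x]) *\<^sub>R v)) \<mu>"
    using Cons xs by (intro has_wasserstein_derivative_sum has_wasserstein_derivative_cmult \<mu>) auto
  moreover have "(\<Sum>i\<in>I. G i l y *\<^sub>R (\<Sum>v\<in>Basis. product_derivs G (\<alpha> @ [[v]]) (I - {i}) \<mu> (ys @ [x]) *\<^sub>R v)) =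
      (\<Sum>v\<in>Basis. (\<Sum>i\<in>I. G i l y * product_derivs G (\<alpha> @ [[v]]) (I - {i}) \<mu> (ys @ [x])) *\<^sub>R v)" for x
    unfolding scaleR_sum_right scaleR_sum_left by (subst sum.swap) simp
  ultimately show ?case using xs by simp
qed

text \<open>Only the factor extracted by the \<open>k\<close>-th list sees the \<open>k\<close>-th
  point, and extending that list differentiates it.\<close>

lemma product_derivs_point_deriv:
  fixes G :: "'i \<Rightarrow> 'a::euclidean_space list \<Rightarrow> 'a \<Rightarrow> real"
  assumes G: "\<And>i. test_derivs (G i)" and w: "w \<in> Basis"
  shows "multi_index \<alpha> \<Longrightarrow> length xs = length \<alpha> \<Longrightarrow> k < length \<alpha> \<Longrightarrow>
    ((\<lambda>t. product_derivs G \<alpha> I \<mu> (xs[k := xs ! k + t *\<^sub>R w]))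
       has_real_derivative product_derivs G (\<alpha>[k := \<alpha> ! k @ [w]]) I \<mu> xs) (at 0)"
proof (induction \<alpha> arbitrary: I xs k)
  case (Cons l \<alpha>)
  obtain y ys where xs: "xs = y # ys" "length ys = length \<alpha>"
    using Cons.prems by (auto simp: length_Suc_conv)
  show ?case
  proof (cases k)
    case 0
    have "set l \<subseteq> Basis" using Cons.prems by (simp add: multi_index_def)
    then have "((\<lambda>t. G i l (y + t *\<^sub>R w)) has_real_derivative G i (l @ [w]) y) (at 0)" for i
      using test_derivs_has_partials[OF G] w unfolding has_partials_def by blast
    then show ?thesis by (auto simp: xs 0 intro!: derivative_eq_intros)
  next
    case (Suc k')
    have "multi_index \<alpha>" "k' < length \<alpha>" using Cons.prems Suc by (auto simp: multi_index_def)
    note IH = Cons.IH[OF this(1) xs(2) this(2)]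
    have "((\<lambda>t. G i l y * product_derivs G \<alpha> (I - {i}) \<mu> (ys[k' := ys ! k' + t *\<^sub>R w]))
        has_real_derivative G i l y * product_derivs G (\<alpha>[k' := \<alpha> ! k' @ [w]]) (I - {i}) \<mu> ys) (at 0)" for i
      by (rule DERIV_cmult[OF IH])
    then show ?thesis by (auto simp: xs Suc intro!: DERIV_sum)
  qed
qed simp

lemma filterlim_tl_wasserstein_nhds:
  "filterlim (\<lambda>(\<nu>, ys). (\<nu>, tl ys)) (wasserstein_nhds j \<mu> ys) (wasserstein_nhds (Suc j) \<mu> (y # ys))"
  unfolding filterlim_iff eventually_wasserstein_nhds
proof (intro allI impI, elim exE conjE)
  fix P r assume r: "0 < r" "\<forall>\<nu>\<in>P2. \<forall>zs. length zs = j \<longrightarrow> W2 \<mu> \<nu> < r \<longrightarrow>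
      (\<forall>k<j. dist (ys ! k) (zs ! k) < r) \<longrightarrow> P (\<nu>, zs)"
  show "\<exists>r>0. \<forall>\<nu>\<in>P2. \<forall>zs. length zs = Suc j \<longrightarrow> W2 \<mu> \<nu> < r \<longrightarrow>
      (\<forall>k<Suc j. dist ((y # ys) ! k) (zs ! k) < r) \<longrightarrow> P (case (\<nu>, zs) of (\<nu>, ys) \<Rightarrow> (\<nu>, tl ys))"
  proof (intro exI[of _ r] conjI ballI allI impI r(1))
    fix \<nu> zs assume *: "\<nu> \<in> P2" "length zs = Suc j" "W2 \<mu> \<nu> < r"
      and d: "\<forall>k<Suc j. dist ((y # ys) ! k) (zs ! k) < r"
    obtain z zs' where zs: "zs = z # zs'" "length zs' = j" using *(2) by (auto simp: length_Suc_conv)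
    have "\<forall>k<j. dist (ys ! k) (zs' ! k) < r" using d zs by auto
    then show "P (case (\<nu>, zs) of (\<nu>, ys) \<Rightarrow> (\<nu>, tl ys))" using * r(2) zs by simp
  qed
qed

lemma tendsto_hd_wasserstein_nhds:
  "((\<lambda>(\<nu>, ys). hd ys) \<longlongrightarrow> y) (wasserstein_nhds (Suc j) \<mu> (y # ys))"
proof (rule tendstoI)
  fix e :: real assume "e > 0"
  then show "\<forall>\<^sub>F x in wasserstein_nhds (Suc j) \<mu> (y # ys). dist (case x of (\<nu>, ys) \<Rightarrow> hd ys) y < e"
    unfolding eventually_wasserstein_nhds
    by (intro exI[of _ e]) (auto simp: length_Suc_conv dist_commute)
qed

lemma product_derivs_jointly_continuous:
  fixes G :: "'i \<Rightarrow> 'a::euclidean_space list \<Rightarrow> 'a \<Rightarrow> real"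
  assumes G: "\<And>i. test_derivs (G i)" and \<mu>: "\<mu> \<in> P2"
  shows "multi_index \<alpha> \<Longrightarrow> length xs = length \<alpha> \<Longrightarrow>
    ((\<lambda>(\<nu>, ys). product_derivs G \<alpha> I \<nu> ys) \<longlongrightarrow> product_derivs G \<alpha> I \<mu> xs)
      (wasserstein_nhds (length \<alpha>) \<mu> xs)"
proof (induction \<alpha> arbitrary: I xs)
  case Nil
  show ?case
    unfolding product_derivs.simps case_prod_beta
    by (intro tendsto_prod tendsto_integral_wasserstein_nhds[OF G \<mu>, unfolded case_prod_beta])
next
  case (Cons l \<alpha>)
  obtain y ys where xs: "xs = y # ys" "length ys = length \<alpha>"
    using Cons.prems by (auto simp: length_Suc_conv)
  have "multi_index \<alpha>" "set l \<subseteq> Basis" using Cons.prems by (auto simp: multi_index_def)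
  have 1: "((\<lambda>(\<nu>, ys). G i l (hd ys)) \<longlongrightarrow> G i l y) (wasserstein_nhds (Suc (length \<alpha>)) \<mu> (y # ys))" for i
  proof -
    have "isCont (G i l) y"
      using test_derivs_continuous[OF G \<open>set l \<subseteq> Basis\<close>] by (simp add: continuous_on_eq_continuous_at)
    from isCont_tendsto_compose[OF this tendsto_hd_wasserstein_nhds[unfolded case_prod_beta]]
    show ?thesis unfolding case_prod_beta .
  qed
  have 2: "((\<lambda>(\<nu>, ys). product_derivs G \<alpha> I \<nu> (tl ys)) \<longlongrightarrow> product_derivs G \<alpha> I \<mu> ys)
      (wasserstein_nhds (Suc (length \<alpha>)) \<mu> (y # ys))" for I
    using filterlim_compose[OF Cons.IH[OF \<open>multi_index \<alpha>\<close> xs(2)] filterlim_tl_wasserstein_nhds[where y = y]]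
    unfolding case_prod_beta fst_conv snd_conv .
  show ?case
    unfolding xs product_derivs.simps list.sel list.size(4) add_Suc_right add_0_right case_prod_beta
    by (intro tendsto_sum tendsto_mult 1[unfolded case_prod_beta] 2[unfolded case_prod_beta])
qed

lemma product_derivs_bounded:
  fixes G :: "'i \<Rightarrow> 'a::euclidean_space list \<Rightarrow> 'a \<Rightarrow> real"
  assumes G: "\<And>i. test_derivs (G i)"
  shows "multi_index \<alpha> \<Longrightarrow> \<exists>C. \<forall>\<mu>\<in>P2. \<forall>xs. \<bar>product_derivs G \<alpha> I \<mu> xs\<bar> \<le> C"
proof (induction \<alpha> arbitrary: I)
  case Nil
  have "\<forall>i. \<exists>B. \<forall>x. \<bar>G i [] x\<bar> \<le> B" using test_derivs_bound[OF G, of "[]"] by (metis empty_set empty_subsetI)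
  then obtain B where B: "\<And>i x. \<bar>G i [] x\<bar> \<le> B i" by metis
  have "\<bar>\<Prod>i\<in>I. LINT x|\<mu>. G i [] x\<bar> \<le> (\<Prod>i\<in>I. B i)" if "\<mu> \<in> P2" for \<mu> :: "'a measure"
    unfolding abs_prod
  proof (intro prod_mono conjI)
    fix i
    interpret prob_space \<mu> using that by (simp add: P2_def)
    have "integrable \<mu> (G i [])"
      using test_derivs_measurable[OF G, of "[]"] by (intro P2_integrable_bounded[OF that, where B = "B i"]) (auto simp: B)
    then have "(LINT x|\<mu>. \<bar>G i [] x\<bar>) \<le> B i"
      using B by (intro integral_le_const) auto
    then show "\<bar>LINT x|\<mu>. G i [] x\<bar> \<le> B i"
      using integral_abs_bound order_trans by blast
  qed simp
  then show ?case by auto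
next
  case (Cons l \<alpha>)
  then have \<alpha>: "multi_index \<alpha>" and l: "set l \<subseteq> Basis" by (auto simp: multi_index_def)
  obtain C where C: "\<And>I \<mu> xs. \<mu> \<in> P2 \<Longrightarrow> \<bar>product_derivs G \<alpha> I \<mu> xs\<bar> \<le> C I"
    using Cons.IH[OF \<alpha>] by metis
  have "\<forall>i. \<exists>B. \<forall>x. \<bar>G i l x\<bar> \<le> B" using test_derivs_bound[OF G l] by metis
  then obtain B where B: "\<And>i x. \<bar>G i l x\<bar> \<le> B i" by metis
  have "\<bar>product_derivs G (l # \<alpha>) I \<mu> xs\<bar> \<le> (\<Sum>i\<in>I. B i * C (I - {i}))" if "\<mu> \<in> P2" for \<mu> xs
    unfolding product_derivs.simps
  proof (rule order_trans[OF sum_abs], rule sum_mono)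
    fix i assume "i \<in> I"
    show "\<bar>G i l (hd xs) * product_derivs G \<alpha> (I - {i}) \<mu> (tl xs)\<bar> \<le> B i * C (I - {i})"
      unfolding abs_mult using B C[OF that] by (intro mult_mono) (auto intro: order_trans[OF abs_ge_zero])
  qed
  then show ?case by blast
qed

text \<open>Each multi-index has its own bound, whereas \<open>derivs_bounded_by\<close> asks for
  one constant. Since the lists are non-empty, the total order controls both their number and their
  lengths.\<close>

lemma finite_multi_index: "finite {\<alpha> :: 'a::euclidean_space list list. multi_index \<alpha> \<and> total_order \<alpha> \<le> n}"
proof (rule finite_subset)
  show "{\<alpha> :: 'a list list. multi_index \<alpha> \<and> total_order \<alpha> \<le> n} \<subseteq>
      {\<alpha>. set \<alpha> \<subseteq> {l. set l \<subseteq> Basis \<and> length l \<le> n} \<and> length \<alpha> \<le> n}"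
  proof (rule subsetI)
    fix \<alpha> :: "'a list list" assume "\<alpha> \<in> {\<alpha>. multi_index \<alpha> \<and> total_order \<alpha> \<le> n}"
    then have \<alpha>: "multi_index \<alpha>" "total_order \<alpha> \<le> n" by auto
    have "sum_list (map (\<lambda>l. 1) \<alpha>) \<le> sum_list (map length \<alpha>)"
      using \<alpha>(1) by (intro sum_list_mono) (auto simp: multi_index_def Suc_le_eq)
    then have "length \<alpha> \<le> n" using \<alpha>(2) by (simp add: total_order_def sum_list_triv)
    moreover have "set l \<subseteq> Basis \<and> length l \<le> n" if l: "l \<in> set \<alpha>" for l
    proof -
      have "length l \<le> sum_list (map length \<alpha>)" using l by (intro member_le_sum_list) auto
      then show ?thesis using \<alpha> l by (auto simp: total_order_def multi_index_def)
    qed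
    ultimately show "\<alpha> \<in> {\<alpha>. set \<alpha> \<subseteq> {l. set l \<subseteq> Basis \<and> length l \<le> n} \<and> length \<alpha> \<le> n}"
      by auto
  qed
  show "finite {\<alpha> :: 'a list list. set \<alpha> \<subseteq> {l. set l \<subseteq> Basis \<and> length l \<le> n} \<and> length \<alpha> \<le> n}"
    by (intro finite_lists_length_le) (simp add: finite_lists_length_le)
qed

lemma product_C_wasserstein_bounded:
  fixes G :: "'i \<Rightarrow> 'a::euclidean_space list \<Rightarrow> 'a \<Rightarrow> real"
  assumes \<Omega>: "prob_space \<Omega>" and G: "\<And>i. test_derivs (G i)" and I: "finite I"
  shows "(\<lambda>\<mu>. \<Prod>i\<in>I. LINT x|\<mu>. G i [] x) \<in> C_wasserstein_bounded \<Omega> n"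
proof -
  let ?D = "\<lambda>\<alpha>. product_derivs G \<alpha> I"
  have "wasserstein_derivs \<Omega> n (\<lambda>\<mu>. \<Prod>i\<in>I. LINT x|\<mu>. G i [] x) ?D"
    unfolding wasserstein_derivs_def jointly_continuous_iff
    by (intro conjI allI impI ballI product_derivs_measure_deriv[OF \<Omega> G _ I]
        product_derivs_point_deriv[OF G] product_derivs_jointly_continuous[OF G]) simp_all
  moreover have "\<exists>C. derivs_bounded_by C 1 n ?D"
  proof -
    have "\<forall>\<alpha>. \<exists>C. multi_index \<alpha> \<longrightarrow> (\<forall>\<mu>\<in>P2. \<forall>xs. \<bar>?D \<alpha> \<mu> xs\<bar> \<le> C)"
      using product_derivs_bounded[of G, OF G] by blast
    then obtain C where C: "\<And>\<alpha> \<mu> xs. multi_index \<alpha> \<Longrightarrow> \<mu> \<in> P2 \<Longrightarrow> \<bar>?D \<alpha> \<mu> xs\<bar> \<le> C \<alpha>"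
      by metis
    have "derivs_bounded_by (Max (C ` {\<alpha>. multi_index \<alpha> \<and> total_order \<alpha> \<le> n})) 1 n ?D"
      unfolding derivs_bounded_by_def
    proof (intro allI impI ballI)
      fix \<alpha> :: "'a list list" and xs and \<mu> :: "'a measure"
      assume "multi_index \<alpha>" "total_order \<alpha> \<le> n" "\<mu> \<in> P2"
      then show "\<bar>?D \<alpha> \<mu> xs\<bar> \<le> Max (C ` {\<alpha>. multi_index \<alpha> \<and> total_order \<alpha> \<le> n})"
        by (intro order_trans[OF C Max_ge]) (auto intro: finite_multi_index)
    qed
    then show ?thesis by blast
  qed
  ultimately show ?thesis unfolding C_wasserstein_bounded_def by blast
qed

section \<open>Linear combinations of functions in \<open>C_wasserstein_bounded\<close>\<close>

lemma wasserstein_derivs_point_deriv: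
  "wasserstein_derivs \<Omega> n U D \<Longrightarrow> multi_index \<alpha> \<Longrightarrow> total_order \<alpha> < n \<Longrightarrow> k < length \<alpha> \<Longrightarrow> w \<in> Basis \<Longrightarrow>
   \<mu> \<in> P2 \<Longrightarrow> length xs = length \<alpha> \<Longrightarrow>
   ((\<lambda>t. D \<alpha> \<mu> (xs[k := xs ! k + t *\<^sub>R w]))
      has_real_derivative D (\<alpha>[k := \<alpha> ! k @ [w]]) \<mu> xs) (at 0)"
  unfolding wasserstein_derivs_def by simp

lemma C_wasserstein_bounded_cmult:
  fixes F :: "'a::euclidean_space measure \<Rightarrow> real"
  assumes F: "F \<in> C_wasserstein_bounded \<Omega> n"
  shows "(\<lambda>\<mu>. c * F \<mu>) \<in> C_wasserstein_bounded \<Omega> n"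
proof -
  obtain D C where D: "wasserstein_derivs \<Omega> n F D" and C: "derivs_bounded_by C 1 n D"
    using F by (auto simp: C_wasserstein_bounded_def)
  have "wasserstein_derivs \<Omega> n (\<lambda>\<mu>. c * F \<mu>) (\<lambda>\<alpha> \<mu> xs. c * D \<alpha> \<mu> xs)"
    unfolding wasserstein_derivs_def
  proof (intro conjI allI impI ballI)
    fix \<alpha> :: "'a list list" and \<mu> :: "'a measure" and xs :: "'a list"
    assume *: "multi_index \<alpha>" "only_measure_derivs \<alpha>" "total_order \<alpha> < n" "\<mu> \<in> P2" "length xs = length \<alpha>"
    then have "has_wasserstein_derivative \<Omega> (\<lambda>\<nu>. c * D \<alpha> \<nu> xs)
        (\<lambda>x. c *\<^sub>R (\<Sum>v\<in>Basis. D (\<alpha> @ [[v]]) \<mu> (xs @ [x]) *\<^sub>R v)) \<mu>"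
      using D by (intro has_wasserstein_derivative_cmult) (auto simp: wasserstein_derivs_def)
    then show "has_wasserstein_derivative \<Omega> (\<lambda>\<nu>. c * D \<alpha> \<nu> xs)
        (\<lambda>x. \<Sum>v\<in>Basis. (c * D (\<alpha> @ [[v]]) \<mu> (xs @ [x])) *\<^sub>R v) \<mu>"
      by (simp add: scaleR_sum_right)
  next
    fix \<alpha> :: "'a list list"
    assume "multi_index \<alpha>" "\<alpha> \<noteq> []" "total_order \<alpha> \<le> n"
    then have "jointly_continuous (length \<alpha>) (D \<alpha>)" using D by (auto simp: wasserstein_derivs_def)
    then show "jointly_continuous (length \<alpha>) (\<lambda>\<mu> xs. c * D \<alpha> \<mu> xs)"
      unfolding jointly_continuous_iff case_prod_beta by (auto intro!: tendsto_intros)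
  next
    fix \<alpha> :: "'a list list" and k and w :: 'a and \<mu> :: "'a measure" and xs :: "'a list"
    assume *: "multi_index \<alpha>" "total_order \<alpha> < n" "k < length \<alpha>" "w \<in> Basis" "\<mu> \<in> P2" "length xs = length \<alpha>"
    then show "((\<lambda>t. c * D \<alpha> \<mu> (xs[k := xs ! k + t *\<^sub>R w]))
        has_real_derivative c * D (\<alpha>[k := \<alpha> ! k @ [w]]) \<mu> xs) (at 0)"
      by (intro DERIV_cmult wasserstein_derivs_point_deriv[OF D])
  next
    fix \<mu> :: "'a measure" assume "\<mu> \<in> P2"
    then show "c * D [] \<mu> [] = c * F \<mu>" using D unfolding wasserstein_derivs_def by simp
  qed
  moreover have "derivs_bounded_by (\<bar>c\<bar> * C) 1 n (\<lambda>\<alpha> \<mu> xs. c * D \<alpha> \<mu> xs)"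
    using C unfolding derivs_bounded_by_def by (auto simp: abs_mult intro!: mult_left_mono)
  ultimately show ?thesis unfolding C_wasserstein_bounded_def by blast
qed

lemma C_wasserstein_bounded_add:
  fixes F F' :: "'a::euclidean_space measure \<Rightarrow> real"
  assumes F: "F \<in> C_wasserstein_bounded \<Omega> n" and F': "F' \<in> C_wasserstein_bounded \<Omega> n"
  shows "(\<lambda>\<mu>. F \<mu> + F' \<mu>) \<in> C_wasserstein_bounded \<Omega> n"
proof -
  obtain D C where D: "wasserstein_derivs \<Omega> n F D" and C: "derivs_bounded_by C 1 n D"
    using F by (auto simp: C_wasserstein_bounded_def)
  obtain D' C' where D': "wasserstein_derivs \<Omega> n F' D'" and C': "derivs_bounded_by C' 1 n D'"
    using F' by (auto simp: C_wasserstein_bounded_def)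
  have "wasserstein_derivs \<Omega> n (\<lambda>\<mu>. F \<mu> + F' \<mu>) (\<lambda>\<alpha> \<mu> xs. D \<alpha> \<mu> xs + D' \<alpha> \<mu> xs)"
    unfolding wasserstein_derivs_def
  proof (intro conjI allI impI ballI)
    fix \<alpha> :: "'a list list" and \<mu> :: "'a measure" and xs :: "'a list"
    assume *: "multi_index \<alpha>" "only_measure_derivs \<alpha>" "total_order \<alpha> < n" "\<mu> \<in> P2" "length xs = length \<alpha>"
    then have "has_wasserstein_derivative \<Omega> (\<lambda>\<nu>. D \<alpha> \<nu> xs + D' \<alpha> \<nu> xs)
        (\<lambda>x. (\<Sum>v\<in>Basis. D (\<alpha> @ [[v]]) \<mu> (xs @ [x]) *\<^sub>R v) + (\<Sum>v\<in>Basis. D' (\<alpha> @ [[v]]) \<mu> (xs @ [x]) *\<^sub>R v)) \<mu>"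
      using D D' by (intro has_wasserstein_derivative_add) (auto simp: wasserstein_derivs_def)
    then show "has_wasserstein_derivative \<Omega> (\<lambda>\<nu>. D \<alpha> \<nu> xs + D' \<alpha> \<nu> xs)
        (\<lambda>x. \<Sum>v\<in>Basis. (D (\<alpha> @ [[v]]) \<mu> (xs @ [x]) + D' (\<alpha> @ [[v]]) \<mu> (xs @ [x])) *\<^sub>R v) \<mu>"
      by (simp add: scaleR_add_left sum.distrib)
  next
    fix \<alpha> :: "'a list list"
    assume "multi_index \<alpha>" "\<alpha> \<noteq> []" "total_order \<alpha> \<le> n"
    then have "jointly_continuous (length \<alpha>) (D \<alpha>)" "jointly_continuous (length \<alpha>) (D' \<alpha>)"
      using D D' by (auto simp: wasserstein_derivs_def)
    then show "jointly_continuous (length \<alpha>) (\<lambda>\<mu> xs. D \<alpha> \<mu> xs + D' \<alpha> \<mu> xs)"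
      unfolding jointly_continuous_iff case_prod_beta by (auto intro!: tendsto_intros)
  next
    fix \<alpha> :: "'a list list" and k and w :: 'a and \<mu> :: "'a measure" and xs :: "'a list"
    assume *: "multi_index \<alpha>" "total_order \<alpha> < n" "k < length \<alpha>" "w \<in> Basis" "\<mu> \<in> P2" "length xs = length \<alpha>"
    then show "((\<lambda>t. D \<alpha> \<mu> (xs[k := xs ! k + t *\<^sub>R w]) + D' \<alpha> \<mu> (xs[k := xs ! k + t *\<^sub>R w]))
        has_real_derivative D (\<alpha>[k := \<alpha> ! k @ [w]]) \<mu> xs + D' (\<alpha>[k := \<alpha> ! k @ [w]]) \<mu> xs) (at 0)"
      by (intro DERIV_add wasserstein_derivs_point_deriv[OF D] wasserstein_derivs_point_deriv[OF D'])
  next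
    fix \<mu> :: "'a measure" assume "\<mu> \<in> P2"
    then show "D [] \<mu> [] + D' [] \<mu> [] = F \<mu> + F' \<mu>" using D D' unfolding wasserstein_derivs_def by simp
  qed
  moreover have "derivs_bounded_by (C + C') 1 n (\<lambda>\<alpha> \<mu> xs. D \<alpha> \<mu> xs + D' \<alpha> \<mu> xs)"
    using C C' unfolding derivs_bounded_by_def by (auto intro!: order_trans[OF abs_triangle_ineq] add_mono)
  ultimately show ?thesis unfolding C_wasserstein_bounded_def by blast
qed

section \<open>Every law is the law of a function of a uniform random variable\<close>

definition base4 :: "(nat \<Rightarrow> bool) \<Rightarrow> real" where
  "base4 d = (\<Sum>k. of_bool (d k) / 4 ^ Suc k)"

lemma sums_base4_max: "(\<lambda>k. 1 / 4 ^ Suc k :: real) sums (1 / 3)"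
  using sums_mult[OF geometric_sums[of "1 / 4 :: real"], of "1 / 4"] by (simp add: power_one_over)

lemma summable_base4: "summable (\<lambda>k. of_bool (d k) / 4 ^ Suc k :: real)"
  by (rule summable_comparison_test'[OF sums_summable[OF sums_base4_max], of 0]) auto

lemma base4_nonneg: "0 \<le> base4 d"
  unfolding base4_def by (intro suminf_nonneg summable_base4) auto

lemma base4_less: "base4 d < 1"
proof -
  have "base4 d \<le> (\<Sum>k. 1 / 4 ^ Suc k)"
    unfolding base4_def
    by (intro suminf_le summable_base4 sums_summable[OF sums_base4_max]) (auto simp: divide_simps)
  then show ?thesis using sums_unique[OF sums_base4_max] by simp
qed

lemma base4_unfold: "4 * base4 d = of_bool (d 0) + base4 (\<lambda>k. d (Suc k))"
proof -
  have "base4 (\<lambda>k. d (Suc k)) / 4 = (\<Sum>k. of_bool (d (Suc k)) / 4 ^ Suc (Suc k))"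
    unfolding base4_def by (subst suminf_divide[OF summable_base4, symmetric]) (simp add: field_simps)
  also have "\<dots> = base4 d - of_bool (d 0) / 4"
    unfolding base4_def by (subst suminf_split_head[OF summable_base4]) simp
  finally show ?thesis by simp
qed

text \<open>Multiplication by 4 ^ Suc n moves the digits 0 to n in front of the point. All of them
  except digit \<open>n\<close> carry a positive power of 4 and so contribute an even integer. As
  the tail lies in [0, 1), the floor has the parity of digit \<open>n\<close>.\<close>

lemma base4_shift: "\<exists>m::int. 4 ^ Suc n * base4 d = 2 * real_of_int m + of_bool (d n) + base4 (\<lambda>k. d (Suc n + k))"
proof (induction n)
  case 0
  show ?case using base4_unfold[of d] by (intro exI[of _ 0]) simp
next
  case (Suc n)
  then obtain m :: int where m: "4 ^ Suc n * base4 d = 2 * real_of_int m + of_bool (d n) + base4 (\<lambda>k. d (Suc n + k))"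
    by blast
  have "4 ^ Suc (Suc n) * base4 d = 4 * (4 ^ Suc n * base4 d)" by simp
  also have "\<dots> = 8 * m + 4 * of_bool (d n) + 4 * base4 (\<lambda>k. d (Suc n + k))" unfolding m by simp
  also have "\<dots> = 8 * m + 4 * of_bool (d n) + of_bool (d (Suc n)) + base4 (\<lambda>k. d (Suc (Suc n) + k))"
    unfolding base4_unfold[of "\<lambda>k. d (Suc n + k)"] by simp
  finally show ?case
    by (intro exI[of _ "4 * m + 2 * of_bool (d n)"]) simp
qed

lemma base4_digit: "odd \<lfloor>4 ^ Suc n * base4 d\<rfloor> \<longleftrightarrow> d n"
proof -
  obtain m :: int where m: "4 ^ Suc n * base4 d = 2 * real_of_int m + of_bool (d n) + base4 (\<lambda>k. d (Suc n + k))"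
    using base4_shift by blast
  have "\<lfloor>4 ^ Suc n * base4 d\<rfloor> = 2 * m + of_bool (d n)"
    unfolding m using base4_nonneg[of "\<lambda>k. d (Suc n + k)"] base4_less[of "\<lambda>k. d (Suc n + k)"]
    by (intro floor_unique) auto
  then show ?thesis by simp
qed

text \<open>This decodes a coordinate from the rationals below it. With - \<infinity> for the other
  rationals, the supremum in \<open>ereal\<close> exists and is measurable for every digit sequence,
  also for one that encodes no point.\<close>

lemma real_eq_SUP_rat: "(SUP q::rat. if of_rat q < y then ereal (of_rat q) else - \<infinity>) = ereal y"
proof (rule antisym)
  show "(SUP q::rat. if of_rat q < y then ereal (of_rat q) else - \<infinity>) \<le> ereal y"
    by (rule SUP_least) auto
  show "ereal y \<le> (SUP q::rat. if of_rat q < y then ereal (of_rat q) else - \<infinity>)"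
  proof (rule dense_le)
    fix z assume z: "z < ereal y"
    show "z \<le> (SUP q::rat. if of_rat q < y then ereal (of_rat q) else - \<infinity>)"
    proof (cases z)
      case (real r)
      then obtain q where "r < of_rat q" "of_rat q < y" using z of_rat_dense[of r y] by auto
      then show ?thesis using real by (intro SUP_upper2[of q]) auto
    qed (use z in auto)
  qed
qed

text \<open>
  \<open>x\<close> is encoded by the truth values of \<open>q < x \<bullet> b\<close> for rational \<open>q\<close> and basis vectors \<open>b\<close>. With
  digits 0 and 1 in base 4 there are no carries, and so the digits can be read off.
\<close>

lemma Borel_encoding:
  obtains e :: "'a::euclidean_space \<Rightarrow> real" and h :: "real \<Rightarrow> 'a"
  where "e \<in> borel_measurable borel" "h \<in> borel_measurable borel" "\<And>x. h (e x) = x"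
proof
  let ?K = "(Basis :: 'a set) \<times> (UNIV :: rat set)"
  let ?n = "\<lambda>b q. to_nat_on ?K (b, q)"
  let ?A = "\<lambda>k x. case from_nat_into ?K k of (b, q) \<Rightarrow> of_rat q < x \<bullet> b"
  define e where "e x = base4 (\<lambda>k. ?A k x)" for x :: 'a
  define h where "h y = (\<Sum>b\<in>Basis. real_of_ereal
    (SUP q::rat. if odd \<lfloor>4 ^ Suc (?n b q) * y\<rfloor> then ereal (of_rat q) else - \<infinity>) *\<^sub>R b)" for y :: real
  have K: "countable ?K" by (intro countable_SIGMA) (auto intro: countable_finite)
  have [measurable]: "Measurable.pred borel (?A k)" for k
    by (simp add: case_prod_beta)
  show "e \<in> borel_measurable borel" unfolding e_def base4_def by measurable
  show "h \<in> borel_measurable borel"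
    unfolding h_def by (intro borel_measurable_sum borel_measurable_scaleR borel_measurable_const
      borel_measurable_real_of_ereal borel_measurable_SUP) measurable
  fix x :: 'a
  have "odd \<lfloor>4 ^ Suc (?n b q) * e x\<rfloor> \<longleftrightarrow> of_rat q < x \<bullet> b" if "b \<in> Basis" for b q
  proof -
    have "from_nat_into ?K (?n b q) = (b, q)" using K that by (intro from_nat_into_to_nat_on) auto
    then show ?thesis unfolding e_def base4_digit by simp
  qed
  then have "h (e x) = (\<Sum>b\<in>Basis. (x \<bullet> b) *\<^sub>R b)"
    unfolding h_def by (intro sum.cong refl) (simp only: real_eq_SUP_rat real_of_ereal.simps)
  then show "h (e x) = x" by (simp add: euclidean_representation)
qed

section \<open>Inverse transform sampling, first on the line and then through the encoding\<close>

abbreviation "uniform01 \<equiv> uniform_measure lborel {0..1::real}"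

lemma prob_space_uniform01: "prob_space uniform01"
  by (rule prob_space_uniform_measure) auto

text \<open>The pseudo-inverse \<open>M.I\<close> of the distribution function pushes the uniform
  law on the open unit interval to \<open>M\<close>. \<open>F\<close> extends it by 0; of the added
  points only 0 and 1 lie in {0..1}, and these are null.\<close>

lemma real_distribution_eq_distr_uniform01:
  assumes "real_distribution M"
  obtains F where "F \<in> borel_measurable borel" "distr uniform01 borel F = M"
proof -
  interpret M: cdf_distribution M using assms by (simp add: cdf_distribution_def)
  define F where "F t = (if t \<in> {0<..<1} then M.I t else 0)" for t
  have F [measurable]: "F \<in> borel_measurable borel"
    unfolding F_def by (rule borel_measurable_restrict_space_iff[THEN iffD1, THEN measurable_cong[THEN iffD1, rotated], OF _ M.measurable_CI]) auto
  have "distr uniform01 borel F = distr (restrict_space lborel {0<..<1}) borel M.I"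
  proof (rule measure_eqI)
    fix A :: "real set" assume "A \<in> sets (distr uniform01 borel F)"
    then have A [measurable]: "A \<in> sets borel" by simp
    have I_meas: "M.I \<in> measurable (restrict_space lborel {0<..<1}) borel"
      using M.measurable_CI by (simp cong: measurable_cong_sets add: sets_restrict_space)
    have FA: "F -` A \<in> sets borel" using measurable_sets[OF F A] by simp
    have "emeasure (distr uniform01 borel F) A = emeasure lborel ({0..1} \<inter> F -` A)"
      using FA by (simp add: emeasure_distr divide_ennreal_def)
    also have "\<dots> = emeasure lborel ({0<..<1} \<inter> F -` A)"
    proof (rule emeasure_eq_AE)
      show "AE x in lborel. x \<in> {0..1} \<inter> F -` A \<longleftrightarrow> x \<in> {0<..<1} \<inter> F -` A"
        using AE_lborel_singleton[of "0::real"] AE_lborel_singleton[of "1::real"]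
        by eventually_elim auto
    qed (use FA in auto)
    also have "{0<..<1} \<inter> F -` A = M.I -` A \<inter> {0<..<1}" by (auto simp: F_def)
    also have "emeasure lborel \<dots> = emeasure (distr (restrict_space lborel {0<..<1}) borel M.I) A"
      by (subst emeasure_distr[OF I_meas A])
        (simp add: emeasure_restrict_space space_restrict_space Int_absorb2)
    finally show "emeasure (distr uniform01 borel F) A =
        emeasure (distr (restrict_space lborel {0<..<1}) borel M.I) A" .
  qed simp
  then show thesis using that[OF F] M.distr_I_eq_M by simp
qed

text \<open>Push \<nu> to the line with the encoding \<open>e\<close>, sample there, and decode with
  \<open>h\<close>.\<close>

lemma prob_eq_distr_uniform01:
  fixes \<nu> :: "'a::euclidean_space measure"
  assumes "prob_space \<nu>" and sets: "sets \<nu> = sets borel"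
  obtains F where "F \<in> borel_measurable borel" "distr uniform01 borel F = \<nu>"
proof -
  interpret prob_space \<nu> by fact
  obtain e :: "'a \<Rightarrow> real" and h :: "real \<Rightarrow> 'a"
    where eh [measurable]: "e \<in> borel_measurable borel" "h \<in> borel_measurable borel" and inv: "\<And>x. h (e x) = x"
    using Borel_encoding by blast
  have e' [measurable]: "e \<in> borel_measurable \<nu>" by (simp add: sets cong: measurable_cong_sets)
  have "real_distribution (distr \<nu> borel e)"
    by (simp add: real_distribution_def real_distribution_axioms_def prob_space_distr)
  then obtain F where F [measurable]: "F \<in> borel_measurable borel" "distr uniform01 borel F = distr \<nu> borel e"
    using real_distribution_eq_distr_uniform01 by blast
  have "distr uniform01 borel (\<lambda>t. h (F t)) = distr (distr uniform01 borel F) borel h"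
    by (subst distr_distr) (auto simp: comp_def)
  also have "\<dots> = distr \<nu> borel (\<lambda>x. h (e x))"
    unfolding F by (subst distr_distr) (auto simp: comp_def)
  also have "\<dots> = distr \<nu> \<nu> (\<lambda>x. x)" unfolding inv by (rule distr_cong) (simp_all add: sets)
  finally have "distr uniform01 borel (\<lambda>t. h (F t)) = \<nu>" by (simp add: distr_id2)
  then show thesis using that[of "\<lambda>t. h (F t)"] by measurable
qed

text \<open>Applied below to the product of \<mu> and \<open>uniform01\<close>, this yields a
  variable of law \<mu> together with an independent source of randomness on the same
  \<Omega>.\<close>

lemma rich_prob_space_law:
  fixes \<nu> :: "'a::euclidean_space measure"
  assumes "rich_prob_space \<Omega>" "prob_space \<nu>" "sets \<nu> = sets borel"
  obtains X where "X \<in> borel_measurable \<Omega>" "distr \<Omega> borel X = \<nu>"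
proof -
  obtain u where u [measurable]: "u \<in> borel_measurable \<Omega>" "distr \<Omega> borel u = uniform01"
    using assms(1) by (auto simp: rich_prob_space_def)
  obtain F where F [measurable]: "F \<in> borel_measurable borel" "distr uniform01 borel F = \<nu>"
    using prob_eq_distr_uniform01[OF assms(2,3)] by blast
  have "distr \<Omega> borel (\<lambda>\<omega>. F (u \<omega>)) = \<nu>"
    unfolding F(2)[symmetric] u(2)[symmetric] by (subst distr_distr) (auto simp: comp_def)
  then show thesis using that[of "\<lambda>\<omega>. F (u \<omega>)"] by measurable
qed

section \<open>Discrete laws as functions of a uniform random variable\<close>

text \<open>Weights are functions on all natural numbers that vanish beyond \<open>n\<close>, so one
  type serves every \<open>n\<close>, and compactness comes from Tychonoff's theorem for a product
  of unit intervals.\<close>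

definition prob_simplex :: "nat \<Rightarrow> (nat \<Rightarrow> real) set" where
  "prob_simplex n = {w. (\<forall>i. 0 \<le> w i) \<and> (\<forall>i>n. w i = 0) \<and> (\<Sum>i\<le>n. w i) = 1}"

text \<open>The quantile function of the law with weights \<open>w\<close>, written as the number of
  partial sums that do not exceed \<open>t\<close>. In this form it is jointly measurable in
  \<open>w\<close> and \<open>t\<close>, and because the sum stops at k < n its value is at most
  \<open>n\<close> even for weights outside the simplex.\<close>

definition pick :: "nat \<Rightarrow> (nat \<Rightarrow> real) \<Rightarrow> real \<Rightarrow> nat" where
  "pick n w t = (\<Sum>k<n. if (\<Sum>j\<le>k. w j) \<le> t then 1 else 0)"

lemma pick_le: "pick n w t \<le> n"
proof -
  have "pick n w t \<le> (\<Sum>k<n. 1)" unfolding pick_def by (rule sum_mono) auto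
  then show ?thesis by simp
qed

lemma pick_eq:
  assumes w: "\<And>i. 0 \<le> w i" and i: "i \<le> n" "(\<Sum>j<i. w j) \<le> t" "t < (\<Sum>j\<le>i. w j)"
  shows "pick n w t = i"
proof -
  have "((\<Sum>j\<le>k. w j) \<le> t) = (k < i)" for k
  proof (cases "k < i")
    case True
    then have "(\<Sum>j\<le>k. w j) \<le> (\<Sum>j<i. w j)" by (intro sum_mono2 w) auto
    then show ?thesis using i True by simp
  next
    case False
    then have "(\<Sum>j\<le>i. w j) \<le> (\<Sum>j\<le>k. w j)" by (intro sum_mono2 w) auto
    then show ?thesis using i False by simp
  qed
  then have "pick n w t = (\<Sum>k<n. if k \<in> {..<i} then 1 else 0)" by (simp add: pick_def)
  also have "\<dots> = card ({..<n} \<inter> {..<i})" by (subst sum.inter_restrict[symmetric]) auto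
  also have "{..<n} \<inter> {..<i} = {..<i}" using i by auto
  finally show ?thesis by simp
qed

text \<open>The half-open intervals between consecutive partial sums partition [0, 1), and
  \<open>pick n w\<close> equals \<open>i\<close> on the \<open>i\<close>-th of them. Their
  indicators reduce integration over \<open>t\<close> to interval lengths.\<close>

lemma pick_expand:
  fixes \<phi> :: "nat \<Rightarrow> ennreal"
  assumes w: "w \<in> prob_simplex n" and t: "0 \<le> t" "t < 1"
  shows "\<phi> (pick n w t) = (\<Sum>i\<le>n. \<phi> i * indicator {(\<Sum>j<i. w j)..<(\<Sum>j\<le>i. w j)} t)"
proof -
  have w': "\<And>i. 0 \<le> w i" "(\<Sum>i\<le>n. w i) = 1" using w by (auto simp: prob_simplex_def)
  define i where "i = (LEAST i. t < (\<Sum>j\<le>i. w j))"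
  have ex: "t < (\<Sum>j\<le>n. w j)" using w' t by simp
  have i: "t < (\<Sum>j\<le>i. w j)" "i \<le> n"
    unfolding i_def using LeastI[of "\<lambda>i. t < (\<Sum>j\<le>i. w j)", OF ex] Least_le[of "\<lambda>i. t < (\<Sum>j\<le>i. w j)", OF ex] by auto
  have i': "(\<Sum>j<i. w j) \<le> t"
  proof (cases i)
    case (Suc k)
    then have "\<not> t < (\<Sum>j\<le>k. w j)" unfolding i_def using not_less_Least[of k "\<lambda>i. t < (\<Sum>j\<le>i. w j)"] by simp
    then show ?thesis using Suc by (simp add: lessThan_Suc_atMost)
  qed (use t in simp)
  have pick: "pick n w t = i" by (rule pick_eq[OF w'(1) i(2) i' i(1)])
  have "(\<Sum>k\<le>n. \<phi> k * indicator {(\<Sum>j<k. w j)..<(\<Sum>j\<le>k. w j)} t) = (\<Sum>k\<le>n. if k = i then \<phi> i else 0)"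
  proof (rule sum.cong)
    fix k assume k: "k \<in> {..n}"
    show "\<phi> k * indicator {(\<Sum>j<k. w j)..<(\<Sum>j\<le>k. w j)} t = (if k = i then \<phi> i else 0)"
    proof (cases "k = i")
      case True
      then show ?thesis using i i' by simp
    next
      case False
      then have "t \<notin> {(\<Sum>j<k. w j)..<(\<Sum>j\<le>k. w j)}"
        using pick_eq[where w = w and i = k and n = n and t = t] w'(1) k pick by auto
      then show ?thesis using False by simp
    qed
  qed simp
  also have "\<dots> = \<phi> i" using i by simp
  finally show ?thesis by (simp add: pick)
qed

lemma measurable_pick [measurable (raw)]:
  assumes [measurable]: "\<And>i. (\<lambda>x. w x i) \<in> borel_measurable M" "t \<in> borel_measurable M"
  shows "(\<lambda>x. pick n (w x) (t x)) \<in> measurable M (count_space UNIV)"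
  unfolding pick_def by measurable

text \<open>The \<open>i\<close>-th interval has length \<open>w i\<close>. Arbitrary values \<phi>
  admit both the indicator of a set, which identifies a law, and the squared distances of the
  cost.\<close>

lemma nn_integral_pick:
  fixes \<phi> :: "nat \<Rightarrow> ennreal"
  assumes w: "w \<in> prob_simplex n"
  shows "(\<integral>\<^sup>+t. \<phi> (pick n w t) \<partial>uniform01) = (\<Sum>i\<le>n. \<phi> i * ennreal (w i))"
proof -
  have w': "\<And>i. 0 \<le> w i" "(\<Sum>i\<le>n. w i) = 1" using w by (auto simp: prob_simplex_def)
  have [measurable]: "(\<lambda>t. \<phi> (pick n w t)) \<in> borel_measurable borel"
    by (rule measurable_compose[OF measurable_pick]) auto
  have "(\<integral>\<^sup>+t. \<phi> (pick n w t) \<partial>uniform01) = (\<integral>\<^sup>+t. \<phi> (pick n w t) * indicator {0..1} t \<partial>lborel)"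
    by (subst nn_integral_uniform_measure) (auto simp: divide_ennreal_def)
  also have "\<dots> = (\<integral>\<^sup>+t. (\<Sum>i\<le>n. \<phi> i * indicator {(\<Sum>j<i. w j)..<(\<Sum>j\<le>i. w j)} t) \<partial>lborel)"
  proof (rule nn_integral_cong_AE)
    show "AE t in lborel. \<phi> (pick n w t) * indicator {0..1} t =
        (\<Sum>i\<le>n. \<phi> i * indicator {(\<Sum>j<i. w j)..<(\<Sum>j\<le>i. w j)} t)"
      \<comment> \<open>The half-open intervals miss t = 1, where the two sides may differ.\<close>
      using AE_lborel_singleton[of "1::real"]
    proof eventually_elim
      case (elim t)
      show ?case
      proof (cases "0 \<le> t \<and> t < 1")
        case True
        then show ?thesis using pick_expand[OF w, of t \<phi>] by simp
      next
        case False
        have "t \<notin> {(\<Sum>j<i. w j)..<(\<Sum>j\<le>i. w j)}" if "i \<le> n" for i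
        proof -
          have "0 \<le> (\<Sum>j<i. w j)" by (intro sum_nonneg w')
          moreover have "(\<Sum>j\<le>i. w j) \<le> (\<Sum>j\<le>n. w j)" using that by (intro sum_mono2 w') auto
          ultimately show ?thesis using False w' by auto
        qed
        then show ?thesis using False elim by auto
      qed
    qed
  qed
  also have "\<dots> = (\<Sum>i\<le>n. \<phi> i * emeasure lborel {(\<Sum>j<i. w j)..<(\<Sum>j\<le>i. w j)})"
    by (subst nn_integral_sum) (auto intro!: sum.cong nn_integral_cmult_indicator)
  also have "\<dots> = (\<Sum>i\<le>n. \<phi> i * ennreal (w i))"
  proof (rule sum.cong)
    fix i
    have "(\<Sum>j\<le>i. w j) = (\<Sum>j<i. w j) + w i" by (metis lessThan_Suc_atMost sum.lessThan_Suc)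
    then show "\<phi> i * emeasure lborel {(\<Sum>j<i. w j)..<(\<Sum>j\<le>i. w j)} = \<phi> i * ennreal (w i)"
      using w'(1)[of i] by simp
  qed simp
  finally show ?thesis .
qed

lemma compact_prob_simplex: "compact (prob_simplex n)"
proof -
  have "compactin (product_topology (\<lambda>_. euclidean) UNIV) (PiE UNIV (\<lambda>_::nat. {0..1::real}))"
    unfolding compactin_PiE by simp
  then have "compact (PiE UNIV (\<lambda>_::nat. {0..1::real}))"
    by (simp add: euclidean_product_topology)
  moreover have "closed (prob_simplex n)"
  proof -
    have "prob_simplex n = (\<Inter>i. {w. 0 \<le> w i}) \<inter> (\<Inter>i\<in>{n<..}. {w. w i = 0}) \<inter> {w. (\<Sum>i\<le>n. w i) = 1}"
      by (auto simp: prob_simplex_def)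
    then show ?thesis
      by (auto intro!: closed_Int closed_INT closed_Collect_le closed_Collect_eq continuous_intros
          continuous_on_product_coordinates)
  qed
  moreover have "prob_simplex n \<subseteq> PiE UNIV (\<lambda>_. {0..1})"
  proof (clarsimp simp: prob_simplex_def PiE_UNIV_domain)
    fix w :: "nat \<Rightarrow> real" and i
    assume w: "\<forall>i. 0 \<le> w i" "\<forall>i>n. w i = 0" "sum w {..n} = 1"
    show "w i \<le> 1"
    proof (cases "i \<le> n")
      case True
      then show ?thesis using member_le_sum[of i "{..n}" w] w by simp
    qed (use w in auto)
  qed
  ultimately show ?thesis by (metis compact_Int_closed inf.absorb_iff2)
qed

section \<open>A smooth partition of unity\<close>

text \<open>
  Up to a common factor the exponentials are exponentials of affine functions. So the weights generate
  an algebra that is closed under partial derivatives, and all their derivatives are bounded.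
\<close>

definition softmax :: "(nat \<Rightarrow> 'a::euclidean_space) \<Rightarrow> real \<Rightarrow> nat \<Rightarrow> nat \<Rightarrow> 'a \<Rightarrow> real" where
  "softmax p \<beta> n i x = (if i \<le> n then exp (- \<beta> * (norm (x - p i))\<^sup>2) /
     (\<Sum>j\<le>n. exp (- \<beta> * (norm (x - p j))\<^sup>2)) else 0)"

lemma softmax_denominator_pos: "0 < (\<Sum>j\<le>n::nat. exp (- \<beta> * (norm (x - p j))\<^sup>2) :: real)"
  by (rule sum_pos) auto

lemma softmax_simplex: "(\<lambda>i. softmax p \<beta> n i x) \<in> prob_simplex n"
  using softmax_denominator_pos[where n = n and p = p and \<beta> = \<beta> and x = x]
  by (auto simp: prob_simplex_def softmax_def sum_nonneg simp flip: sum_divide_distrib)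

lemma softmax_nonneg: "0 \<le> softmax p \<beta> n i x"
  using softmax_simplex[of p \<beta> n x] by (auto simp: prob_simplex_def)

lemma softmax_sum: "(\<Sum>i\<le>n. softmax p \<beta> n i x) = 1"
  using softmax_simplex[of p \<beta> n x] by (auto simp: prob_simplex_def)

lemma softmax_le_1: "softmax p \<beta> n i x \<le> 1"
proof (cases "i \<le> n")
  case True
  then show ?thesis
    using member_le_sum[of i "{..n}" "\<lambda>i. softmax p \<beta> n i x"] softmax_sum[of p \<beta> n x] softmax_nonneg[of p \<beta> n _ x]
    by simp
qed (simp add: softmax_def)

lemma softmax_deriv:
  fixes p :: "nat \<Rightarrow> 'a::euclidean_space"
  assumes i: "i \<le> n"
  shows "((\<lambda>t. softmax p \<beta> n i (x + t *\<^sub>R b)) has_real_derivative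
    softmax p \<beta> n i x * (2 * \<beta> * (p i \<bullet> b) + (\<Sum>j\<le>n. softmax p \<beta> n j x * (- 2 * \<beta> * (p j \<bullet> b))))) (at 0)"
proof -
  define f where "f j t = exp (- \<beta> * (norm (x + t *\<^sub>R b - p j))\<^sup>2)" for j t
  define S where "S t = (\<Sum>j\<le>n. f j t)" for t
  define a where "a j = - 2 * \<beta> * ((x - p j) \<bullet> b)" for j
  have S0: "S 0 \<noteq> 0" using softmax_denominator_pos[where n = n and p = p and \<beta> = \<beta> and x = x] by (simp add: S_def f_def)
  have sm: "softmax p \<beta> n j x = f j 0 / S 0" if "j \<le> n" for j
    using that by (simp add: softmax_def f_def S_def)
  have f: "(f j has_real_derivative a j * f j 0) (at 0)" for j
  proof -
    have "f j = (\<lambda>t. exp (- \<beta> * ((x - p j) \<bullet> (x - p j) + 2 * t * ((x - p j) \<bullet> b) + t\<^sup>2 * (b \<bullet> b))))"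
      unfolding f_def power2_norm_eq_inner
      by (rule ext) (simp add: inner_add_left inner_add_right inner_diff_left inner_diff_right inner_commute
        algebra_simps power2_eq_square)
    then show ?thesis
      by (auto intro!: derivative_eq_intros simp: a_def)
  qed
  have S: "(S has_real_derivative (\<Sum>j\<le>n. a j * f j 0)) (at 0)"
    unfolding S_def[abs_def] by (intro DERIV_sum f)
  have "((\<lambda>t. f i t / S t) has_real_derivative
      ((a i * f i 0) * S 0 - f i 0 * (\<Sum>j\<le>n. a j * f j 0)) / (S 0 * S 0)) (at 0)"
    by (rule DERIV_divide[OF f S S0])
  moreover have "((a i * f i 0) * S 0 - f i 0 * (\<Sum>j\<le>n. a j * f j 0)) / (S 0 * S 0) =
      f i 0 / S 0 * (a i - (\<Sum>j\<le>n. a j * f j 0) / S 0)"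
    using S0 by (simp add: field_simps)
  moreover have "(\<Sum>j\<le>n. a j * f j 0) / S 0 = (\<Sum>j\<le>n. a j * softmax p \<beta> n j x)"
    unfolding sum_divide_distrib by (rule sum.cong) (auto simp: sm)
  \<comment> \<open>The variable \<open>x\<close> enters \<open>a j\<close> only through a summand
    that is the same for all \<open>j\<close>. It cancels against its average because the weights
    sum to 1, and what remains has constant coefficients.\<close>
  moreover have "a i - (\<Sum>j\<le>n. a j * softmax p \<beta> n j x) =
      2 * \<beta> * (p i \<bullet> b) + (\<Sum>j\<le>n. softmax p \<beta> n j x * (- 2 * \<beta> * (p j \<bullet> b)))"
  proof -
    have "(\<Sum>j\<le>n. a j * softmax p \<beta> n j x) =
        (\<Sum>j\<le>n. (- 2 * \<beta> * (x \<bullet> b)) * softmax p \<beta> n j x + - (softmax p \<beta> n j x * (- 2 * \<beta> * (p j \<bullet> b))))"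
      by (rule sum.cong) (auto simp: a_def inner_diff_left algebra_simps)
    also have "\<dots> = - 2 * \<beta> * (x \<bullet> b) - (\<Sum>j\<le>n. softmax p \<beta> n j x * (- 2 * \<beta> * (p j \<bullet> b)))"
      unfolding sum.distrib sum_distrib_left[symmetric] softmax_sum sum_negf by simp
    finally show ?thesis by (simp add: a_def inner_diff_left algebra_simps)
  qed
  moreover have "(\<lambda>t. f i t / S t) = (\<lambda>t. softmax p \<beta> n i (x + t *\<^sub>R b))"
    using i by (simp add: softmax_def f_def S_def fun_eq_iff)
  ultimately show ?thesis using sm[OF i] by simp
qed

inductive_set softmax_algebra :: "(nat \<Rightarrow> 'a::euclidean_space) \<Rightarrow> real \<Rightarrow> nat \<Rightarrow> ('a \<Rightarrow> real) set"
  for p \<beta> n where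
  base: "softmax p \<beta> n i \<in> softmax_algebra p \<beta> n"
| const: "(\<lambda>_. c) \<in> softmax_algebra p \<beta> n"
| add: "f \<in> softmax_algebra p \<beta> n \<Longrightarrow> g \<in> softmax_algebra p \<beta> n \<Longrightarrow> (\<lambda>x. f x + g x) \<in> softmax_algebra p \<beta> n"
| mult: "f \<in> softmax_algebra p \<beta> n \<Longrightarrow> g \<in> softmax_algebra p \<beta> n \<Longrightarrow> (\<lambda>x. f x * g x) \<in> softmax_algebra p \<beta> n"

lemma softmax_algebra_sum:
  "finite I \<Longrightarrow> (\<And>i. i \<in> I \<Longrightarrow> f i \<in> softmax_algebra p \<beta> n) \<Longrightarrow> (\<lambda>x. \<Sum>i\<in>I. f i x) \<in> softmax_algebra p \<beta> n"
  by (induction I rule: finite_induct) (auto intro: softmax_algebra.intros)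

lemma softmax_algebra_bounded: "g \<in> softmax_algebra p \<beta> n \<Longrightarrow> \<exists>B. \<forall>x. \<bar>g x\<bar> \<le> B"
proof (induction rule: softmax_algebra.induct)
  case (base i)
  then show ?case using softmax_nonneg[of p \<beta> n i] softmax_le_1[of p \<beta> n i] by (intro exI[of _ 1]) auto
next
  case (add f g)
  then obtain A B where "\<And>x. \<bar>f x\<bar> \<le> A" "\<And>x. \<bar>g x\<bar> \<le> B" by blast
  then have "\<bar>f x + g x\<bar> \<le> A + B" for x by (intro order_trans[OF abs_triangle_ineq] add_mono)
  then show ?case by blast
next
  case (mult f g)
  then obtain A B where AB: "\<And>x. \<bar>f x\<bar> \<le> A" "\<And>x. \<bar>g x\<bar> \<le> B" by blast
  then have "\<bar>f x * g x\<bar> \<le> A * B" for x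
    unfolding abs_mult using order_trans[OF abs_ge_zero AB(1)] by (intro mult_mono) auto
  then show ?case by blast
qed auto

lemma softmax_algebra_deriv:
  "g \<in> softmax_algebra p \<beta> n \<Longrightarrow>
    \<exists>g'\<in>softmax_algebra p \<beta> n. \<forall>x. ((\<lambda>t. g (x + t *\<^sub>R b)) has_real_derivative g' x) (at 0)"
proof (induction rule: softmax_algebra.induct)
  case (base i)
  show ?case
  proof (cases "i \<le> n")
    case True
    show ?thesis
    proof (rule bexI)
      show "\<forall>x. ((\<lambda>t. softmax p \<beta> n i (x + t *\<^sub>R b)) has_real_derivative
          (\<lambda>x. softmax p \<beta> n i x *
            (2 * \<beta> * (p i \<bullet> b) + (\<Sum>j\<le>n. softmax p \<beta> n j x * (- 2 * \<beta> * (p j \<bullet> b))))) x) (at 0)"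
        using softmax_deriv[OF True] by blast
    qed (intro softmax_algebra.intros softmax_algebra_sum finite_atMost)
  next
    case False
    then show ?thesis
      by (intro bexI[OF _ softmax_algebra.const[of 0]]) (simp add: softmax_def)
  qed
next
  case (const c)
  show ?case by (intro bexI[OF _ softmax_algebra.const[of 0]]) simp
next
  case (add f g)
  then obtain f' g' where "f' \<in> softmax_algebra p \<beta> n" "g' \<in> softmax_algebra p \<beta> n"
    "\<And>x. ((\<lambda>t. f (x + t *\<^sub>R b)) has_real_derivative f' x) (at 0)"
    "\<And>x. ((\<lambda>t. g (x + t *\<^sub>R b)) has_real_derivative g' x) (at 0)" by blast
  then show ?case
    by (intro bexI[where x = "\<lambda>x. f' x + g' x"]) (auto intro: softmax_algebra.intros DERIV_add)
next
  case (mult f g)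
  then obtain f' g' where *: "f' \<in> softmax_algebra p \<beta> n" "g' \<in> softmax_algebra p \<beta> n"
    "\<And>x. ((\<lambda>t. f (x + t *\<^sub>R b)) has_real_derivative f' x) (at 0)"
    "\<And>x. ((\<lambda>t. g (x + t *\<^sub>R b)) has_real_derivative g' x) (at 0)" by blast
  have "((\<lambda>t. f (x + t *\<^sub>R b) * g (x + t *\<^sub>R b)) has_real_derivative f' x * g x + g' x * f x) (at 0)" for x
    using DERIV_mult[OF *(3,4)[of x]] by simp
  then show ?case using * mult
    by (intro bexI[where x = "\<lambda>x. f' x * g x + g' x * f x"]) (auto intro: softmax_algebra.intros)
qed

lemma softmax_algebra_test_derivs:
  assumes g: "g \<in> softmax_algebra p \<beta> n"
  obtains G where "test_derivs G" "G [] = g"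
proof -
  define d where "d b g = (SOME g'. g' \<in> softmax_algebra p \<beta> n \<and>
    (\<forall>x. ((\<lambda>t. g (x + t *\<^sub>R b)) has_real_derivative g' x) (at 0)))" for b g
  have d: "d b g \<in> softmax_algebra p \<beta> n \<and>
      (\<forall>x. ((\<lambda>t. g (x + t *\<^sub>R b)) has_real_derivative d b g x) (at 0))"
    if "g \<in> softmax_algebra p \<beta> n" for b g
  proof -
    have ex: "\<exists>g'. g' \<in> softmax_algebra p \<beta> n \<and>
        (\<forall>x. ((\<lambda>t. g (x + t *\<^sub>R b)) has_real_derivative g' x) (at 0))"
      using softmax_algebra_deriv[OF that, of b] by blast
    show ?thesis unfolding d_def by (rule someI_ex[OF ex])
  qed
  \<comment> \<open>\<open>fold\<close> applies the directions from left to right, so appending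
    \<open>b\<close> differentiates once more, as \<open>test_derivs\<close> demands.\<close>
  define G where "G l = fold d l g" for l
  have G: "G l \<in> softmax_algebra p \<beta> n" for l
    by (induction l rule: rev_induct) (auto simp: G_def g d)
  have "has_partials (G l) (\<lambda>b. G (l @ [b]))" for l
    using d[OF G[of l]] by (auto simp: has_partials_def G_def)
  then have "test_derivs G"
    unfolding test_derivs_def using softmax_algebra_bounded[OF G] by blast
  then show thesis using that[of G] by (simp add: G_def)
qed

lemma softmax_test_derivs:
  obtains G where "\<And>i. test_derivs (G i)" "\<And>i. G i [] = softmax p \<beta> n i"
proof -
  have "\<forall>i. \<exists>G. test_derivs G \<and> G [] = softmax p \<beta> n i"
    using softmax_algebra_test_derivs[OF softmax_algebra.base] by metis
  then show thesis using that by metis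
qed

lemma borel_measurable_softmax [measurable]: "softmax p \<beta> n i \<in> borel_measurable borel"
proof -
  obtain G where "\<And>i. test_derivs (G i)" "\<And>i. G i [] = softmax p \<beta> n i"
    using softmax_test_derivs by blast
  then show ?thesis using test_derivs_measurable[of "G i" "[]"] by simp
qed

text \<open>The mean squared error of replacing \<open>x\<close> by a random p_i drawn with these
  weights. Its integral against \<mu> is the squared L2 distance between X and its
  discretisation.\<close>

definition softmax_cost :: "(nat \<Rightarrow> 'a::euclidean_space) \<Rightarrow> real \<Rightarrow> nat \<Rightarrow> 'a \<Rightarrow> real" where
  "softmax_cost p \<beta> n x = (\<Sum>i\<le>n. softmax p \<beta> n i x * (norm (x - p i))\<^sup>2)"

lemma softmax_cost_nonneg: "0 \<le> softmax_cost p \<beta> n x"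
  unfolding softmax_cost_def by (intro sum_nonneg mult_nonneg_nonneg softmax_nonneg) auto

text \<open>A point whose squared distance exceeds that of \<open>p k\<close> by s > 0 has weight at
  most exp (- \<beta> s), and s exp (- \<beta> s) \<le> 1 / \<beta>. So each of the n + 1 points
  adds at most 1 / \<beta> to the cost of always choosing \<open>p k\<close>.\<close>

lemma softmax_cost_le:
  assumes \<beta>: "\<beta> > 0" and k: "k \<le> n"
  shows "softmax_cost p \<beta> n x \<le> (norm (x - p k))\<^sup>2 + (real n + 1) / \<beta>"
proof -
  let ?E = "\<lambda>i. (norm (x - p i))\<^sup>2"
  have le: "softmax p \<beta> n i x * (?E i - ?E k) \<le> 1 / \<beta>" if i: "i \<le> n" for i
  proof (cases "?E i \<le> ?E k")
    case True
    then have "softmax p \<beta> n i x * (?E i - ?E k) \<le> 0"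
      using softmax_nonneg by (intro mult_nonneg_nonpos) auto
    also have "0 \<le> 1 / \<beta>" using \<beta> by simp
    finally show ?thesis .
  next
    case False
    define s where "s = ?E i - ?E k"
    have s: "s > 0" using False unfolding s_def by (simp only: diff_gt_0_iff_gt not_le)
    have "softmax p \<beta> n i x \<le> exp (- \<beta> * ?E i) / exp (- \<beta> * ?E k)"
      unfolding softmax_def using i member_le_sum[of k "{..n}" "\<lambda>j. exp (- \<beta> * ?E j)"] k
        softmax_denominator_pos[where n = n and p = p and \<beta> = \<beta> and x = x]
      by (auto intro!: divide_left_mono mult_pos_pos)
    also have "\<dots> = exp (- (\<beta> * s))" by (simp add: exp_diff[symmetric] s_def algebra_simps)
    finally have "softmax p \<beta> n i x * s \<le> exp (- (\<beta> * s)) * s" using s by simp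
    also have "\<dots> \<le> 1 / \<beta>"
    proof -
      have "\<beta> * s \<le> exp (\<beta> * s)" using exp_ge_add_one_self[of "\<beta> * s"] by linarith
      then show ?thesis using \<beta> by (simp add: exp_minus field_simps)
    qed
    finally show ?thesis by (simp add: s_def)
  qed
  have "softmax_cost p \<beta> n x = (\<Sum>i\<le>n. softmax p \<beta> n i x * ?E k + softmax p \<beta> n i x * (?E i - ?E k))"
    unfolding softmax_cost_def by (rule sum.cong) (auto simp: algebra_simps)
  also have "\<dots> = ?E k + (\<Sum>i\<le>n. softmax p \<beta> n i x * (?E i - ?E k))"
    by (simp add: sum.distrib softmax_sum flip: sum_distrib_right)
  also have "(\<Sum>i\<le>n. softmax p \<beta> n i x * (?E i - ?E k)) \<le> (\<Sum>i\<le>n. 1 / \<beta>)"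
    by (rule sum_mono) (use le in auto)
  finally show ?thesis by (simp add: add.commute)
qed

text \<open>For \<beta> = (n + 1)^2 the excess (n + 1) / \<beta> is 1 / (n + 1). So in the limit the
  cost is at most the squared distance to any fixed \<open>p k\<close>, which density makes
  arbitrarily small.\<close>

lemma softmax_cost_tendsto_0:
  fixes p :: "nat \<Rightarrow> 'a::euclidean_space"
  assumes dense: "\<And>\<epsilon>. \<epsilon> > 0 \<Longrightarrow> \<exists>k. norm (x - p k) < \<epsilon>"
  shows "(\<lambda>n. softmax_cost p ((real n + 1)\<^sup>2) n x) \<longlonglongrightarrow> 0"
proof (rule LIMSEQ_I)
  fix r :: real assume r: "r > 0"
  obtain k where "norm (x - p k) < sqrt (r / 2)" using dense[of "sqrt (r / 2)"] r by auto
  then have "(norm (x - p k))\<^sup>2 < (sqrt (r / 2))\<^sup>2" by (intro power_strict_mono) auto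
  then have k: "(norm (x - p k))\<^sup>2 < r / 2" using r by simp
  obtain N :: nat where N: "2 / r < real N" using reals_Archimedean2 by blast
  show "\<exists>no. \<forall>n\<ge>no. norm (softmax_cost p ((real n + 1)\<^sup>2) n x - 0) < r"
  proof (intro exI[of _ "max k N"] allI impI)
    fix n assume n: "max k N \<le> n"
    have "softmax_cost p ((real n + 1)\<^sup>2) n x \<le> (norm (x - p k))\<^sup>2 + (real n + 1) / (real n + 1)\<^sup>2"
      using n by (intro softmax_cost_le) auto
    also have "(real n + 1) / (real n + 1)\<^sup>2 = 1 / (real n + 1)" by (simp add: power2_eq_square)
    also have "1 / (real n + 1) < r / 2"
    proof -
      have "2 / r < real n + 1" using N n by simp
      then show ?thesis using r by (simp add: field_simps)
    qed
    finally show "norm (softmax_cost p ((real n + 1)\<^sup>2) n x - 0) < r"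
      using k softmax_cost_nonneg[of p "(real n + 1)\<^sup>2" n x] by simp
  qed
qed

section \<open>Approximation of \<open>L\<^sup>2\<close>-continuous functions of laws\<close>

text \<open>Sums of monomials, each given by a list of variables: evaluated at integrals of \<mu>, a
  monomial is a product to which \<open>product_C_wasserstein_bounded\<close> applies.\<close>

inductive coord_poly :: "((nat \<Rightarrow> real) \<Rightarrow> real) \<Rightarrow> bool" where
  monomial: "coord_poly (\<lambda>w. c * prod_list (map w is))"
| add: "coord_poly P \<Longrightarrow> coord_poly Q \<Longrightarrow> coord_poly (\<lambda>w. P w + Q w)"

lemma coord_poly_const: "coord_poly (\<lambda>_. c)"
  using coord_poly.monomial[of c "[]"] by simp

lemma coord_poly_coord: "coord_poly (\<lambda>w. w i)"
  using coord_poly.monomial[of 1 "[i]"] by simp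

text \<open>Stone-Weierstrass asks for an algebra. Concatenating the lists multiplies two monomials,
  and distributivity does the rest.\<close>

lemma coord_poly_mult:
  assumes "coord_poly P" "coord_poly Q"
  shows "coord_poly (\<lambda>w. P w * Q w)"
  using assms
proof (induction rule: coord_poly.induct)
  case (monomial c xs)
  from monomial show ?case
  proof (induction rule: coord_poly.induct)
    case (monomial d ys)
    show ?case
      using coord_poly.monomial[of "c * d" "xs @ ys"] by (simp add: ac_simps)
  next
    case (add P Q)
    then show ?case using coord_poly.add by (simp add: distrib_left)
  qed
next
  case (add P P')
  then show ?case using coord_poly.add by (simp add: distrib_right)
qed

lemma continuous_on_prod_list:
  "continuous_on S (\<lambda>w :: nat \<Rightarrow> real. prod_list (map w is))"
  by (induction "is") (auto intro!: continuous_intros continuous_on_product_coordinates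
      intro: continuous_on_subset)

lemma coord_poly_continuous: "coord_poly P \<Longrightarrow> continuous_on S P"
  by (induction rule: coord_poly.induct) (auto intro!: continuous_intros continuous_on_prod_list)

lemma coord_poly_approx:
  assumes "continuous_on (prob_simplex n) F" "e > 0"
  obtains P where "coord_poly P" "\<And>w. w \<in> prob_simplex n \<Longrightarrow> \<bar>F w - P w\<bar> < e"
proof -
  have "\<exists>P. coord_poly P \<and> (\<forall>w\<in>prob_simplex n. \<bar>F w - P w\<bar> < e)"
  proof (rule Stone_Weierstrass_HOL[OF compact_prob_simplex])
    fix x y :: "nat \<Rightarrow> real" assume "x \<in> prob_simplex n \<and> y \<in> prob_simplex n \<and> x \<noteq> y"
    then obtain i where "x i \<noteq> y i" by auto
    then show "\<exists>f. coord_poly f \<and> f x \<noteq> f y" using coord_poly_coord by blast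
  qed (use assms in \<open>auto intro: coord_poly_const coord_poly.add coord_poly_mult coord_poly_continuous\<close>)
  then show thesis using that by blast
qed

lemma coord_poly_C_wasserstein_bounded:
  fixes G :: "nat \<Rightarrow> 'a::euclidean_space list \<Rightarrow> 'a \<Rightarrow> real"
  assumes \<Omega>: "prob_space \<Omega>" and G: "\<And>i. test_derivs (G i)" and P: "coord_poly P"
  shows "(\<lambda>\<mu>. P (\<lambda>i. LINT x|\<mu>. G i [] x)) \<in> C_wasserstein_bounded \<Omega> n"
  using P
proof (induction rule: coord_poly.induct)
  case (monomial c xs)
  \<comment> \<open>A variable may occur several times in \<open>xs\<close>, so the factors are
    indexed by positions and not by the set of variables.\<close>
  have "(\<lambda>\<mu>. \<Prod>k\<in>{0..<length xs}. LINT x|\<mu>. G (xs ! k) [] x) \<in> C_wasserstein_bounded \<Omega> n"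
    by (rule product_C_wasserstein_bounded[OF \<Omega> G]) simp
  moreover have "prod_list (map (\<lambda>i. LINT x|\<mu>. G i [] x) xs) =
      (\<Prod>k\<in>{0..<length xs}. LINT x|\<mu>. G (xs ! k) [] x)" for \<mu>
    by (simp add: prod.list_conv_set_nth)
  ultimately show ?case using C_wasserstein_bounded_cmult by simp
next
  case (add P Q)
  then show ?case by (intro C_wasserstein_bounded_add)
qed

text \<open>The comparisons that define \<open>pick\<close> are stable under small changes of the
  weights unless \<open>t\<close> is one of finitely many partial sums. So convergence of weights
  gives eventual equality at almost every \<open>t\<close>.\<close>

lemma pick_tendsto:
  assumes w: "\<And>j. (\<lambda>k. v k j) \<longlonglongrightarrow> w j" and t: "\<And>i. i < n \<Longrightarrow> t \<noteq> (\<Sum>j\<le>i. w j)"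
  shows "\<forall>\<^sub>F k in sequentially. pick n (v k) t = pick n w t"
proof -
  have "\<forall>\<^sub>F k in sequentially. \<forall>i\<in>{..<n}. ((\<Sum>j\<le>i. v k j) \<le> t) = ((\<Sum>j\<le>i. w j) \<le> t)"
  proof (rule eventually_ball_finite, simp, intro ballI)
    fix i assume "i \<in> {..<n}"
    then have ne: "t \<noteq> (\<Sum>j\<le>i. w j)" using t by simp
    have lim: "(\<lambda>k. \<Sum>j\<le>i. v k j) \<longlonglongrightarrow> (\<Sum>j\<le>i. w j)"
      by (intro tendsto_sum w)
    show "\<forall>\<^sub>F k in sequentially. ((\<Sum>j\<le>i. v k j) \<le> t) = ((\<Sum>j\<le>i. w j) \<le> t)"
    proof (cases "(\<Sum>j\<le>i. w j) < t")
      case True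
      from order_tendstoD(2)[OF lim True] show ?thesis
        by eventually_elim (use True in auto)
    next
      case False
      then have "t < (\<Sum>j\<le>i. w j)" using ne by simp
      from order_tendstoD(1)[OF lim this] show ?thesis
        by eventually_elim (use False ne in auto)
    qed
  qed
  then show ?thesis
    by eventually_elim (auto simp: pick_def intro!: sum.cong)
qed

text \<open>With \<open>p 0 = 0\<close>, comparison with the choice of \<open>p 0\<close> bounds
  every cost by (norm x)^2 + 1, a dominating function that does not depend on
  \<open>n\<close>.\<close>

lemma dense_sequence:
  obtains p :: "nat \<Rightarrow> 'a::euclidean_space" where "p 0 = 0" "\<And>x \<epsilon>. \<epsilon> > 0 \<Longrightarrow> \<exists>k. norm (x - p k) < \<epsilon>"
proof -
  obtain D :: "'a set" where D: "countable D" "\<And>X. open X \<Longrightarrow> X \<noteq> {} \<Longrightarrow> \<exists>d\<in>D. d \<in> X"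
    using countable_dense_exists by blast
  define p where "p k = (if k = 0 then 0 else from_nat_into D (k - 1))" for k
  have "\<exists>k. norm (x - p k) < \<epsilon>" if "\<epsilon> > 0" for x \<epsilon>
  proof -
    have "ball x \<epsilon> \<noteq> {}" using that by simp
    then obtain d where d: "d \<in> D" "d \<in> ball x \<epsilon>" using D(2)[OF open_ball] by blast
    obtain j where "d = from_nat_into D j" using from_nat_into_surj[OF D(1) d(1)] by blast
    then have "p (Suc j) = d" by (simp add: p_def)
    then show ?thesis using d(2) by (auto simp: dist_norm)
  qed
  then show thesis using that[of p] by (simp add: p_def)
qed

text \<open>Integrating first over the uniform variable, with the point fixed, leaves the
  softmax-weighted sum. Both the law of the discretisation and its L2 error are instances.\<close>

lemma nn_integral_softmax_pick:
  fixes p :: "nat \<Rightarrow> 'a::euclidean_space" and \<phi> :: "nat \<Rightarrow> 'a \<Rightarrow> ennreal"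
  assumes sets [measurable_cong]: "sets \<mu> = sets borel"
    and [measurable]: "\<And>i. \<phi> i \<in> borel_measurable borel"
  shows "(\<integral>\<^sup>+z. \<phi> (pick n (\<lambda>i. softmax p \<beta> n i (fst z)) (snd z)) (fst z) \<partial>(\<mu> \<Otimes>\<^sub>M uniform01)) =
    (\<Sum>i\<le>n. \<integral>\<^sup>+x. \<phi> i x * ennreal (softmax p \<beta> n i x) \<partial>\<mu>)"
proof -
  interpret U: prob_space uniform01 by (rule prob_space_uniform01)
  have meas: "(\<lambda>z. \<phi> (pick n (\<lambda>i. softmax p \<beta> n i (fst z)) (snd z)) (fst z))
      \<in> borel_measurable (\<mu> \<Otimes>\<^sub>M uniform01)"
    by (rule measurable_compose_countable[OF _ measurable_pick]) measurable
  have "(\<integral>\<^sup>+z. \<phi> (pick n (\<lambda>i. softmax p \<beta> n i (fst z)) (snd z)) (fst z) \<partial>(\<mu> \<Otimes>\<^sub>M uniform01)) =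
      (\<integral>\<^sup>+x. \<integral>\<^sup>+t. \<phi> (pick n (\<lambda>i. softmax p \<beta> n i x) t) x \<partial>uniform01 \<partial>\<mu>)"
    by (subst U.nn_integral_fst[OF meas, symmetric]) simp
  also have "\<dots> = (\<integral>\<^sup>+x. (\<Sum>i\<le>n. \<phi> i x * ennreal (softmax p \<beta> n i x)) \<partial>\<mu>)"
    by (intro nn_integral_cong nn_integral_pick softmax_simplex)
  also have "\<dots> = (\<Sum>i\<le>n. \<integral>\<^sup>+x. \<phi> i x * ennreal (softmax p \<beta> n i x) \<partial>\<mu>)"
    by (rule nn_integral_sum) measurable
  finally show ?thesis .
qed

lemma (in prob_space) L2norm_tendsto_0_dominated:
  fixes Y :: "nat \<Rightarrow> 'a \<Rightarrow> 'b::euclidean_space"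
  assumes [measurable]: "\<And>k. Y k \<in> borel_measurable M" "X \<in> borel_measurable M"
    and bound: "\<And>k \<omega>. norm (Y k \<omega>) \<le> B" "\<And>\<omega>. norm (X \<omega>) \<le> B"
    and ev: "AE \<omega> in M. \<forall>\<^sub>F k in sequentially. Y k \<omega> = X \<omega>"
  shows "(\<lambda>k. L2dist M (Y k) X) \<longlonglongrightarrow> 0"
proof -
  have "(\<lambda>k. LINT \<omega>|M. (norm (Y k \<omega> - X \<omega>))\<^sup>2) \<longlonglongrightarrow> (LINT \<omega>|M. 0)"
  proof (rule integral_dominated_convergence[where w = "\<lambda>_. (2 * B)\<^sup>2"])
    show "AE \<omega> in M. (\<lambda>k. (norm (Y k \<omega> - X \<omega>))\<^sup>2) \<longlonglongrightarrow> 0"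
      using ev
    proof eventually_elim
      case (elim \<omega>)
      then have "\<forall>\<^sub>F k in sequentially. (norm (Y k \<omega> - X \<omega>))\<^sup>2 = 0" by eventually_elim simp
      then show ?case by (rule tendsto_eventually)
    qed
    show "AE \<omega> in M. norm ((norm (Y k \<omega> - X \<omega>))\<^sup>2) \<le> (2 * B)\<^sup>2" for k
    proof (rule AE_I2)
      fix \<omega>
      have "norm (Y k \<omega> - X \<omega>) \<le> 2 * B"
        using norm_triangle_ineq4[of "Y k \<omega>" "X \<omega>"] bound(1)[of k \<omega>] bound(2)[of \<omega>] by simp
      from power_mono[OF this norm_ge_zero, of 2]
      show "norm ((norm (Y k \<omega> - X \<omega>))\<^sup>2) \<le> (2 * B)\<^sup>2" by simp
    qed
  qed auto
  then show ?thesis unfolding L2norm_def using tendsto_real_sqrt by fastforce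
qed

text \<open>Continuity of the lift enters twice: it makes \<open>H\<close> continuous in the weights
  of laws on finitely many points, and it carries \<open>H\<close> along the discretisations of a
  given X. The order \<open>m\<close> is arbitrary, since polynomials in such integrals have bounded
  derivatives of every order.\<close>

theorem L2_continuous_approximation:
  fixes \<Omega> :: "'w measure" and H :: "'a::euclidean_space measure \<Rightarrow> real"
  assumes rich: "rich_prob_space \<Omega>"
    and cont: "\<And>X Y. X \<in> L2 \<Omega> \<Longrightarrow> (\<And>k. Y k \<in> L2 \<Omega>) \<Longrightarrow>
      (\<lambda>k. L2dist \<Omega> (Y k) X) \<longlonglongrightarrow> 0 \<Longrightarrow> (\<lambda>k::nat. H (law \<Omega> (Y k))) \<longlonglongrightarrow> H (law \<Omega> X)"
  shows "\<exists>Hn. (\<forall>n::nat. Hn n \<in> C_wasserstein_bounded \<Omega> m) \<and> (\<forall>\<mu>\<in>P2. (\<lambda>n. Hn n \<mu>) \<longlonglongrightarrow> H \<mu>)"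
proof -
  interpret prob_space \<Omega> using rich by (simp add: rich_prob_space_def)
  obtain u where u [measurable]: "u \<in> borel_measurable \<Omega>" and law_u: "distr \<Omega> borel u = uniform01"
    using rich by (auto simp: rich_prob_space_def)
  obtain p :: "nat \<Rightarrow> 'a" where p: "p 0 = 0" "\<And>x \<epsilon>. \<epsilon> > 0 \<Longrightarrow> \<exists>k. norm (x - p k) < \<epsilon>"
    using dense_sequence by blast
  have p_bound: "norm (p (pick n w t)) \<le> (\<Sum>i\<le>n. norm (p i))" for n w t
    using pick_le[of n w t] by (intro member_le_sum) auto
  \<comment> \<open>The same uniform variable realises all weight vectors, so a convergent sequence
    of weights gives variables that are almost surely eventually equal to their limit.\<close>
  define Y where "Y n w \<omega> = p (pick n w (u \<omega>))" for n w \<omega>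
  have [measurable]: "Y n w \<in> borel_measurable \<Omega>" for n w
    unfolding Y_def by measurable
  have Y: "Y n w \<in> L2 \<Omega>" for n w
    by (rule L2_bounded[where B = "\<Sum>i\<le>n. norm (p i)"]) (auto simp: Y_def p_bound)
  define h where "h n w = H (law \<Omega> (Y n w))" for n w
  have h_cont: "continuous_on (prob_simplex n) (h n)" for n
    unfolding continuous_on_sequentially
  proof (intro allI ballI impI, elim conjE)
    fix v :: "nat \<Rightarrow> nat \<Rightarrow> real" and w assume v: "v \<longlonglongrightarrow> w"
    have v': "(\<lambda>k. v k j) \<longlonglongrightarrow> w j" for j
    proof -
      have "isCont (\<lambda>w :: nat \<Rightarrow> real. w j) w"
        by (rule continuous_on_interior[OF continuous_on_product_coordinates]) simp
      then show ?thesis using isCont_tendsto_compose v by blast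
    qed
    have "(\<lambda>k. L2dist \<Omega> (Y n (v k)) (Y n w)) \<longlonglongrightarrow> 0"
    proof (rule L2norm_tendsto_0_dominated[where B = "\<Sum>i\<le>n. norm (p i)"])
      have "AE t in uniform01. \<forall>i\<in>{..<n}. t \<noteq> (\<Sum>j\<le>i. w j)"
      proof (intro AE_finite_allI AE_uniform_measureI)
        fix i
        show "AE t in lborel. t \<in> {0..1} \<longrightarrow> t \<noteq> (\<Sum>j\<le>i. w j)"
          using AE_lborel_singleton[of "\<Sum>j\<le>i. w j"] by eventually_elim simp
      qed auto
      then have "AE \<omega> in \<Omega>. \<forall>i\<in>{..<n}. u \<omega> \<noteq> (\<Sum>j\<le>i. w j)"
        unfolding law_u[symmetric] by (rule AE_distrD[OF u])
      then show "AE \<omega> in \<Omega>. \<forall>\<^sub>F k in sequentially. Y n (v k) \<omega> = Y n w \<omega>"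
      proof eventually_elim
        case (elim \<omega>)
        have "\<forall>\<^sub>F k in sequentially. pick n (v k) (u \<omega>) = pick n w (u \<omega>)"
          by (rule pick_tendsto[OF v']) (use elim in auto)
        then show ?case by eventually_elim (simp add: Y_def)
      qed
    qed (auto simp: Y_def p_bound)
    from cont[OF Y Y this] show "(h n \<circ> v) \<longlonglongrightarrow> h n w"
      by (simp add: h_def comp_def)
  qed
  have "\<exists>P. coord_poly P \<and> (\<forall>w\<in>prob_simplex n. \<bar>h n w - P w\<bar> < 1 / Suc n)" for n
    by (rule coord_poly_approx[OF h_cont[of n], of "1 / Suc n"]) auto
  then obtain P where P: "\<And>n. coord_poly (P n)"
    "\<And>n w. w \<in> prob_simplex n \<Longrightarrow> \<bar>h n w - P n w\<bar> < 1 / Suc n"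
    by metis
  define sm where "sm n = softmax p ((real n + 1)\<^sup>2) n" for n
  have [measurable]: "sm n i \<in> borel_measurable borel" for n i by (simp add: sm_def)
  have "\<exists>G. (\<forall>i. test_derivs (G i)) \<and> (\<forall>i. G i [] = sm n i)" for n
    unfolding sm_def by (rule softmax_test_derivs[of p "(real n + 1)\<^sup>2" n]) blast
  then obtain G where G: "\<And>n i. test_derivs (G n i)" "\<And>n i. G n i [] = sm n i"
    by metis
  define I where "I n \<mu> i = (LINT x|\<mu>. sm n i x)" for n \<mu> i
  define Hn where "Hn n \<mu> = P n (I n \<mu>)" for n \<mu>
  have "Hn n \<in> C_wasserstein_bounded \<Omega> m" for n
    using coord_poly_C_wasserstein_bounded[OF prob_space_axioms, of "G n" "P n" m, OF G(1) P(1)]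
    unfolding Hn_def[abs_def] I_def[abs_def] G(2) .
  moreover have "(\<lambda>n. Hn n \<mu>) \<longlonglongrightarrow> H \<mu>" if \<mu>: "\<mu> \<in> P2" for \<mu>
  proof -
    interpret \<mu>: prob_space \<mu> using \<mu> by (simp add: P2_def)
    interpret U: prob_space uniform01 by (rule prob_space_uniform01)
    interpret \<mu>U: pair_prob_space \<mu> uniform01 ..
    have sets [measurable_cong]: "sets \<mu> = sets borel" using \<mu> by (simp add: P2_def)
    have "sets (\<mu> \<Otimes>\<^sub>M uniform01) = sets borel"
      by (simp add: sets borel_prod[symmetric] cong: sets_pair_measure_cong)
    then obtain Z where Z [measurable]: "Z \<in> borel_measurable \<Omega>"
      and law_Z: "distr \<Omega> borel Z = \<mu> \<Otimes>\<^sub>M uniform01"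
      using rich_prob_space_law[OF rich \<mu>U.prob_space_axioms] by blast
    define X where "X \<omega> = fst (Z \<omega>)" for \<omega>
    have fst_snd [measurable]: "fst \<in> borel_measurable (borel :: ('a \<times> real) measure)"
      "snd \<in> borel_measurable (borel :: ('a \<times> real) measure)"
      by (auto simp: borel_prod[symmetric])
    have [measurable]: "X \<in> borel_measurable \<Omega>" "(\<lambda>\<omega>. snd (Z \<omega>)) \<in> borel_measurable \<Omega>"
      unfolding X_def using measurable_compose[OF Z fst_snd(1)] measurable_compose[OF Z fst_snd(2)] by auto
    have "law \<Omega> X = distr (distr \<Omega> borel Z) borel fst"
      unfolding law_def X_def by (subst distr_distr[OF fst_snd(1) Z]) (simp add: comp_def)
    also have "\<dots> = distr (\<mu> \<Otimes>\<^sub>M uniform01) \<mu> fst"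
      unfolding law_Z by (rule distr_cong) (simp_all add: sets)
    also have "\<dots> = \<mu>" by (rule U.distr_pair_fst)
    finally have law_X: "law \<Omega> X = \<mu>" .
    have X: "X \<in> L2 \<Omega>"
      using \<mu> unfolding L2_def P2_def law_X[symmetric] law_def by (auto simp: integrable_distr_eq)
    have nn_Z: "(\<integral>\<^sup>+\<omega>. f (Z \<omega>) \<partial>\<Omega>) = (\<integral>\<^sup>+z. f z \<partial>(\<mu> \<Otimes>\<^sub>M uniform01))"
      if "f \<in> borel_measurable borel" for f
      unfolding law_Z[symmetric] using that by (simp add: nn_integral_distr)
    \<comment> \<open>A randomised rounding of \<open>X\<close>: given \<open>X\<close>, the second
      component of \<open>Z\<close> draws p_i with probability
      \<open>sm n i (X \<omega>)\<close>.\<close>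
    define Xn where "Xn n \<omega> = p (pick n (\<lambda>i. sm n i (X \<omega>)) (snd (Z \<omega>)))" for n \<omega>
    have [measurable]: "Xn n \<in> borel_measurable \<Omega>" for n
      unfolding Xn_def by measurable
    have Xn: "Xn n \<in> L2 \<Omega>" for n
      by (rule L2_bounded[where B = "\<Sum>i\<le>n. norm (p i)"]) (auto simp: Xn_def p_bound)
    have meas_pick: "(\<lambda>z. \<phi> (pick n (\<lambda>i. sm n i (fst z)) (snd z)) (fst z)) \<in> borel_measurable borel"
      if [measurable]: "\<And>i. \<phi> i \<in> borel_measurable borel" for n and \<phi> :: "nat \<Rightarrow> 'a \<Rightarrow> ennreal"
      unfolding borel_prod[symmetric]
      by (rule measurable_compose_countable[OF _ measurable_pick]) measurable
    have sm_int: "integrable \<mu> (sm n i)" for n i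
      by (rule P2_integrable_bounded[OF \<mu>, where B = 1])
        (auto simp: sm_def softmax_nonneg softmax_le_1)
    have I_simplex: "I n \<mu> \<in> prob_simplex n" for n
    proof -
      have "(\<Sum>i\<le>n. I n \<mu> i) = (LINT x|\<mu>. (\<Sum>i\<le>n. sm n i x))"
        unfolding I_def by (rule Bochner_Integration.integral_sum[symmetric]) (rule sm_int)
      also have "\<dots> = 1" unfolding sm_def softmax_sum by (simp add: \<mu>.prob_space)
      finally have "(\<Sum>i\<le>n. I n \<mu> i) = 1" .
      moreover have "0 \<le> I n \<mu> i" for i
        unfolding I_def sm_def by (intro Bochner_Integration.integral_nonneg softmax_nonneg)
      moreover have "I n \<mu> i = 0" if "i > n" for i
        using that by (simp add: I_def sm_def softmax_def)
      ultimately show ?thesis by (simp add: prob_simplex_def)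
    qed
    \<comment> \<open>\<open>Xn n\<close> is coupled to \<open>X\<close> and hence close to it,
      while \<open>Y n\<close> depends continuously on its weights. \<open>H\<close> sees only the
      law, so one may be exchanged for the other.\<close>
    have law_Xn: "law \<Omega> (Xn n) = law \<Omega> (Y n (I n \<mu>))" for n
    proof (rule measure_eqI)
      fix A assume "A \<in> sets (law \<Omega> (Xn n))"
      then have A [measurable]: "A \<in> sets borel" by (simp add: law_def)
      have "emeasure (law \<Omega> (Xn n)) A = (\<integral>\<^sup>+\<omega>. indicator A (Xn n \<omega>) \<partial>\<Omega>)"
        unfolding law_def by (subst nn_integral_indicator[symmetric], simp, subst nn_integral_distr) auto
      also have "\<dots> = (\<integral>\<^sup>+z. indicator A (p (pick n (\<lambda>i. sm n i (fst z)) (snd z))) \<partial>(\<mu> \<Otimes>\<^sub>M uniform01))"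
        unfolding Xn_def X_def
        by (rule nn_Z[of "\<lambda>z. indicator A (p (pick n (\<lambda>i. sm n i (fst z)) (snd z)))"])
          (rule meas_pick, simp)
      also have "\<dots> = (\<Sum>i\<le>n. \<integral>\<^sup>+x. indicator A (p i) * ennreal (sm n i x) \<partial>\<mu>)"
        unfolding sm_def by (rule nn_integral_softmax_pick[OF sets, where \<phi> = "\<lambda>i x. indicator A (p i)"]) simp
      also have "\<dots> = (\<Sum>i\<le>n. indicator A (p i) * ennreal (I n \<mu> i))"
        unfolding I_def using sm_int
        by (auto intro!: sum.cong simp: nn_integral_cmult nn_integral_eq_integral sm_def softmax_nonneg)
      also have "\<dots> = (\<integral>\<^sup>+t. indicator A (p (pick n (I n \<mu>) t)) \<partial>uniform01)"
        by (rule nn_integral_pick[OF I_simplex, symmetric])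
      also have "\<dots> = (\<integral>\<^sup>+\<omega>. indicator A (Y n (I n \<mu>) \<omega>) \<partial>\<Omega>)"
        unfolding law_u[symmetric] Y_def by (rule nn_integral_distr) measurable
      also have "\<dots> = emeasure (law \<Omega> (Y n (I n \<mu>))) A"
        unfolding law_def by (subst nn_integral_indicator[symmetric], simp, subst nn_integral_distr) auto
      finally show "emeasure (law \<Omega> (Xn n)) A = emeasure (law \<Omega> (Y n (I n \<mu>))) A" .
    qed (simp add: law_def)
    define cost where "cost n = softmax_cost p ((real n + 1)\<^sup>2) n" for n
    have cost_meas [measurable]: "cost n \<in> borel_measurable borel" for n
      unfolding cost_def softmax_cost_def[abs_def] by measurable
    have cost_le: "cost n x \<le> (norm x)\<^sup>2 + 1" for n x
    proof -
      have "cost n x \<le> (norm (x - p 0))\<^sup>2 + (real n + 1) / (real n + 1)\<^sup>2"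
        unfolding cost_def by (rule softmax_cost_le) auto
      also have "(real n + 1) / (real n + 1)\<^sup>2 \<le> 1" by (simp add: power2_eq_square)
      finally show ?thesis by (simp add: p(1))
    qed
    have sq_int: "integrable \<mu> (\<lambda>x. (norm x)\<^sup>2 + 1)" using \<mu> by (simp add: P2_def)
    have cost0: "0 \<le> cost n x" for n x by (simp add: cost_def softmax_cost_nonneg)
    have cost_int: "integrable \<mu> (cost n)" for n
      by (rule Bochner_Integration.integrable_bound[OF sq_int]) (use cost_le cost0 in auto)
    have "(L2dist \<Omega> (Xn n) X)\<^sup>2 = (LINT x|\<mu>. cost n x)" for n
    proof -
      have "ennreal ((L2dist \<Omega> (Xn n) X)\<^sup>2) =
          (\<integral>\<^sup>+\<omega>. ennreal ((norm (X \<omega> - Xn n \<omega>))\<^sup>2) \<partial>\<Omega>)"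
        unfolding L2norm_minus_commute[of \<Omega> "Xn n"] L2norm_power2
        by (rule nn_integral_eq_integral[symmetric]) (use L2_integrable_power2[OF L2_diff[OF X Xn]] in auto)
      also have "\<dots> = (\<integral>\<^sup>+z. ennreal ((norm (fst z - p (pick n (\<lambda>i. sm n i (fst z)) (snd z))))\<^sup>2)
          \<partial>(\<mu> \<Otimes>\<^sub>M uniform01))"
        unfolding Xn_def X_def
        by (rule nn_Z[of "\<lambda>z. ennreal ((norm (fst z - p (pick n (\<lambda>i. sm n i (fst z)) (snd z))))\<^sup>2)"])
          (rule meas_pick[of "\<lambda>i x. ennreal ((norm (x - p i))\<^sup>2)"], simp)
      also have "\<dots> = (\<Sum>i\<le>n. \<integral>\<^sup>+x. ennreal ((norm (x - p i))\<^sup>2) * ennreal (sm n i x) \<partial>\<mu>)"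
        unfolding sm_def
        by (rule nn_integral_softmax_pick[OF sets, where \<phi> = "\<lambda>i x. ennreal ((norm (x - p i))\<^sup>2)"]) simp
      also have "\<dots> = (\<integral>\<^sup>+x. (\<Sum>i\<le>n. ennreal ((norm (x - p i))\<^sup>2) * ennreal (sm n i x)) \<partial>\<mu>)"
        by (rule nn_integral_sum[symmetric]) measurable
      also have "\<dots> = (\<integral>\<^sup>+x. ennreal (cost n x) \<partial>\<mu>)"
        unfolding cost_def softmax_cost_def sm_def
        by (intro nn_integral_cong) (simp add: ennreal_mult' softmax_nonneg mult.commute flip: sum_ennreal)
      also have "\<dots> = ennreal (LINT x|\<mu>. cost n x)"
        by (rule nn_integral_eq_integral[OF cost_int]) (simp add: cost0)
      finally show ?thesis by (simp add: ennreal_inj Bochner_Integration.integral_nonneg cost0)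
    qed
    moreover have "(\<lambda>n. LINT x|\<mu>. cost n x) \<longlonglongrightarrow> (LINT x|\<mu>. 0)"
    proof (rule integral_dominated_convergence[OF _ _ sq_int])
      show "AE x in \<mu>. (\<lambda>n. cost n x) \<longlonglongrightarrow> 0"
        unfolding cost_def by (intro AE_I2 softmax_cost_tendsto_0 p(2))
    qed (use cost_le cost0 in auto)
    ultimately have "(\<lambda>n. (L2dist \<Omega> (Xn n) X)\<^sup>2) \<longlonglongrightarrow> 0" by simp
    from tendsto_real_sqrt[OF this] have "(\<lambda>n. L2dist \<Omega> (Xn n) X) \<longlonglongrightarrow> 0" by simp
    from cont[OF X Xn this] have "(\<lambda>n. h n (I n \<mu>)) \<longlonglongrightarrow> H \<mu>"
      by (simp add: law_X law_Xn h_def)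
    moreover have "(\<lambda>n. Hn n \<mu> - h n (I n \<mu>)) \<longlonglongrightarrow> 0"
    proof (rule tendsto_0_le[where K = 1])
      show "(\<lambda>n. 1 / real (Suc n)) \<longlonglongrightarrow> 0" by (rule LIMSEQ_Suc[OF lim_1_over_n])
      show "\<forall>\<^sub>F n in sequentially. norm (Hn n \<mu> - h n (I n \<mu>)) \<le> norm (1 / real (Suc n)) * 1"
      proof (rule always_eventually, rule allI)
        fix n
        show "norm (Hn n \<mu> - h n (I n \<mu>)) \<le> norm (1 / real (Suc n)) * 1"
          using P(2)[OF I_simplex[of n]] by (simp add: Hn_def abs_minus_commute)
      qed
    qed
    ultimately show ?thesis using tendsto_add by fastforce
  qed
  ultimately show ?thesis by blast
qed

section \<open>Continuity of the Hamiltonian\<close>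

lemma L2_contraction:
  fixes T :: "'a::euclidean_space \<Rightarrow> 'b::euclidean_space"
  assumes T: "T \<in> borel_measurable borel" "\<And>x. norm (T x) \<le> norm x" and X: "X \<in> L2 \<Omega>"
  shows "(\<lambda>w. T (X w)) \<in> L2 \<Omega>"
  by (rule L2_dominated[OF X measurable_compose[OF L2_measurable[OF X] T(1)], of 1]) (simp add: T(2))

lemma L2_Pair:
  assumes X: "X \<in> L2 \<Omega>" and Y: "Y \<in> L2 \<Omega>"
  shows "(\<lambda>w. (X w, Y w)) \<in> L2 \<Omega>"
  using borel_measurable_Pair[OF L2_measurable[OF X] L2_measurable[OF Y]]
    L2_integrable_power2[OF X] L2_integrable_power2[OF Y]
  by (simp add: L2_def norm_Pair)

lemma L2_inner_tendsto:
  assumes X: "X \<in> L2 \<Omega>" "\<And>k. X' k \<in> L2 \<Omega>" "(\<lambda>k. L2dist \<Omega> (X' k) X) \<longlonglongrightarrow> 0"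
    and Y: "Y \<in> L2 \<Omega>" "\<And>k. Y' k \<in> L2 \<Omega>" "(\<lambda>k. L2dist \<Omega> (Y' k) Y) \<longlonglongrightarrow> 0"
  shows "(\<lambda>k::nat. LINT w|\<Omega>. X' k w \<bullet> Y' k w) \<longlonglongrightarrow> (LINT w|\<Omega>. X w \<bullet> Y w)"
proof -
  let ?dX = "\<lambda>k w. X' k w - X w" and ?dY = "\<lambda>k w. Y' k w - Y w"
  have "(\<lambda>k. (LINT w|\<Omega>. X' k w \<bullet> Y' k w) - (LINT w|\<Omega>. X w \<bullet> Y w)) \<longlonglongrightarrow> 0"
  proof (rule tendsto_0_le[where K = 1])
    show "(\<lambda>k. L2norm \<Omega> (?dX k) * L2norm \<Omega> (?dY k) + L2norm \<Omega> (?dX k) * L2norm \<Omega> Y +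
        L2norm \<Omega> X * L2norm \<Omega> (?dY k)) \<longlonglongrightarrow> 0"
      using X(3) Y(3) by (auto intro!: tendsto_eq_intros)
    show "\<forall>\<^sub>F k in sequentially. norm ((LINT w|\<Omega>. X' k w \<bullet> Y' k w) - (LINT w|\<Omega>. X w \<bullet> Y w)) \<le>
        norm (L2norm \<Omega> (?dX k) * L2norm \<Omega> (?dY k) + L2norm \<Omega> (?dX k) * L2norm \<Omega> Y +
          L2norm \<Omega> X * L2norm \<Omega> (?dY k)) * 1"
    proof (rule always_eventually, rule allI)
      fix k
      have dX: "?dX k \<in> L2 \<Omega>" and dY: "?dY k \<in> L2 \<Omega>" using X Y by (auto intro: L2_diff)
      have "(\<lambda>w. X' k w \<bullet> Y' k w) = (\<lambda>w. ?dX k w \<bullet> ?dY k w + ?dX k w \<bullet> Y w + X w \<bullet> ?dY k w + X w \<bullet> Y w)"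
        by (simp add: fun_eq_iff inner_diff_left inner_diff_right)
      then have "(LINT w|\<Omega>. X' k w \<bullet> Y' k w) - (LINT w|\<Omega>. X w \<bullet> Y w) =
          (LINT w|\<Omega>. ?dX k w \<bullet> ?dY k w) + (LINT w|\<Omega>. ?dX k w \<bullet> Y w) + (LINT w|\<Omega>. X w \<bullet> ?dY k w)"
        using L2_integrable_inner[OF dX dY] L2_integrable_inner[OF dX Y(1)]
          L2_integrable_inner[OF X(1) dY] L2_integrable_inner[OF X(1) Y(1)]
        by (simp only: Bochner_Integration.integral_add Bochner_Integration.integrable_add)
      then show "norm ((LINT w|\<Omega>. X' k w \<bullet> Y' k w) - (LINT w|\<Omega>. X w \<bullet> Y w)) \<le>
          norm (L2norm \<Omega> (?dX k) * L2norm \<Omega> (?dY k) + L2norm \<Omega> (?dX k) * L2norm \<Omega> Y +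
            L2norm \<Omega> X * L2norm \<Omega> (?dY k)) * 1"
        using L2_Cauchy_Schwarz[OF dX dY] L2_Cauchy_Schwarz[OF dX Y(1)] L2_Cauchy_Schwarz[OF X(1) dY]
        by simp
    qed
  qed
  then show ?thesis by (simp add: LIM_zero_iff)
qed

lemma (in prob_space) L2_integral_tendsto:
  assumes X: "X \<in> L2 M" "\<And>k. X' k \<in> L2 M" "(\<lambda>k. L2dist M (X' k) X) \<longlonglongrightarrow> 0"
  shows "(\<lambda>k::nat. LINT w|M. X' k w) \<longlonglongrightarrow> (LINT w|M. X w)"
proof -
  have "(\<lambda>k. (LINT w|M. X' k w) - (LINT w|M. X w)) \<longlonglongrightarrow> 0"
  proof (rule tendsto_0_le[OF X(3), where K = 1], rule always_eventually, rule allI)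
    fix k
    have "(LINT w|M. X' k w) - (LINT w|M. X w) = (LINT w|M. X' k w - X w)"
      using L2_integrable[OF X(1)] L2_integrable[OF X(2)] by simp
    then show "norm ((LINT w|M. X' k w) - (LINT w|M. X w)) \<le> norm (L2dist M (X' k) X) * 1"
      using L2_norm_integral_le[OF L2_diff[OF X(2) X(1)]] by simp
  qed
  then show ?thesis by (simp add: LIM_zero_iff)
qed

text \<open>\<open>wasserstein_derivs\<close> demands joint continuity only for non-empty
  multi-indices, so continuity of \<open>f\<close> itself is drawn from differentiability: the
  expansion with tolerance 1 bounds the increment by a constant times the distance from
  \<open>X\<close>.\<close>

lemma wasserstein_derivative_continuous:
  assumes F: "has_wasserstein_derivative \<Omega> F g (law \<Omega> X)"
    and X: "X \<in> L2 \<Omega>" "\<And>k. X' k \<in> L2 \<Omega>" "(\<lambda>k. L2dist \<Omega> (X' k) X) \<longlonglongrightarrow> 0"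
  shows "(\<lambda>k::nat. F (law \<Omega> (X' k))) \<longlonglongrightarrow> F (law \<Omega> X)"
proof -
  have gX: "(\<lambda>w. g (X w)) \<in> L2 \<Omega>" by (rule has_wasserstein_derivativeD(3)[OF F X(1) refl])
  obtain r where r: "r > 0" "\<And>\<eta>. \<eta> \<in> L2 \<Omega> \<Longrightarrow> L2norm \<Omega> \<eta> < r \<Longrightarrow>
      \<bar>F (law \<Omega> (\<lambda>w. X w + \<eta> w)) - F (law \<Omega> X) - (LINT w|\<Omega>. g (X w) \<bullet> \<eta> w)\<bar> \<le> 1 * L2norm \<Omega> \<eta>"
    using has_wasserstein_derivativeD(4)[OF F X(1) refl, of 1] by auto
  have "(\<lambda>k. F (law \<Omega> (X' k)) - F (law \<Omega> X)) \<longlonglongrightarrow> 0"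
  proof (rule tendsto_0_le[OF X(3)])
    from order_tendstoD(2)[OF X(3) r(1)]
    show "\<forall>\<^sub>F k in sequentially. norm (F (law \<Omega> (X' k)) - F (law \<Omega> X)) \<le>
        norm (L2dist \<Omega> (X' k) X) * (L2norm \<Omega> (\<lambda>w. g (X w)) + 1)"
    proof eventually_elim
      case (elim k)
      have d: "(\<lambda>w. X' k w - X w) \<in> L2 \<Omega>" by (intro L2_diff X)
      show ?case
        using r(2)[OF d elim] L2_Cauchy_Schwarz[OF gX d] by (simp add: algebra_simps)
    qed
  qed
  then show ?thesis by (simp add: LIM_zero_iff)
qed

text \<open>Second-order Taylor expansion with Lagrange remainder along the ray through \<alpha>;
  \<open>d m\<close> is the \<open>m\<close>-th derivative on this ray.\<close>

lemma convex_quadratic_lower_bound: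
  fixes \<Phi> :: "'e::euclidean_space \<Rightarrow> real"
  assumes \<Phi>: "euclidean_derivs n \<Phi> D" and n: "2 \<le> n" and hess: "\<And>\<alpha> v. hess D \<alpha> v \<ge> \<delta> * (v \<bullet> v)"
  shows "\<Phi> \<alpha> \<ge> \<Phi> 0 + \<alpha> \<bullet> (\<Sum>b\<in>Basis. D [b] 0 *\<^sub>R b) + \<delta> / 2 * (norm \<alpha>)\<^sup>2"
proof -
  have P: "has_partials (D \<beta>) (\<lambda>b. D (\<beta> @ [b]))" if "set \<beta> \<subseteq> Basis" "length \<beta> < n" for \<beta>
    using \<Phi> that by (simp add: euclidean_derivs_def has_partials_def)
  have cont: "continuous_on UNIV (D \<beta>)" if "set \<beta> \<subseteq> Basis" "length \<beta> \<le> n" for \<beta>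
    using \<Phi> that by (simp add: euclidean_derivs_def)
  define d where "d m t = (if m = 0 then \<Phi> (t *\<^sub>R \<alpha>) else if m = 1 then \<Sum>b\<in>Basis. (\<alpha> \<bullet> b) * D [b] (t *\<^sub>R \<alpha>)
    else hess D (t *\<^sub>R \<alpha>) \<alpha>)" for m :: nat and t
  have "\<exists>t. 0 < t \<and> t < 1 \<and> \<Phi> (1 *\<^sub>R \<alpha>) = (\<Sum>m<2. (d m 0 / fact m) * 1 ^ m) + (d 2 t / fact 2) * 1 ^ 2"
  proof (rule Maclaurin[where f = "\<lambda>t. \<Phi> (t *\<^sub>R \<alpha>)"])
    show "d 0 = (\<lambda>t. \<Phi> (t *\<^sub>R \<alpha>))" by (simp add: d_def fun_eq_iff)
    have "(d 0 has_real_derivative d 1 t) (at t)" for t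
      using continuous_partials_line[OF P[of "[]"], of 0 \<alpha> t] cont n \<Phi>
      by (simp add: d_def[abs_def] euclidean_derivs_def)
    moreover have "(d 1 has_real_derivative d 2 t) (at t)" for t
    proof -
      have "((\<lambda>t. D [b] (t *\<^sub>R \<alpha>)) has_real_derivative (\<Sum>c\<in>Basis. (\<alpha> \<bullet> c) * D [b, c] (t *\<^sub>R \<alpha>))) (at t)"
        if "b \<in> Basis" for b
        using continuous_partials_line[OF P[of "[b]"], of 0 \<alpha> t] cont n that by simp
      then have "((\<lambda>t. \<Sum>b\<in>Basis. (\<alpha> \<bullet> b) * D [b] (t *\<^sub>R \<alpha>)) has_real_derivative
          (\<Sum>b\<in>Basis. (\<alpha> \<bullet> b) * (\<Sum>c\<in>Basis. (\<alpha> \<bullet> c) * D [b, c] (t *\<^sub>R \<alpha>)))) (at t)"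
        by (intro DERIV_sum DERIV_cmult)
      then show ?thesis
        by (simp add: d_def[abs_def] hess_def sum_distrib_left mult.assoc)
    qed
    ultimately show "\<forall>m t. m < 2 \<and> 0 \<le> t \<and> t \<le> 1 \<longrightarrow> (d m has_real_derivative d (Suc m) t) (at t)"
      by (auto simp: less_Suc_eq numeral_2_eq_2)
  qed auto
  then obtain t where "\<Phi> \<alpha> = d 0 0 + d 1 0 + d 2 t / 2" by (auto simp: numeral_2_eq_2)
  moreover have "d 2 t \<ge> \<delta> * (norm \<alpha>)\<^sup>2"
    using hess[where v = \<alpha>] by (simp add: d_def power2_norm_eq_inner)
  moreover have "d 1 0 = \<alpha> \<bullet> (\<Sum>b\<in>Basis. D [b] 0 *\<^sub>R b)"
    by (simp add: d_def inner_sum_right mult.commute)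
  ultimately show ?thesis by (simp add: d_def)
qed

text \<open>Quadratic growth of \<Phi> makes the supremum finite at every \<beta>, so
  \<open>SUP\<close> is not a default value. A finite supremum of affine functions is convex, and
  convex functions on a Euclidean space are continuous.\<close>

lemma convex_conjugate_continuous:
  fixes \<Phi> :: "'e::euclidean_space \<Rightarrow> real"
  assumes "euclidean_derivs n \<Phi> D" "2 \<le> n" "\<And>\<alpha> v. hess D \<alpha> v \<ge> \<delta> * (v \<bullet> v)" and \<delta>: "\<delta> > 0"
  shows "continuous_on UNIV (convex_conjugate \<Phi>)"
proof -
  define g where "g = (\<Sum>b\<in>Basis. D [b] 0 *\<^sub>R b)"
  have bdd: "bdd_above (range (\<lambda>\<alpha>. \<alpha> \<bullet> \<beta> - \<Phi> \<alpha>))" for \<beta>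
  proof (rule bdd_aboveI2)
    fix \<alpha>
    \<comment> \<open>Completing the square bounds the linear term by the quadratic growth plus a
      constant.\<close>
    have "0 \<le> (norm (\<delta> *\<^sub>R \<alpha> - (\<beta> - g)))\<^sup>2" by simp
    also have "\<dots> = \<delta>\<^sup>2 * (norm \<alpha>)\<^sup>2 - 2 * \<delta> * (\<alpha> \<bullet> (\<beta> - g)) + (norm (\<beta> - g))\<^sup>2"
      unfolding power2_norm_eq_inner
      by (simp add: inner_diff_left inner_diff_right inner_commute power2_eq_square algebra_simps)
    finally have "\<alpha> \<bullet> (\<beta> - g) \<le> \<delta> / 2 * (norm \<alpha>)\<^sup>2 + (norm (\<beta> - g))\<^sup>2 / (2 * \<delta>)"
      using \<delta> by (simp add: field_simps power2_eq_square)
    then show "\<alpha> \<bullet> \<beta> - \<Phi> \<alpha> \<le> (norm (\<beta> - g))\<^sup>2 / (2 * \<delta>) - \<Phi> 0"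
      using convex_quadratic_lower_bound[OF assms(1-3), of \<alpha>] by (simp add: g_def inner_diff_right)
  qed
  have "convex_on UNIV (convex_conjugate \<Phi>)"
  proof (rule convex_onI)
    fix t :: real and \<beta> \<beta>' :: 'e assume t: "0 < t" "t < 1"
    show "convex_conjugate \<Phi> ((1 - t) *\<^sub>R \<beta> + t *\<^sub>R \<beta>') \<le>
        (1 - t) * convex_conjugate \<Phi> \<beta> + t * convex_conjugate \<Phi> \<beta>'"
      unfolding convex_conjugate_def[of \<Phi> "(1 - t) *\<^sub>R \<beta> + t *\<^sub>R \<beta>'"]
    proof (rule cSUP_least)
      fix \<alpha>
      have "\<alpha> \<bullet> \<beta> - \<Phi> \<alpha> \<le> convex_conjugate \<Phi> \<beta>" "\<alpha> \<bullet> \<beta>' - \<Phi> \<alpha> \<le> convex_conjugate \<Phi> \<beta>'"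
        unfolding convex_conjugate_def by (auto intro: cSUP_upper bdd)
      then have "(1 - t) * (\<alpha> \<bullet> \<beta> - \<Phi> \<alpha>) + t * (\<alpha> \<bullet> \<beta>' - \<Phi> \<alpha>) \<le>
          (1 - t) * convex_conjugate \<Phi> \<beta> + t * convex_conjugate \<Phi> \<beta>'"
        using t by (intro add_mono mult_left_mono) auto
      then show "\<alpha> \<bullet> ((1 - t) *\<^sub>R \<beta> + t *\<^sub>R \<beta>') - \<Phi> \<alpha> \<le>
          (1 - t) * convex_conjugate \<Phi> \<beta> + t * convex_conjugate \<Phi> \<beta>'"
        by (simp add: inner_add_right algebra_simps)
    qed simp
  qed simp
  then show ?thesis by (intro convex_on_continuous) auto
qed

text \<open>Bounded second partials give first partials of linear growth, hence increments of this
  mixed form. It suits L2: the integral is finite and depends continuously on the random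
  variable.\<close>

lemma bounded_second_partials_growth:
  fixes v :: "'e::euclidean_space \<Rightarrow> real"
  assumes v: "has_partials v g" and g: "\<And>b. b \<in> Basis \<Longrightarrow> has_partials (g b) (h b)"
    and C: "\<And>b c z. b \<in> Basis \<Longrightarrow> c \<in> Basis \<Longrightarrow> \<bar>h b c z\<bar> \<le> C"
  obtains K where "K \<ge> 0" "\<And>z w. \<bar>v (z + w) - v z\<bar> \<le> K * (1 + norm z + norm w) * norm w"
proof -
  define A where "A = (\<Sum>b\<in>Basis. \<bar>g b 0\<bar>)"
  have C0: "C \<ge> 0"
  proof -
    obtain b :: 'e where "b \<in> Basis" using nonempty_Basis by blast
    then show ?thesis using C[of b b 0] by linarith
  qed
  have A0: "A \<ge> 0" by (simp add: A_def sum_nonneg)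
  define B where "B = A + DIM('e) * C"
  have B0: "B \<ge> 0" using A0 C0 by (simp add: B_def)
  have gb: "\<bar>g b z\<bar> \<le> B * (1 + norm z)" if b: "b \<in> Basis" for b z
  proof -
    have "\<bar>g b (0 + z) - g b 0\<bar> \<le> DIM('e) * C * norm z"
      by (rule partials_increment[OF g[OF b] C[OF b]])
    moreover have "\<bar>g b 0\<bar> \<le> A" unfolding A_def using b by (intro member_le_sum) auto
    ultimately have "\<bar>g b z\<bar> \<le> A + DIM('e) * C * norm z" by simp
    also have "\<dots> \<le> B * (1 + norm z)" using A0 C0 by (simp add: B_def algebra_simps)
    finally show ?thesis .
  qed
  have "\<bar>v (z + w) - v z\<bar> \<le> (DIM('e) * B) * (1 + norm z + norm w) * norm w" for z w
  proof -
    have "\<bar>v (z + w) - v z\<bar> \<le> DIM('e) * (B * (1 + norm z + norm w)) * norm w"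
    proof (rule partials_increment[OF v])
      fix b y :: 'e assume b: "b \<in> Basis" and y: "y \<in> cball z (norm w)"
      have "norm y \<le> norm z + norm w"
        using norm_triangle_ineq2[of y z] y by (simp add: dist_norm norm_minus_commute)
      then have "B * (1 + norm y) \<le> B * (1 + norm z + norm w)"
        using B0 by (intro mult_left_mono) auto
      then show "\<bar>g b y\<bar> \<le> B * (1 + norm z + norm w)" using gb[OF b, of y] by linarith
    qed
    then show ?thesis by (simp add: mult.assoc)
  qed
  moreover have "0 \<le> DIM('e) * B" using B0 by simp
  ultimately show thesis by (rule that[rotated])
qed

text \<open>On the segment from \<open>x\<close> to \<open>y\<close> the second derivative is the
  Hessian form in the direction y - x, so concavity reduces to one variable.\<close>

lemma nonpos_second_partials_concave:
  fixes v :: "'e::euclidean_space \<Rightarrow> real"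
  assumes v: "has_partials v g" and g: "\<And>b. b \<in> Basis \<Longrightarrow> has_partials (g b) (h b)"
    and g_cont: "\<And>b. b \<in> Basis \<Longrightarrow> continuous_on UNIV (g b)"
    and h_cont: "\<And>b c. b \<in> Basis \<Longrightarrow> c \<in> Basis \<Longrightarrow> continuous_on UNIV (h b c)"
    and nonpos: "\<And>z w. (\<Sum>b\<in>Basis. \<Sum>c\<in>Basis. (w \<bullet> b) * (w \<bullet> c) * h b c z) \<le> 0"
    and t: "0 \<le> t" "t \<le> 1"
  shows "(1 - t) * v x + t * v y \<le> v ((1 - t) *\<^sub>R x + t *\<^sub>R y)"
proof -
  define w where "w = y - x"
  have "convex_on UNIV (\<lambda>s. - v (x + s *\<^sub>R w))"
  proof (rule f''_ge0_imp_convex)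
    show "((\<lambda>s. - v (x + s *\<^sub>R w)) has_real_derivative - (\<Sum>b\<in>Basis. (w \<bullet> b) * g b (x + s *\<^sub>R w))) (at s)" for s
      by (intro DERIV_minus continuous_partials_line v g_cont)
    show "((\<lambda>s. - (\<Sum>b\<in>Basis. (w \<bullet> b) * g b (x + s *\<^sub>R w))) has_real_derivative
        - (\<Sum>b\<in>Basis. (w \<bullet> b) * (\<Sum>c\<in>Basis. (w \<bullet> c) * h b c (x + s *\<^sub>R w)))) (at s)" for s
      by (intro DERIV_minus DERIV_sum DERIV_cmult continuous_partials_line g h_cont)
    show "0 \<le> - (\<Sum>b\<in>Basis. (w \<bullet> b) * (\<Sum>c\<in>Basis. (w \<bullet> c) * h b c (x + s *\<^sub>R w)))" for s
      using nonpos[of w "x + s *\<^sub>R w"] by (simp add: sum_distrib_left mult.assoc)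
  qed simp
  from convex_onD[OF this, of t 0 1] t
  have "- v (x + t *\<^sub>R w) \<le> (1 - t) * - v x + t * - v (x + w)" by simp
  moreover have "x + t *\<^sub>R w = (1 - t) *\<^sub>R x + t *\<^sub>R y" by (simp add: w_def algebra_simps)
  ultimately show ?thesis by (simp add: w_def)
qed

section \<open>Growth and concavity of \<open>U\<close> in its Euclidean variables\<close>

lemma mixed_derivs_partials:
  assumes "mixed_derivs \<Omega> n U D" and "\<mu> \<in> P2" and "set \<beta> \<subseteq> Basis" and "length \<beta> < n"
  shows "has_partials (\<lambda>z. D \<beta> [] z \<mu> []) (\<lambda>b z. D (\<beta> @ [b]) [] z \<mu> [])"
proof -
  have *: "\<forall>\<beta> \<alpha>. set \<beta> \<subseteq> Basis \<longrightarrow> multi_index \<alpha> \<longrightarrow> length \<beta> + total_order \<alpha> < n \<longrightarrow>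
      (\<forall>z. \<forall>b\<in>Basis. \<forall>\<mu> \<in> P2. \<forall>xs. length xs = length \<alpha> \<longrightarrow>
        ((\<lambda>t. D \<beta> \<alpha> (z + t *\<^sub>R b) \<mu> xs) has_real_derivative D (\<beta> @ [b]) \<alpha> z \<mu> xs) (at 0))"
    using assms(1) unfolding mixed_derivs_def by (elim conjE)
  show ?thesis
    unfolding has_partials_def
    by (intro allI ballI, rule *[rule_format, of \<beta> "[]" _ \<mu> "[]"])
      (use assms in \<open>auto simp: multi_index_def total_order_def\<close>)
qed

lemma mixed_derivs_bound:
  assumes "mixed_derivs_bounded_by C m n D" and "\<mu> \<in> P2"
    and "set \<beta> \<subseteq> Basis" and "m \<le> length \<beta>" and "length \<beta> \<le> n"
  shows "\<bar>D \<beta> [] z \<mu> []\<bar> \<le> C"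
  by (rule assms(1)[unfolded mixed_derivs_bounded_by_def, rule_format, of \<beta> "[]" \<mu> "[]"])
    (use assms in \<open>auto simp: multi_index_def total_order_def\<close>)

text \<open>Within one cost the control is fixed, and with it the measure argument of
  \<open>U\<close>. So growth in the Euclidean variables at a frozen \<mu> is the relevant
  estimate.\<close>

lemma mixed_derivs_growth:
  fixes U :: "real^'m \<Rightarrow> real^'n \<Rightarrow> (real^'m) measure \<Rightarrow> real"
  assumes U: "mixed_derivs \<Omega> 6 (\<lambda>(x, q). U x q) DU" and bound: "mixed_derivs_bounded_by C 2 6 DU"
    and \<mu>: "\<mu> \<in> P2"
  obtains K where "K \<ge> 0"
    "\<And>x q x' q'. \<bar>U (x + x') (q + q') \<mu> - U x q \<mu>\<bar> \<le>
       K * (1 + norm (x, q) + norm (x', q')) * norm (x', q')"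
proof -
  have 1: "has_partials (\<lambda>z. DU [] [] z \<mu> []) (\<lambda>b z. DU [b] [] z \<mu> [])"
    using mixed_derivs_partials[OF U \<mu>, of "[]"] by simp
  have 2: "has_partials (\<lambda>z. DU [b] [] z \<mu> []) (\<lambda>c z. DU [b, c] [] z \<mu> [])" if "b \<in> Basis" for b
    using mixed_derivs_partials[OF U \<mu>, of "[b]"] that by simp
  have 3: "\<bar>DU [b, c] [] z \<mu> []\<bar> \<le> C" if "b \<in> Basis" "c \<in> Basis" for b c z
    by (rule mixed_derivs_bound[OF bound \<mu>]) (use that in auto)
  obtain K where K: "K \<ge> 0" "\<And>z w. \<bar>DU [] [] (z + w) \<mu> [] - DU [] [] z \<mu> []\<bar> \<le> K * (1 + norm z + norm w) * norm w"
    using bounded_second_partials_growth[OF 1 2 3] by blast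
  have "DU [] [] (x, q) \<mu> [] = U x q \<mu>" for x q
    using U \<mu> by (simp add: mixed_derivs_def)
  then show thesis using that[OF K(1)] K(2)[of "(x, q)" "(x', q')" for x q x' q'] by simp
qed

lemma mixed_derivs_concave:
  fixes U :: "real^'m \<Rightarrow> real^'n \<Rightarrow> (real^'m) measure \<Rightarrow> real"
  assumes U: "mixed_derivs \<Omega> 6 (\<lambda>(x, q). U x q) DU" and bound: "mixed_derivs_bounded_by C 2 6 DU"
    and hess: "\<And>x q v. hess_QQ DU x q \<mu> v \<le> 0" and \<mu>: "\<mu> \<in> P2" and t: "0 \<le> t" "t \<le> 1"
  shows "(1 - t) * U x q \<mu> + t * U x q' \<mu> \<le> U x ((1 - t) *\<^sub>R q + t *\<^sub>R q') \<mu>"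
proof -
  have B: "(0, b) \<in> (Basis :: ((real^'m) \<times> (real^'n)) set)" if "b \<in> Basis" for b
    using that by (auto simp: Basis_prod_def)
  have P: "has_partials (\<lambda>q. DU \<beta> [] (x, q) \<mu> []) (\<lambda>c q. DU (\<beta> @ [(0, c)]) [] (x, q) \<mu> [])"
    if \<beta>: "set \<beta> \<subseteq> Basis" "length \<beta> < 6" for \<beta>
    unfolding has_partials_def
  proof (intro allI ballI)
    fix z b :: "real^'n" assume "b \<in> Basis"
    then have "((\<lambda>t. DU \<beta> [] ((x, z) + t *\<^sub>R (0, b)) \<mu> []) has_real_derivative
        DU (\<beta> @ [(0, b)]) [] (x, z) \<mu> []) (at 0)"
      using mixed_derivs_partials[OF U \<mu> \<beta>] B unfolding has_partials_def by blast
    then show "((\<lambda>t. DU \<beta> [] (x, z + t *\<^sub>R b) \<mu> []) has_real_derivative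
        DU (\<beta> @ [(0, b)]) [] (x, z) \<mu> []) (at 0)" by simp
  qed
  \<comment> \<open>A partial of order 1 to 5 has next partials of order 2 to 6, which are bounded
    by \<open>C\<close>; so it is Lipschitz in \<open>q\<close>.\<close>
  have cont: "continuous_on UNIV (\<lambda>q. DU \<beta> [] (x, q) \<mu> [])"
    if \<beta>: "set \<beta> \<subseteq> Basis" "1 \<le> length \<beta>" "length \<beta> < 6" for \<beta>
    by (rule bounded_partials_continuous[OF P, of _ C], use \<beta> in simp, use \<beta> in simp,
        rule mixed_derivs_bound[OF bound \<mu>]) (use \<beta> B in auto)
  have "(1 - t) * DU [] [] (x, q) \<mu> [] + t * DU [] [] (x, q') \<mu> [] \<le>
      DU [] [] (x, (1 - t) *\<^sub>R q + t *\<^sub>R q') \<mu> []"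
  proof (rule nonpos_second_partials_concave[where v = "\<lambda>q. DU [] [] (x, q) \<mu> []", OF _ _ _ _ _ t])
    show "has_partials (\<lambda>q. DU [] [] (x, q) \<mu> []) (\<lambda>b q. DU [(0, b)] [] (x, q) \<mu> [])"
      using P[of "[]"] by simp
    show "has_partials (\<lambda>q. DU [(0, b)] [] (x, q) \<mu> []) (\<lambda>c q. DU [(0, b), (0, c)] [] (x, q) \<mu> [])"
      if "b \<in> Basis" for b
      using P[of "[(0, b)]"] B[OF that] by simp
    show "continuous_on UNIV (\<lambda>q. DU [(0, b)] [] (x, q) \<mu> [])" if "b \<in> Basis" for b
      using cont[of "[(0, b)]"] B[OF that] by simp
    show "continuous_on UNIV (\<lambda>q. DU [(0, b), (0, c)] [] (x, q) \<mu> [])" if "b \<in> Basis" "c \<in> Basis" for b c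
      using cont[of "[(0, b), (0, c)]"] B that by simp
    show "(\<Sum>b\<in>Basis. \<Sum>c\<in>Basis. (w \<bullet> b) * (w \<bullet> c) * DU [(0, b), (0, c)] [] (x, z) \<mu> []) \<le> 0" for z w
      using hess[of x z w] by (simp add: hess_QQ_def)
  qed
  moreover have "DU [] [] (x, q) \<mu> [] = U x q \<mu>" for x q
    using U \<mu> by (simp add: mixed_derivs_def)
  ultimately show ?thesis by simp
qed

lemma L2_growth_integrable:
  fixes u :: "'a::euclidean_space \<Rightarrow> real"
  assumes \<Omega>: "prob_space \<Omega>" and u: "\<And>z w. \<bar>u (z + w) - u z\<bar> \<le> K * (1 + norm z + norm w) * norm w"
    and meas: "u \<in> borel_measurable borel" and Z: "Z \<in> L2 \<Omega>"
  shows "integrable \<Omega> (\<lambda>w. u (Z w))"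
proof -
  interpret prob_space \<Omega> by fact
  have [measurable]: "u \<in> borel_measurable borel" "Z \<in> borel_measurable \<Omega>"
    using meas Z by (auto simp: L2_def)
  have nZ: "(\<lambda>w. norm (Z w)) \<in> L2 \<Omega>" by (rule L2_norm[OF Z])
  show ?thesis
  proof (rule Bochner_Integration.integrable_bound)
    show "integrable \<Omega> (\<lambda>w. \<bar>u 0\<bar> + K * (norm (Z w) + norm (Z w) * norm (Z w)))"
      using L2_integrable[OF nZ] L2_integrable_mult[OF nZ nZ] by simp
    show "AE w in \<Omega>. norm (u (Z w)) \<le> norm (\<bar>u 0\<bar> + K * (norm (Z w) + norm (Z w) * norm (Z w)))"
    proof (rule AE_I2)
      fix w
      show "norm (u (Z w)) \<le> norm (\<bar>u 0\<bar> + K * (norm (Z w) + norm (Z w) * norm (Z w)))"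
        using u[of 0 "Z w"] by (simp add: algebra_simps)
    qed
  qed simp
qed

text \<open>The factor \<open>norm w\<close> is small in L2 while 1 + norm z + norm w stays bounded
  in L2, so Cauchy-Schwarz sends the integrated difference to 0.\<close>

lemma L2_growth_tendsto:
  fixes u :: "'a::euclidean_space \<Rightarrow> real"
  assumes \<Omega>: "prob_space \<Omega>" and u: "\<And>z w. \<bar>u (z + w) - u z\<bar> \<le> K * (1 + norm z + norm w) * norm w"
    and meas: "u \<in> borel_measurable borel" and Z: "Z \<in> L2 \<Omega>" "\<And>k. Z' k \<in> L2 \<Omega>"
      "(\<lambda>k. L2dist \<Omega> (Z' k) Z) \<longlonglongrightarrow> 0" and K: "K \<ge> 0"
  shows "(\<lambda>k::nat. LINT w|\<Omega>. u (Z' k w)) \<longlonglongrightarrow> (LINT w|\<Omega>. u (Z w))"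
proof -
  interpret prob_space \<Omega> by fact
  let ?d = "\<lambda>k w. norm (Z' k w - Z w)"
  let ?e = "\<lambda>k. L2dist \<Omega> (Z' k) Z"
  have "(\<lambda>k. (LINT w|\<Omega>. u (Z' k w)) - (LINT w|\<Omega>. u (Z w))) \<longlonglongrightarrow> 0"
  proof (rule tendsto_0_le[where K = 1])
    show "(\<lambda>k. K * (?e k + L2norm \<Omega> Z * ?e k + ?e k * ?e k)) \<longlonglongrightarrow> 0"
      using Z(3) by (auto intro!: tendsto_eq_intros)
    show "\<forall>\<^sub>F k in sequentially. norm ((LINT w|\<Omega>. u (Z' k w)) - (LINT w|\<Omega>. u (Z w))) \<le>
        norm (K * (?e k + L2norm \<Omega> Z * ?e k + ?e k * ?e k)) * 1"
    proof (rule always_eventually, rule allI)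
      fix k
      have d: "(\<lambda>w. Z' k w - Z w) \<in> L2 \<Omega>" by (intro L2_diff Z)
      have nd: "?d k \<in> L2 \<Omega>" and nZ: "(\<lambda>w. norm (Z w)) \<in> L2 \<Omega>" using L2_norm[OF d] L2_norm[OF Z(1)] by auto
      have int: "integrable \<Omega> (\<lambda>w. u (Z' k w))" "integrable \<Omega> (\<lambda>w. u (Z w))"
        using L2_growth_integrable[OF \<Omega> u meas] Z by auto
      have int': "integrable \<Omega> (?d k)" "integrable \<Omega> (\<lambda>w. norm (Z w) * ?d k w)" "integrable \<Omega> (\<lambda>w. ?d k w * ?d k w)"
        using L2_integrable[OF nd] L2_integrable_mult[OF nZ nd] L2_integrable_mult[OF nd nd] by auto
      have "(LINT w|\<Omega>. u (Z' k w)) - (LINT w|\<Omega>. u (Z w)) = (LINT w|\<Omega>. u (Z' k w) - u (Z w))"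
        using int by simp
      also have "\<bar>\<dots>\<bar> \<le> (LINT w|\<Omega>. \<bar>u (Z' k w) - u (Z w)\<bar>)" by (rule integral_abs_bound)
      also have "\<dots> \<le> (LINT w|\<Omega>. K * (?d k w + norm (Z w) * ?d k w + ?d k w * ?d k w))"
      proof (rule integral_mono)
        show "\<bar>u (Z' k w) - u (Z w)\<bar> \<le> K * (?d k w + norm (Z w) * ?d k w + ?d k w * ?d k w)" for w
          using u[of "Z w" "Z' k w - Z w"] by (simp add: algebra_simps)
      qed (use int int' in auto)
      also have "\<dots> = K * ((LINT w|\<Omega>. ?d k w) + (LINT w|\<Omega>. norm (Z w) * ?d k w) + (LINT w|\<Omega>. ?d k w * ?d k w))"
        using int' by simp
      also have "\<dots> \<le> K * (?e k + L2norm \<Omega> Z * ?e k + ?e k * ?e k)"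
        using L2_integral_norm_le[OF d] L2_integral_mult_le[OF Z(1) d] L2_integral_mult_le[OF d d] K
        by (intro mult_left_mono add_mono) auto
      finally show "norm ((LINT w|\<Omega>. u (Z' k w)) - (LINT w|\<Omega>. u (Z w))) \<le>
          norm (K * (?e k + L2norm \<Omega> Z * ?e k + ?e k * ?e k)) * 1" by simp
    qed
  qed
  then show ?thesis by (simp add: LIM_zero_iff)
qed

text \<open>At fixed \<open>z\<close> the growth bound is a modulus of continuity.\<close>

lemma growth_measurable:
  fixes u :: "'a::euclidean_space \<Rightarrow> real"
  assumes u: "\<And>z w. \<bar>u (z + w) - u z\<bar> \<le> K * (1 + norm z + norm w) * norm w"
  shows "u \<in> borel_measurable borel"
proof (rule borel_measurable_continuous_onI, unfold continuous_on_eq_continuous_at[OF open_UNIV], intro ballI)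
  fix x
  have "((\<lambda>y. u y - u x) \<longlongrightarrow> 0) (at x)"
  proof (rule Lim_null_comparison)
    show "\<forall>\<^sub>F y in at x. norm (u y - u x) \<le> K * (1 + norm x + norm (y - x)) * norm (y - x)"
    proof (rule always_eventually, rule allI)
      fix y show "norm (u y - u x) \<le> K * (1 + norm x + norm (y - x)) * norm (y - x)"
        using u[of x "y - x"] by simp
    qed
    show "((\<lambda>y. K * (1 + norm x + norm (y - x)) * norm (y - x)) \<longlongrightarrow> 0) (at x)"
      by (auto intro!: tendsto_eq_intros)
  qed
  then show "isCont u x" by (simp add: isCont_def LIM_zero_iff)
qed

text \<open>
  Passing to the adjoint matrices turns the linear part of the cost, including the mean-field term, into
  the inner product of \<open>(p\<^sub>1, p\<^sub>2)\<close> with an element of \<open>L\<^sup>2\<close> that depends only on the control.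
\<close>

lemma control_cost_split:
  fixes p1 :: "'w \<Rightarrow> real^'m" and p2 Q :: "'w \<Rightarrow> real^'n"
  assumes \<Omega>: "prob_space \<Omega>" and L2: "p1 \<in> L2 \<Omega>" "p2 \<in> L2 \<Omega>" "\<xi> \<in> L2 \<Omega>"
    and int: "integrable \<Omega> (\<lambda>w. U (\<xi> w) (Q w) (law \<Omega> \<xi>))"
  shows "control_cost \<Omega> \<phi> \<phi>' U Q p1 p2 \<xi> =
    (LINT w|\<Omega>. (p1 w, p2 w) \<bullet> (- \<xi> w, - (\<phi> *v \<xi> w) - \<phi>' *v (LINT w'|\<Omega>. \<xi> w')))
    + (LINT w|\<Omega>. U (\<xi> w) (Q w) (law \<Omega> \<xi>))"
    and "(\<lambda>w. (- \<xi> w, - (\<phi> *v \<xi> w) - \<phi>' *v (LINT w'|\<Omega>. \<xi> w'))) \<in> L2 \<Omega>"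
proof -
  interpret prob_space \<Omega> by fact
  have matrix_L2: "(\<lambda>w. A *v X w) \<in> L2 \<Omega>" if X: "X \<in> L2 \<Omega>" for A :: "real^'a^'b" and X
  proof -
    obtain K where K: "\<And>x. norm (A *v x) \<le> norm x * K"
      using bounded_linear.nonneg_bounded[OF matrix_vector_mul_bounded_linear[of A]] by blast
    show ?thesis
    proof (rule L2_dominated[OF X, where c = K])
      have "continuous_on UNIV ((*v) A)"
        by (intro linear_continuous_on matrix_vector_mul_bounded_linear)
      from measurable_compose[OF L2_measurable[OF X] borel_measurable_continuous_onI[OF this]]
      show "(\<lambda>w. A *v X w) \<in> borel_measurable \<Omega>" .
    qed (use K in \<open>simp add: mult.commute\<close>)
  qed
  have adjoint: "(transpose A *v x) \<bullet> y = x \<bullet> (A *v y)" for A :: "real^'m^'n" and x y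
    by (metis dot_lmul_matrix transpose_matrix_vector)
  have neg: "(\<lambda>w. - X w) \<in> L2 \<Omega>" if "X \<in> L2 \<Omega>" for X :: "'w \<Rightarrow> 'a::euclidean_space"
    using L2_scaleR[OF that, of "-1"] by simp
  define c where "c = (LINT w|\<Omega>. p2 w)"
  define e where "e = (LINT w|\<Omega>. \<xi> w)"
  show \<Xi>: "(\<lambda>w. (- \<xi> w, - (\<phi> *v \<xi> w) - \<phi>' *v (LINT w'|\<Omega>. \<xi> w'))) \<in> L2 \<Omega>"
    by (intro L2_Pair L2_diff neg matrix_L2 L2_const L2)
  have i1: "integrable \<Omega> (\<lambda>w. p1 w \<bullet> \<xi> w)" by (intro L2_integrable_inner L2)
  have i2: "integrable \<Omega> (\<lambda>w. p2 w \<bullet> (\<phi> *v \<xi> w))" by (intro L2_integrable_inner L2 matrix_L2)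
  have i3: "integrable \<Omega> (\<lambda>w. c \<bullet> (\<phi>' *v \<xi> w))" by (intro L2_integrable_inner L2 matrix_L2 L2_const)
  have i4: "integrable \<Omega> (\<lambda>w. p2 w \<bullet> (\<phi>' *v e))" by (intro L2_integrable_inner L2 L2_const)
  \<comment> \<open>Both sides equal the inner product of \<open>c\<close> with the image of
    \<open>e\<close>: the mean of \<open>p2\<close> paired with the control is traded for
    \<open>p2\<close> paired with the mean of the control.\<close>
  have mean: "(LINT w|\<Omega>. c \<bullet> (\<phi>' *v \<xi> w)) = (LINT w|\<Omega>. p2 w \<bullet> (\<phi>' *v e))"
  proof -
    have "(LINT w|\<Omega>. c \<bullet> (\<phi>' *v \<xi> w)) = (LINT w|\<Omega>. (transpose \<phi>' *v c) \<bullet> \<xi> w)" by (simp only: adjoint)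
    also have "\<dots> = (transpose \<phi>' *v c) \<bullet> e"
      unfolding e_def by (rule integral_inner_right) (use L2_integrable[OF L2(3)] in auto)
    also have "\<dots> = c \<bullet> (\<phi>' *v e)" by (rule adjoint)
    also have "\<dots> = (LINT w|\<Omega>. p2 w \<bullet> (\<phi>' *v e))"
      unfolding c_def by (rule integral_inner_left[symmetric]) (use L2_integrable[OF L2(2)] in auto)
    finally show ?thesis .
  qed
  have "control_cost \<Omega> \<phi> \<phi>' U Q p1 p2 \<xi> =
      (LINT w|\<Omega>. - (p1 w \<bullet> \<xi> w) - p2 w \<bullet> (\<phi> *v \<xi> w) - c \<bullet> (\<phi>' *v \<xi> w) + U (\<xi> w) (Q w) (law \<Omega> \<xi>))"
    unfolding control_cost_def c_def[symmetric]
    by (simp add: inner_diff_left adjoint del: transpose_matrix_vector)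
  also have "\<dots> = - (LINT w|\<Omega>. p1 w \<bullet> \<xi> w) - (LINT w|\<Omega>. p2 w \<bullet> (\<phi> *v \<xi> w)) - (LINT w|\<Omega>. p2 w \<bullet> (\<phi>' *v e))
      + (LINT w|\<Omega>. U (\<xi> w) (Q w) (law \<Omega> \<xi>))"
    using i1 i2 i3 int by (simp add: mean)
  also have "\<dots> = (LINT w|\<Omega>. (p1 w, p2 w) \<bullet> (- \<xi> w, - (\<phi> *v \<xi> w) - \<phi>' *v e))
      + (LINT w|\<Omega>. U (\<xi> w) (Q w) (law \<Omega> \<xi>))"
    using i1 i2 i4 by (simp add: inner_diff_right)
  finally show "control_cost \<Omega> \<phi> \<phi>' U Q p1 p2 \<xi> =
    (LINT w|\<Omega>. (p1 w, p2 w) \<bullet> (- \<xi> w, - (\<phi> *v \<xi> w) - \<phi>' *v (LINT w'|\<Omega>. \<xi> w')))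
    + (LINT w|\<Omega>. U (\<xi> w) (Q w) (law \<Omega> \<xi>))" unfolding e_def .
qed

text \<open>The five terms converge separately. All components are read off from one L2 variable by
  linear contractions, so each inherits the convergence of \<open>X'\<close>.\<close>

lemma hamiltonian_L2_continuous:
  fixes \<Omega> :: "'w measure"
    and lam \<rho> \<kappa>1 \<kappa>2 C \<delta> :: real
    and \<phi> \<phi>' :: "real^'m::finite^'n::finite"
    and U :: "real^'m \<Rightarrow> real^'n \<Rightarrow> (real^'m) measure \<Rightarrow> real"
    and H :: "(((real^'m) \<times> (real^'n)) \<times> ((real^'m) \<times> (real^'n))) measure \<Rightarrow> real"
    and X :: "'w \<Rightarrow> (((real^'m) \<times> (real^'n)) \<times> ((real^'m) \<times> (real^'n)))"
  assumes \<Omega>: "prob_space \<Omega>" and \<delta>: "\<delta> > 0"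
    and f: "wasserstein_derivs \<Omega> 6 f Df"
    and \<Phi>: "euclidean_derivs 6 \<Phi> D\<Phi>"
    and U: "mixed_derivs \<Omega> 6 (\<lambda>(x, q). U x q) DU"
    and U_bound: "mixed_derivs_bounded_by C 2 6 DU"
    and hess_\<Phi>: "\<And>\<alpha> v. hess D\<Phi> \<alpha> v \<ge> \<delta> * (v \<bullet> v)"
    and hess_U: "\<And>x q \<mu> v. \<mu> \<in> P2 \<Longrightarrow> hess_QQ DU x q \<mu> v \<le> 0"
    and H: "is_hamiltonian \<Omega> lam \<rho> \<kappa>1 \<kappa>2 \<phi> \<phi>' f \<Phi> U H"
    and X: "X \<in> L2 \<Omega>" and X': "\<And>k. X' k \<in> L2 \<Omega>"
    and lim: "(\<lambda>k. L2dist \<Omega> (X' k) X) \<longlonglongrightarrow> 0"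
  shows "(\<lambda>k::nat. H (law \<Omega> (X' k))) \<longlonglongrightarrow> H (law \<Omega> X)"
proof -
  interpret prob_space \<Omega> by fact
  define m q r s p where "m = (\<lambda>x :: ((real^'m) \<times> (real^'n)) \<times> ((real^'m) \<times> (real^'n)). fst (fst x))"
    and "q = (\<lambda>x :: ((real^'m) \<times> (real^'n)) \<times> ((real^'m) \<times> (real^'n)). snd (fst x))"
    and "r = (\<lambda>x :: ((real^'m) \<times> (real^'n)) \<times> ((real^'m) \<times> (real^'n)). fst (snd x))"
    and "s = (\<lambda>x :: ((real^'m) \<times> (real^'n)) \<times> ((real^'m) \<times> (real^'n)). snd (snd x))"
    and "p = (\<lambda>x :: ((real^'m) \<times> (real^'n)) \<times> ((real^'m) \<times> (real^'n)). snd x)"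
  note proj_defs = m_def q_def r_def s_def p_def
  have norm_fst: "norm (fst z) \<le> norm z" and norm_snd: "norm (snd z) \<le> norm z"
    for z :: "'x::real_normed_vector \<times> 'y::real_normed_vector"
    using norm_fst_le[of "fst z" "snd z"] norm_snd_le[of "snd z" "fst z"] by auto
  have proj_norm: "norm (m x) \<le> norm x" "norm (q x) \<le> norm x" "norm (r x) \<le> norm x" "norm (s x) \<le> norm x"
    "norm (p x) \<le> norm x" for x
    unfolding proj_defs by (meson norm_fst norm_snd order_trans)+
  have proj_meas: "m \<in> borel_measurable borel" "q \<in> borel_measurable borel" "r \<in> borel_measurable borel"
    "s \<in> borel_measurable borel" "p \<in> borel_measurable borel"
    unfolding proj_defs by (intro borel_measurable_continuous_onI continuous_intros)+
  note proj_L2 = L2_contraction[OF proj_meas(1) proj_norm(1)] L2_contraction[OF proj_meas(2) proj_norm(2)]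
    L2_contraction[OF proj_meas(3) proj_norm(3)] L2_contraction[OF proj_meas(4) proj_norm(4)]
    L2_contraction[OF proj_meas(5) proj_norm(5)]
  have proj_lim: "(\<lambda>k. L2norm \<Omega> (\<lambda>w. T (Y' k w) - T (Y w))) \<longlonglongrightarrow> 0"
    if T: "T \<in> borel_measurable borel" "\<And>x. norm (T x) \<le> norm x" "\<And>x y. T (x - y) = T x - T y"
      and Y: "Y \<in> L2 \<Omega>" "\<And>k. Y' k \<in> L2 \<Omega>" "(\<lambda>k. L2dist \<Omega> (Y' k) Y) \<longlonglongrightarrow> 0"
    for T :: "((real^'m) \<times> (real^'n)) \<times> ((real^'m) \<times> (real^'n)) \<Rightarrow> 'c::euclidean_space" and Y and Y' :: "nat \<Rightarrow> _"
  proof (rule tendsto_sandwich[OF _ _ tendsto_const Y(3)])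
    have "L2norm \<Omega> (\<lambda>w. T (Y' k w - Y w)) \<le> L2dist \<Omega> (Y' k) Y" for k
      using L2_contraction[OF T(1,2) L2_diff[OF Y(2,1)]]
      by (intro L2norm_mono L2_diff Y T(2)) (auto intro: L2_measurable)
    then show "\<forall>\<^sub>F k in sequentially. L2norm \<Omega> (\<lambda>w. T (Y' k w) - T (Y w)) \<le> L2dist \<Omega> (Y' k) Y"
      by (simp add: T(3))
  qed simp
  note m_lim = proj_lim[OF proj_meas(1) proj_norm(1)] and q_lim = proj_lim[OF proj_meas(2) proj_norm(2)]
    and s_lim = proj_lim[OF proj_meas(4) proj_norm(4)] and p_lim = proj_lim[OF proj_meas(5) proj_norm(5)]
  have proj_diff: "m (x - y) = m x - m y" "q (x - y) = q x - q y" "s (x - y) = s x - s y" "p (x - y) = p x - p y" for x y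
    by (simp_all add: proj_defs)
  define cost where "cost \<xi> Y = control_cost \<Omega> \<phi> \<phi>' U (\<lambda>w. q (Y w)) (\<lambda>w. r (Y w)) (\<lambda>w. s (Y w)) \<xi>" for \<xi> Y
  define \<Xi> where "\<Xi> \<xi> w = (- \<xi> w, - (\<phi> *v \<xi> w) - \<phi>' *v (LINT w'|\<Omega>. \<xi> w'))" for \<xi> w
  define u where "u \<xi> z = (case z of (x, y) \<Rightarrow> U x y (law \<Omega> \<xi>))" for \<xi> z
  let ?E = "\<lambda>\<xi> Y. LINT w|\<Omega>. U (\<xi> w) (q (Y w)) (law \<Omega> \<xi>)"
  have u_growth: "\<exists>K\<ge>0. \<forall>z w. \<bar>u \<xi> (z + w) - u \<xi> z\<bar> \<le> K * (1 + norm z + norm w) * norm w"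
    if \<xi>: "\<xi> \<in> L2 \<Omega>" for \<xi>
  proof -
    obtain K where "K \<ge> 0" "\<And>x q x' q'. \<bar>U (x + x') (q + q') (law \<Omega> \<xi>) - U x q (law \<Omega> \<xi>)\<bar> \<le>
        K * (1 + norm (x, q) + norm (x', q')) * norm (x', q')"
      using mixed_derivs_growth[OF U U_bound P2_law[OF \<Omega> \<xi>]] by blast
    then show ?thesis by (intro exI[of _ K]) (auto simp: u_def split_paired_all)
  qed
  \<comment> \<open>Without integrability the integral in \<open>control_cost\<close> could be the
    default value 0, and it could not be split into a linear part and a part from
    \<open>U\<close>.\<close>
  have u_int: "integrable \<Omega> (\<lambda>w. U (\<xi> w) (q (Y w)) (law \<Omega> \<xi>))" if \<xi>: "\<xi> \<in> L2 \<Omega>" and Y: "Y \<in> L2 \<Omega>" for \<xi> Y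
  proof -
    obtain K where K: "\<And>z w. \<bar>u \<xi> (z + w) - u \<xi> z\<bar> \<le> K * (1 + norm z + norm w) * norm w"
      using u_growth[OF \<xi>] by blast
    from L2_growth_integrable[OF \<Omega> K growth_measurable[OF K] L2_Pair[OF \<xi> proj_L2(2)[OF Y]]]
    show ?thesis by (simp add: u_def)
  qed
  have cost_eq: "cost \<xi> Y = (LINT w|\<Omega>. p (Y w) \<bullet> \<Xi> \<xi> w) + ?E \<xi> Y"
    and \<Xi>_L2: "\<Xi> \<xi> \<in> L2 \<Omega>"
    if \<xi>: "\<xi> \<in> L2 \<Omega>" and Y: "Y \<in> L2 \<Omega>" for \<xi> Y
    using control_cost_split[where U = U and Q = "\<lambda>w. q (Y w)" and \<phi> = \<phi> and \<phi>' = \<phi>',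
        OF \<Omega> proj_L2(3)[OF Y] proj_L2(4)[OF Y] \<xi> u_int[OF \<xi> Y]]
    unfolding cost_def \<Xi>_def[abs_def] by (simp_all add: proj_defs)
  have "(\<lambda>k. INF \<xi>\<in>L2 \<Omega>. cost \<xi> (X' k)) \<longlonglongrightarrow> (INF \<xi>\<in>L2 \<Omega>. cost \<xi> X)"
  proof (rule L2_concave_INF_continuous[where c = cost, OF _ _ _ _ X X' lim])
    show "L2 \<Omega> \<noteq> ({} :: ('w \<Rightarrow> real^'m) set)" using L2_const by blast
    show "bdd_below ((\<lambda>\<xi>. cost \<xi> Y) ` L2 \<Omega>)" if Y: "Y \<in> L2 \<Omega>" for Y
      using H[unfolded is_hamiltonian_def, rule_format, OF proj_L2(1)[OF Y] proj_L2(2)[OF Y] proj_L2(3)[OF Y] proj_L2(4)[OF Y]]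
      unfolding cost_def by (rule conjunct1)
    \<comment> \<open>The first integral in \<open>cost_eq\<close> is linear in (p1, p2) and the
      second is concave in \<open>Q\<close>. As they involve separate components of
      \<open>Y\<close>, the sum is concave in \<open>Y\<close> as a whole.\<close>
    show "(1 - t) * cost \<xi> Y + t * cost \<xi> Z \<le> cost \<xi> (\<lambda>w. (1 - t) *\<^sub>R Y w + t *\<^sub>R Z w)"
      if \<xi>: "\<xi> \<in> L2 \<Omega>" and Y: "Y \<in> L2 \<Omega>" and Z: "Z \<in> L2 \<Omega>" and t: "0 \<le> t" "t \<le> 1" for \<xi> Y Z t
    proof -
      let ?W = "\<lambda>w. (1 - t) *\<^sub>R Y w + t *\<^sub>R Z w"
      have W: "?W \<in> L2 \<Omega>" by (intro L2_add L2_scaleR Y Z)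
      have "(LINT w|\<Omega>. p (?W w) \<bullet> \<Xi> \<xi> w) =
          (1 - t) * (LINT w|\<Omega>. p (Y w) \<bullet> \<Xi> \<xi> w) + t * (LINT w|\<Omega>. p (Z w) \<bullet> \<Xi> \<xi> w)"
        using L2_integrable_inner[OF proj_L2(5)[OF Y] \<Xi>_L2[OF \<xi> Y]]
          L2_integrable_inner[OF proj_L2(5)[OF Z] \<Xi>_L2[OF \<xi> Z]]
        by (simp add: p_def inner_add_left)
      moreover have "(1 - t) * ?E \<xi> Y +
          t * ?E \<xi> Z \<le> ?E \<xi> ?W"
      proof -
        have "(1 - t) * ?E \<xi> Y +
            t * ?E \<xi> Z =
            (LINT w|\<Omega>. (1 - t) * U (\<xi> w) (q (Y w)) (law \<Omega> \<xi>) + t * U (\<xi> w) (q (Z w)) (law \<Omega> \<xi>))"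
          using u_int[OF \<xi> Y] u_int[OF \<xi> Z] by simp
        also have "\<dots> \<le> ?E \<xi> ?W"
        proof (rule integral_mono)
          fix w
          have "q (?W w) = (1 - t) *\<^sub>R q (Y w) + t *\<^sub>R q (Z w)" by (simp add: q_def)
          then show "(1 - t) * U (\<xi> w) (q (Y w)) (law \<Omega> \<xi>) + t * U (\<xi> w) (q (Z w)) (law \<Omega> \<xi>) \<le>
              U (\<xi> w) (q (?W w)) (law \<Omega> \<xi>)"
            using mixed_derivs_concave[OF U U_bound hess_U[OF P2_law[OF \<Omega> \<xi>]] P2_law[OF \<Omega> \<xi>] t] by simp
        qed (use u_int[OF \<xi> Y] u_int[OF \<xi> Z] u_int[OF \<xi> W] in auto)
        finally show ?thesis .
      qed
      ultimately show ?thesis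
        unfolding cost_eq[OF \<xi> Y] cost_eq[OF \<xi> Z] cost_eq[OF \<xi> W] by (simp add: algebra_simps)
    qed
    show "(\<lambda>k. cost \<xi> (Y' k)) \<longlonglongrightarrow> cost \<xi> Y"
      if \<xi>: "\<xi> \<in> L2 \<Omega>" and Y: "Y \<in> L2 \<Omega>" "\<And>k. Y' k \<in> L2 \<Omega>" "(\<lambda>k. L2dist \<Omega> (Y' k) Y) \<longlonglongrightarrow> 0"
      for \<xi> Y and Y' :: "nat \<Rightarrow> _"
    proof -
      have "(\<lambda>k. LINT w|\<Omega>. p (Y' k w) \<bullet> \<Xi> \<xi> w) \<longlonglongrightarrow> (LINT w|\<Omega>. p (Y w) \<bullet> \<Xi> \<xi> w)"
        using p_lim[OF proj_diff(4) Y] \<Xi>_L2[OF \<xi> Y(1)] proj_L2(5) Y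
        by (intro L2_inner_tendsto) (auto simp: L2norm_def)
      moreover have "(\<lambda>k. LINT w|\<Omega>. U (\<xi> w) (q (Y' k w)) (law \<Omega> \<xi>)) \<longlonglongrightarrow> ?E \<xi> Y"
      proof -
        obtain K where K: "K \<ge> 0" "\<And>z w. \<bar>u \<xi> (z + w) - u \<xi> z\<bar> \<le> K * (1 + norm z + norm w) * norm w"
          using u_growth[OF \<xi>] by blast
        have "(\<lambda>k. LINT w|\<Omega>. u \<xi> (\<xi> w, q (Y' k w))) \<longlonglongrightarrow> (LINT w|\<Omega>. u \<xi> (\<xi> w, q (Y w)))"
        proof (rule L2_growth_tendsto[OF \<Omega> K(2) growth_measurable[OF K(2)] _ _ _ K(1)])
          show "(\<lambda>k. L2norm \<Omega> (\<lambda>w. (\<xi> w, q (Y' k w)) - (\<xi> w, q (Y w)))) \<longlonglongrightarrow> 0"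
            using q_lim[OF proj_diff(2) Y] by (simp add: L2norm_def norm_Pair)
        qed (intro L2_Pair \<xi> proj_L2 Y)+
        then show ?thesis by (simp add: u_def)
      qed
      ultimately show ?thesis
        unfolding cost_eq[OF \<xi> Y(1)] cost_eq[OF \<xi> Y(2)] by (rule tendsto_add)
    qed
  qed
  moreover have "(\<lambda>k. LINT w|\<Omega>. q (X' k w) \<bullet> s (X' k w)) \<longlonglongrightarrow> (LINT w|\<Omega>. q (X w) \<bullet> s (X w))"
    by (intro L2_inner_tendsto q_lim s_lim proj_diff proj_L2 X X' lim)
  moreover have "(\<lambda>k. LINT w|\<Omega>. (norm (s (X' k w)))\<^sup>2) \<longlonglongrightarrow> (LINT w|\<Omega>. (norm (s (X w)))\<^sup>2)"
    unfolding power2_norm_eq_inner by (intro L2_inner_tendsto s_lim proj_diff proj_L2 X X' lim)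
  moreover have "(\<lambda>k. f (law \<Omega> (\<lambda>w. m (X' k w)))) \<longlonglongrightarrow> f (law \<Omega> (\<lambda>w. m (X w)))"
  proof -
    have "multi_index []" "only_measure_derivs []" "total_order [] < 6"
      by (auto simp: multi_index_def only_measure_derivs_def total_order_def)
    then have "has_wasserstein_derivative \<Omega> (\<lambda>\<nu>. Df [] \<nu> [])
        (\<lambda>x. \<Sum>v\<in>Basis. Df [[v]] (law \<Omega> (\<lambda>w. m (X w))) [x] *\<^sub>R v) (law \<Omega> (\<lambda>w. m (X w)))"
      using f P2_law[OF \<Omega> proj_L2(1)[OF X]] unfolding wasserstein_derivs_def by fastforce
    from wasserstein_derivative_continuous[OF this proj_L2(1)[OF X] proj_L2(1)[OF X'] m_lim[OF proj_diff(1) X X' lim]]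
    have "(\<lambda>k. Df [] (law \<Omega> (\<lambda>w. m (X' k w))) []) \<longlonglongrightarrow> Df [] (law \<Omega> (\<lambda>w. m (X w))) []" .
    moreover have "Df [] (law \<Omega> (\<lambda>w. m (Y w))) [] = f (law \<Omega> (\<lambda>w. m (Y w)))" if "Y \<in> L2 \<Omega>" for Y
      using f P2_law[OF \<Omega> proj_L2(1)[OF that]] unfolding wasserstein_derivs_def by blast
    ultimately show ?thesis using X X' by simp
  qed
  moreover have "(\<lambda>k. convex_conjugate \<Phi> (\<kappa>1 *\<^sub>R (LINT w|\<Omega>. s (X' k w)))) \<longlonglongrightarrow>
      convex_conjugate \<Phi> (\<kappa>1 *\<^sub>R (LINT w|\<Omega>. s (X w)))"
  proof (rule continuous_on_tendsto_compose[OF convex_conjugate_continuous[OF \<Phi> _ hess_\<Phi> \<delta>]])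
    show "(\<lambda>k. \<kappa>1 *\<^sub>R (LINT w|\<Omega>. s (X' k w))) \<longlonglongrightarrow> \<kappa>1 *\<^sub>R (LINT w|\<Omega>. s (X w))"
      by (intro tendsto_intros L2_integral_tendsto s_lim proj_diff proj_L2 X X' lim)
  qed auto
  moreover have "H (law \<Omega> Y) = (INF \<xi> \<in> L2 \<Omega>. cost \<xi> Y) - \<rho> * (LINT w|\<Omega>. q (Y w) \<bullet> s (Y w))
      + f (law \<Omega> (\<lambda>w. m (Y w))) + \<kappa>2\<^sup>2 / (4 * lam) * (LINT w|\<Omega>. (norm (s (Y w)))\<^sup>2)
      + convex_conjugate \<Phi> (\<kappa>1 *\<^sub>R (LINT w|\<Omega>. s (Y w)))" if Y: "Y \<in> L2 \<Omega>" for Y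
  proof -
    have "(\<lambda>w. ((m (Y w), q (Y w)), (r (Y w), s (Y w)))) = Y" by (simp add: proj_defs fun_eq_iff)
    then show ?thesis
      using H[unfolded is_hamiltonian_def, rule_format, OF proj_L2(1)[OF Y] proj_L2(2)[OF Y] proj_L2(3)[OF Y] proj_L2(4)[OF Y]]
      unfolding cost_def by simp
  qed
  ultimately show ?thesis
    using X X' by (auto simp del: times_divide_eq_left intro!: tendsto_add tendsto_diff tendsto_mult tendsto_const)
qed

theorem lemma2p10:
  fixes \<Omega> :: "'w measure"
    and lam \<rho> \<kappa>1 \<kappa>2 C \<delta> :: real
    and \<phi> \<phi>' :: "real^'m::finite^'n::finite"
    and f :: "(real^'m) measure \<Rightarrow> real"
    and \<Phi> :: "real^'n \<Rightarrow> real"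
    and U :: "real^'m \<Rightarrow> real^'n \<Rightarrow> (real^'m) measure \<Rightarrow> real"
    and Df :: "(real^'m) list list \<Rightarrow> (real^'m) measure \<Rightarrow> (real^'m) list \<Rightarrow> real"
    and D\<Phi> :: "(real^'n) list \<Rightarrow> real^'n \<Rightarrow> real"
    and DU :: "('m, 'n) U_derivs"
    and H :: "(((real^'m) \<times> (real^'n)) \<times> ((real^'m) \<times> (real^'n))) measure \<Rightarrow> real"
  assumes "rich_prob_space \<Omega>"
    and "lam > 0" and "\<rho> > 0" and "\<kappa>1 \<ge> 0" and "\<kappa>2 \<ge> 0" and "C > 0" and "\<delta> > 0"
    and "wasserstein_derivs \<Omega> 6 f Df"
    and "euclidean_derivs 6 \<Phi> D\<Phi>"
    and "mixed_derivs \<Omega> 6 (\<lambda>(x, q). U x q) DU"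
    and "derivs_bounded_by C 2 6 Df"
    and "mixed_derivs_bounded_by C 2 6 DU"
    and "\<And>\<alpha> v. hess D\<Phi> \<alpha> v \<ge> \<delta> * (v \<bullet> v)"
    and "displacement_convex \<Omega> f"
    and "\<And>x q \<mu> v. \<mu> \<in> P2 \<Longrightarrow> hess_QQ DU x q \<mu> v \<le> 0"
    and "displacement_monotone \<Omega> \<delta> DU"
    and "is_hamiltonian \<Omega> lam \<rho> \<kappa>1 \<kappa>2 \<phi> \<phi>' f \<Phi> U H"
  shows "\<exists>Hn :: nat \<Rightarrow> (((real^'m) \<times> (real^'n)) \<times> ((real^'m) \<times> (real^'n))) measure \<Rightarrow> real.
           (\<forall>n\<ge>1. Hn n \<in> C_wasserstein_bounded \<Omega> 6) \<and>
           (\<forall>\<mu> \<in> P2. (\<lambda>n. Hn n \<mu>) \<longlonglongrightarrow> H \<mu>)"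
proof -
  have "prob_space \<Omega>" using assms(1) by (simp add: rich_prob_space_def)
  from hamiltonian_L2_continuous[OF this assms(7-10,12,13,15,17)]
  have "\<exists>Hn. (\<forall>n. Hn n \<in> C_wasserstein_bounded \<Omega> 6) \<and> (\<forall>\<mu>\<in>P2. (\<lambda>n. Hn n \<mu>) \<longlonglongrightarrow> H \<mu>)"
    by (rule L2_continuous_approximation[OF assms(1)])
  then show ?thesis by blast
qed

end
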